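(* Assume that $P_X$ satisfies the following two conditions. (Small-ball condition) There are constants $C\ge1$ and $\alpha\in(0,1]$ such that for every $\theta\in\mathbb R^d\setminus\{0\}$ and $t>0$, $\mathbb P\big(|\langle\theta,X\rangle|\le t\,\|\Sigma^{1/2}\theta\|\big)\le(Ct)^\alpha$. (Norm kurtosis) $\mathbb E\big[\|\Sigma^{-1/2}X\|^4\big]\le\kappa d^2$ for some $\kappa>0$. Let $C'=3C^4e^{1+9/\alpha}$. If $n\ge\max\big(6\alpha^{-1}d,\ 12\alpha^{-1}\log(12\alpha^{-1})\big)$, then $$\frac1n\,\mathbb E\big[\operatorname{tr}(\widetilde\Sigma_n^{-1})\big]\le\frac dn+8C'\kappa\Big(\frac dn\Big)^2 .$$ In particular, the minimax excess risk over the class $\mathcal P_{\mathrm{well}}(P_X,\sigma^2)$ satisfies $$\frac{\sigma^2d}{n}\;\le\;\inf_{\widehat\beta_n}\ \sup_{P\in\mathcal P_{\mathrm{well}}(P_X,\sigma^2)}\mathbb E\big[\mathcal E_P(\widehat\beta_n)\big]\;\le\;\frac{\sigma^2d}{n}\Big(1+8C'\frac{\kappa d}{n}\Big).$$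
   Context: Let $n,d\ge 1$ be integers, $\sigma^2>0$, and let $P_X$ be a probability distribution on $\mathbb R^d$ such that, for $X\sim P_X$, $\mathbb E\|X\|^2<\infty$ and $\Sigma:=\mathbb E[XX^\top]$ is invertible. Let $X_1,\dots,X_n$ be i.i.d. from $P_X$, $\widehat\Sigma_n=\frac1n\sum_{i=1}^nX_iX_i^\top$ and $\widetilde\Sigma_n=\Sigma^{-1/2}\widehat\Sigma_n\Sigma^{-1/2}$ (almost surely invertible under the small-ball condition when $n\ge d$). The class $\mathcal P_{\mathrm{well}}(P_X,\sigma^2)$ consists of all joint distributions $P$ of $(X,Y)$ with $X\sim P_X$ and $Y=\langle\beta^*,X\rangle+\varepsilon$, where $\beta^*\in\mathbb R^d$ is arbitrary, $\mathbb E[\varepsilon|X]=0$ and $\mathbb E[\varepsilon^2|X]\le\sigma^2$. The risk of $\beta\in\mathbb R^d$ under $P$ is $R(\beta)=\mathbb E[(Y-\langle\beta,X\rangle)^2]$; it is uniquely minimized at $\beta^*$, and the excess risk is $\mathcal E_P(\beta)=R(\beta)-R(\beta^* )=\|\Sigma^{1/2}(\beta-\beta^* )\|^2$. An estimator $\widehat\beta_n$ is an $\mathbb R^d$-valued measurable function of an i.i.d. sample $(X_1,Y_1),\dots,(X_n,Y_n)$ from $P$; the infimum is over all estimators and the expectation is over the sample. *)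

theory Defs
  imports "HOL-Probability.Probability"
begin

definition outer :: "real ^ 'd \<Rightarrow> real ^ 'd ^ 'd" where
  "outer x = (\<chi> i j. x $ i * x $ j)"

definition second_moment :: "(real ^ 'd) measure \<Rightarrow> real ^ 'd ^ 'd" where
  "second_moment PX = (LINT x|PX. outer x)"

text \<open>The positive semidefinite square root; meaningful for symmetric positive semidefinite
  arguments, for which it exists and is unique.\<close>

definition psd_sqrt :: "real ^ 'd ^ 'd \<Rightarrow> real ^ 'd ^ 'd" where
  "psd_sqrt A = (THE S. transpose S = S \<and> (\<forall>x. 0 \<le> x \<bullet> (S *v x)) \<and> S ** S = A)"

definition sample_cov :: "nat \<Rightarrow> (nat \<Rightarrow> real ^ 'd) \<Rightarrow> real ^ 'd ^ 'd" where
  "sample_cov n X = (1 / real n) *\<^sub>R (\<Sum>k<n. outer (X k))"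

definition whitened_sample_cov ::
    "(real ^ 'd) measure \<Rightarrow> nat \<Rightarrow> (nat \<Rightarrow> real ^ 'd) \<Rightarrow> real ^ 'd ^ 'd" where
  "whitened_sample_cov PX n X =
     (let W = matrix_inv (psd_sqrt (second_moment PX)) in W ** sample_cov n X ** W)"

text \<open>Since \<^const>\<open>matrix_inv\<close> is unspecified on singular matrices, the trace of the inverse is
  taken to be infinite there. Hence a finite expectation below entails almost sure invertibility.\<close>

definition trace_inv :: "real ^ 'd ^ 'd \<Rightarrow> ennreal" where
  "trace_inv A = (if invertible A then ennreal (trace (matrix_inv A)) else \<infinity>)"

definition expected_trace_inv :: "(real ^ 'd) measure \<Rightarrow> nat \<Rightarrow> ennreal" where
  "expected_trace_inv PX n =
     (\<integral>\<^sup>+ X. trace_inv (whitened_sample_cov PX n X) \<partial>(\<Pi>\<^sub>M k\<in>{..<n}. PX))"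

definition small_ball :: "(real ^ 'd) measure \<Rightarrow> real \<Rightarrow> real \<Rightarrow> bool" where
  "small_ball PX C \<alpha> \<longleftrightarrow>
     (\<forall>\<theta> t. \<theta> \<noteq> 0 \<longrightarrow> t > 0 \<longrightarrow>
        measure PX {x \<in> space PX. \<bar>\<theta> \<bullet> x\<bar> \<le> t * norm (psd_sqrt (second_moment PX) *v \<theta>)}
          \<le> (C * t) powr \<alpha>)"

text \<open>The nonnegative integral makes finiteness of the fourth moment part of the condition.\<close>

definition norm_kurtosis :: "(real ^ 'd) measure \<Rightarrow> real \<Rightarrow> bool" where
  "norm_kurtosis PX \<kappa> \<longleftrightarrow>
     (\<integral>\<^sup>+ x. ennreal (norm (matrix_inv (psd_sqrt (second_moment PX)) *v x) ^ 4) \<partial>PX)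
       \<le> ennreal (\<kappa> * real CARD('d) ^ 2)"

definition residual :: "real ^ 'd \<Rightarrow> (real ^ 'd) \<times> real \<Rightarrow> real" where
  "residual \<beta> z = snd z - \<beta> \<bullet> fst z"

definition risk :: "((real ^ 'd) \<times> real) measure \<Rightarrow> real ^ 'd \<Rightarrow> real" where
  "risk P \<beta> = (LINT z|P. (residual \<beta> z)\<^sup>2)"

text \<open>The \<open>\<sigma>\<close>-algebra generated by the covariate \<open>X = fst\<close>.\<close>

definition sigma_X :: "((real ^ 'd) \<times> real) measure \<Rightarrow> ((real ^ 'd) \<times> real) measure" where
  "sigma_X P = vimage_algebra (space P) fst borel"

text \<open>\<open>P\<close> is the law of \<open>(X, Y)\<close> with \<open>Y = \<langle>\<beta>, X\<rangle> + \<epsilon>\<close>. The conditional second moment of the noise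
  is the \<^typ>\<open>ennreal\<close>-valued one, because \<^const>\<open>real_cond_exp\<close> would
  collapse an infinite value to 0.\<close>

definition well_specified_at ::
    "(real ^ 'd) measure \<Rightarrow> real \<Rightarrow> ((real ^ 'd) \<times> real) measure \<Rightarrow> real ^ 'd \<Rightarrow> bool" where
  "well_specified_at PX \<sigma>2 P \<beta> \<longleftrightarrow>
     prob_space P \<and> sets P = sets borel \<and> distr P borel fst = PX \<and>
     integrable P (residual \<beta>) \<and>
     (AE z in P. real_cond_exp P (sigma_X P) (residual \<beta>) z = 0) \<and>
     (AE z in P. nn_cond_exp P (sigma_X P) (\<lambda>z. ennreal ((residual \<beta> z)\<^sup>2)) z \<le> ennreal \<sigma>2)"

definition P_well :: "(real ^ 'd) measure \<Rightarrow> real \<Rightarrow> ((real ^ 'd) \<times> real) measure set" where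
  "P_well PX \<sigma>2 = {P. \<exists>\<beta>. well_specified_at PX \<sigma>2 P \<beta>}"

text \<open>The regression parameter of a well-specified \<open>P\<close>; it is unique when
  \<open>E[X X\<^sup>T]\<close> is invertible.\<close>

definition true_param ::
    "(real ^ 'd) measure \<Rightarrow> real \<Rightarrow> ((real ^ 'd) \<times> real) measure \<Rightarrow> real ^ 'd" where
  "true_param PX \<sigma>2 P = (THE \<beta>. well_specified_at PX \<sigma>2 P \<beta>)"

definition excess_risk ::
    "(real ^ 'd) measure \<Rightarrow> real \<Rightarrow> ((real ^ 'd) \<times> real) measure \<Rightarrow> real ^ 'd \<Rightarrow> real" where
  "excess_risk PX \<sigma>2 P \<beta> = risk P \<beta> - risk P (true_param PX \<sigma>2 P)"

definition estimators :: "nat \<Rightarrow> ((nat \<Rightarrow> (real ^ 'd) \<times> real) \<Rightarrow> real ^ 'd) set" where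
  "estimators n = (\<Pi>\<^sub>M k\<in>{..<n}. borel) \<rightarrow>\<^sub>M borel"

definition minimax_excess_risk :: "(real ^ 'd) measure \<Rightarrow> real \<Rightarrow> nat \<Rightarrow> ennreal" where
  "minimax_excess_risk PX \<sigma>2 n =
     (INF b\<in>estimators n. SUP P\<in>P_well PX \<sigma>2.
        \<integral>\<^sup>+ z. ennreal (excess_risk PX \<sigma>2 P (b z)) \<partial>(\<Pi>\<^sub>M k\<in>{..<n}. P))"

end

theory Submission
  imports Defs
begin

text \<open>
  Let \<open>S\<close> be the square root of \<open>\<Sigma> = E[X X\<^sup>T]\<close>, let \<open>W = S\<^sup>-\<^sup>1\<close>, and let \<open>A\<close> be the sample
  covariance matrix of the whitened vectors \<open>W X\<^sub>k\<close>, so that \<open>E A = I\<close>.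

  \<^emph>\<open>The trace.\<close> From \<open>A\<^sup>-\<^sup>1 = 2 I - A + (A - I) A\<^sup>-\<^sup>1 (A - I)\<close> one gets
  \<open>tr A\<^sup>-\<^sup>1 \<le> 2 d - tr A + |A - I|\<^sup>2 / \<lambda>\<close>, where \<open>\<lambda>\<close> is the smallest eigenvalue and \<open>| \<cdot> |\<close> the
  Frobenius norm (\<open>trace_inv_le_second_order\<close>).  The first two terms have mean \<open>d\<close>, and
  \<open>E |A - I|\<^sup>2 \<le> \<kappa> d\<^sup>2 / n\<close> because the summands of \<open>A - I\<close> are independent and centred
  (\<open>sample_cov_deviation\<close>).  So the claim holds with constant \<open>4 C'\<close> on the event
  \<open>\<lambda> \<ge> 1 / (4 C')\<close>.  Off this event the crude bound \<open>tr A\<^sup>-\<^sup>1 \<le> d / \<lambda>\<close> is enough, since the tail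
  \<open>P(\<lambda> < t) \<le> (C' t)\<^bsup>\<alpha>n/6\<^esup>\<close> decays so fast that the dyadic levels \<open>\<lambda> \<approx> 2\<^bsup>-j\<^esup> / (4 C')\<close>
  together contribute at most another \<open>4 C' \<kappa> d\<^sup>2 / n\<close> (\<open>trace_inv_le_dyadic\<close>,
  \<open>sample_size_beats_tail\<close>, \<open>expected_trace_inv_sample_cov\<close>).

  \<^emph>\<open>The tail of the smallest eigenvalue\<close> (\<open>lower_tail_smallest_eigenvalue\<close>).  For one direction \<open>\<theta>\<close> the
  small-ball condition bounds the Laplace transform of \<open>\<langle>\<theta>, W X\<rangle>\<^sup>2\<close>, and Chernoff's inequality gives the
  tail of \<open>\<langle>\<theta>, A \<theta>\<rangle>\<close>.  A plain net over all directions would bring in the largest eigenvalue of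
  \<open>A\<close>, which may have heavy tails.  Instead a unit vector is rounded to a grid one coordinate at a
  time, each time to the better of the two neighbours; a quadratic form then grows by at most
  a quarter of the squared mesh times its trace (\<open>round_quadratic_to_grid\<close>).  The trace is at most \<open>d\<close>
  once every vector is clipped to length \<open>\<surd>d\<close>, which only decreases \<open>A\<close> and only weakens the
  small-ball exponent from \<open>\<alpha>\<close> to \<open>2 \<alpha> / 3\<close> (\<open>clip_small_ball\<close>).  The grid is small enough
  for a union bound because \<open>d \<le> \<alpha> n / 6\<close> (\<open>card_l1_ball_int\<close>, \<open>tail_constants\<close>).

  \<^emph>\<open>The upper bound on the minimax risk.\<close>  The excess risk of least squares is
  \<open>|\<Sum>\<^sub>k \<epsilon>\<^sub>k w\<^sub>k|\<^sup>2\<close> with \<open>w\<^sub>k = A\<^sup>-\<^sup>1 W X\<^sub>k / n\<close>.  The conditional moments of the noise remove the cross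
  terms, and \<open>\<Sum>\<^sub>k |w\<^sub>k|\<^sup>2 = tr A\<^sup>-\<^sup>1 / n\<close> (\<open>expected_excess_risk_ols\<close>).

  \<^emph>\<open>The lower bound\<close> (\<open>bayes_lower_bound\<close>).  Take Gaussian noise and put independent
  \<open>N(0, \<tau>\<^sup>2)\<close> priors on the coordinates of \<open>S \<beta>\<close>.  If all coordinates but the \<open>i\<close>-th are revealed, a
  conjugate Gaussian problem in one dimension remains; given the covariates, its Bayes risk is the
  inverse of \<open>\<Sum>\<^sub>k (W X\<^sub>k)\<^sub>i\<^sup>2 / \<sigma>\<^sup>2 + 1 / \<tau>\<^sup>2\<close>.  This information has mean \<open>n / \<sigma>\<^sup>2 + 1 / \<tau>\<^sup>2\<close>, so by
  Jensen's inequality the risk of each coordinate is at least the inverse of that mean.  Summing over the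
  \<open>d\<close> coordinates and letting \<open>\<tau>\<close> grow gives \<open>\<sigma>\<^sup>2 d / n\<close>.
\<close>

section \<open>Square roots of positive definite matrices\<close>

lemma matrix_inv_left_right:
  fixes A :: "real^'d^'d"
  assumes "invertible A"
  shows "matrix_inv A ** A = mat 1" "A ** matrix_inv A = mat 1"
proof -
  have "\<exists>B. A ** B = mat 1 \<and> B ** A = mat 1"
    using assms by (simp add: invertible_def)
  from someI_ex[OF this] show "matrix_inv A ** A = mat 1" "A ** matrix_inv A = mat 1"
    unfolding matrix_inv_def by auto
qed

lemma transpose_matrix_inv:
  fixes A :: "real^'d^'d"
  assumes sym: "transpose A = A" and inv: "invertible A"
  shows "transpose (matrix_inv A) = matrix_inv A"
proof -
  note AB = matrix_inv_left_right[OF inv]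
  have "transpose (matrix_inv A) = transpose (matrix_inv A) ** (A ** matrix_inv A)" by (simp add: AB)
  also have "\<dots> = transpose (A ** matrix_inv A) ** matrix_inv A"
    by (simp add: matrix_mul_assoc matrix_transpose_mul sym)
  finally show ?thesis by (simp add: AB)
qed

lemma inner_matrix_mult_symmetric:
  fixes S :: "real^'d^'d"
  assumes "transpose S = S"
  shows "x \<bullet> (S *v y) = (S *v x) \<bullet> y"
  by (metis assms dot_lmul_matrix vector_transpose_matrix)

text \<open>The form is nonnegative along the line \<open>x + t y\<close>, so its discriminant is not positive; the case
  in which it is linear in \<open>t\<close> has to be treated separately.\<close>

lemma psd_form_Cauchy_Schwarz:
  fixes S :: "real^'d^'d"
  assumes sym: "transpose S = S" and psd: "\<And>x. 0 \<le> x \<bullet> (S *v x)"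
  shows "(x \<bullet> (S *v y))\<^sup>2 \<le> (x \<bullet> (S *v x)) * (y \<bullet> (S *v y))"
proof -
  define a b c where "a = y \<bullet> (S *v y)" and "b = x \<bullet> (S *v y)" and "c = x \<bullet> (S *v x)"
  have b': "y \<bullet> (S *v x) = b"
    unfolding b_def inner_matrix_mult_symmetric[OF sym, of y] by (simp add: inner_commute)
  have q: "0 \<le> c + 2 * t * b + t\<^sup>2 * a" for t
    using psd[of "x + t *\<^sub>R y"] b'
    by (simp add: a_def b_def c_def matrix_vector_right_distrib matrix_vector_mult_scaleR inner_add_left
        inner_add_right
        power2_eq_square algebra_simps)
  have "b\<^sup>2 \<le> c * a"
  proof (cases "a = 0")
    case True
    have "b = 0"
    proof (rule ccontr)
      assume "b \<noteq> 0"
      with q[of "- (c + 1) / (2 * b)"] True show False by (simp add: field_simps)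
    qed
    with True show ?thesis by simp
  next
    case False
    hence "a > 0" using psd[of y] by (simp add: a_def)
    with q[of "- b / a"] have "0 \<le> c - b\<^sup>2 / a" by (simp add: power2_eq_square field_simps)
    with \<open>a > 0\<close> show ?thesis by (simp add: field_simps)
  qed
  thus ?thesis by (simp add: a_def b_def c_def mult.commute)
qed

lemma psd_form_zero_imp:
  fixes S :: "real^'d^'d"
  assumes sym: "transpose S = S" and psd: "\<And>x. 0 \<le> x \<bullet> (S *v x)" and "x \<bullet> (S *v x) = 0"
  shows "S *v x = 0"
  using psd_form_Cauchy_Schwarz[OF sym psd, of "S *v x" x] assms(3) by simp

lemma trace_eq_sum_axis:
  fixes A :: "real^'d^'d"
  shows "trace A = (\<Sum>i\<in>UNIV. axis i 1 \<bullet> (A *v axis i 1))"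
  by (simp add: trace_def inner_axis' matrix_vector_mul_component inner_axis)

lemma trace_sandwich:
  fixes A B :: "real^'d^'d"
  assumes "transpose B = B"
  shows "trace (B ** A ** B) = (\<Sum>i\<in>UNIV. (B *v axis i 1) \<bullet> (A *v (B *v axis i 1)))"
  unfolding trace_eq_sum_axis
  by (simp add: inner_matrix_mult_symmetric[OF assms, symmetric] matrix_vector_mul_assoc matrix_mul_assoc)

lemma matrix_mult_distribs:
  fixes A B C :: "real^'d^'d"
  shows "(A + B) ** C = A ** C + B ** C" "(A - B) ** C = A ** C - B ** C" "A ** (B - C) = A ** B - A ** C"
  by (simp_all add: matrix_matrix_mult_def vec_eq_iff sum.distrib sum_subtractf algebra_simps)

text \<open>For \<open>D = S - T\<close> the cyclic invariance of the trace makes \<open>tr (D (S + T) D)\<close> vanish whenever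
  \<open>S\<^sup>2 = T\<^sup>2\<close>, although \<open>S\<close> and \<open>T\<close> need not commute.  This trace is a sum of values of the two
  positive semidefinite forms at the columns of \<open>D\<close>, so \<open>S\<close> annihilates these columns; as
  \<open>S\<close> is injective, \<open>D = 0\<close>.\<close>

lemma psd_square_root_unique:
  fixes S T A :: "real^'d^'d"
  assumes S: "transpose S = S" "\<And>x. 0 \<le> x \<bullet> (S *v x)" "S ** S = A"
    and T: "transpose T = T" "\<And>x. 0 \<le> x \<bullet> (T *v x)" "T ** T = A"
    and inv: "invertible A"
  shows "S = T"
proof -
  define D where "D = S - T"
  have symD: "transpose D = D" using S(1) T(1) by (simp add: D_def transpose_def vec_eq_iff)
  have "trace (D ** (S + T) ** D) =
     trace (S**S**S) - trace (S**S**T) + trace (S**T**S) - trace (S**T**T)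
     - trace (T**S**S) + trace (T**S**T) - trace (T**T**S) + trace (T**T**T)"
    unfolding D_def by (simp add: matrix_add_ldistrib matrix_mult_distribs trace_add trace_sub)
  also have "\<dots> = 0"
  proof -
    have "S ** S ** S = A ** S" "S**S**T = A ** T" "T**T**S = A**S" "T**T**T = A**T"
      using S T by auto
    moreover have "trace (S**T**S) = trace (A ** T)"
      using trace_mul_sym[of "S**T" S] S(3) by (simp add: matrix_mul_assoc)
    moreover have "trace (T**S**T) = trace (A ** S)"
      using trace_mul_sym[of "T**S" T] T(3) by (simp add: matrix_mul_assoc)
    moreover have "trace (S**T**T) = trace (A**S)"
      using trace_mul_sym[of S "T**T"] T(3) by (metis matrix_mul_assoc)
    moreover have "trace (T**S**S) = trace (A**T)"
      using trace_mul_sym[of T "S**S"] S(3) by (metis matrix_mul_assoc)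
    ultimately show ?thesis by simp
  qed
  finally have "(\<Sum>i\<in>UNIV. (D *v axis i 1) \<bullet> (S *v (D *v axis i 1)) + (D *v axis i 1) \<bullet> (T *v (D *v axis i 1))) = 0"
    unfolding trace_sandwich[OF symD] by (simp add: matrix_vector_mult_add_rdistrib inner_add_right)
  hence *: "(D *v axis i 1) \<bullet> (S *v (D *v axis i 1)) = 0" for i :: 'd
    using S(2)[of "D *v axis i 1"] T(2)[of "D *v axis i 1"]
    by (subst (asm) sum_nonneg_eq_0_iff) (auto simp: S(2) T(2) add_nonneg_nonneg add_nonneg_eq_0_iff)
  have "D *v axis i 1 = 0" for i :: 'd
  proof -
    have "S *v (D *v axis i 1) = 0" by (rule psd_form_zero_imp[OF S(1,2) *])
    hence "A *v (D *v axis i 1) = A *v 0"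
      unfolding S(3)[symmetric] matrix_vector_mul_assoc[symmetric] by simp
    thus ?thesis using inv
      by (metis matrix_inv_left_right(1) matrix_vector_mul_assoc matrix_vector_mul_lid matrix_vector_mult_0_right)
  qed
  hence "D = 0"
    by (simp add: vec_eq_iff matrix_vector_mul_component inner_axis)
  thus ?thesis by (simp add: D_def)
qed

text \<open>A square root \<open>I - Z\<close> of \<open>I - B\<close> is a fixed point of \<open>Z \<mapsto> (B + Z\<^sup>2) / 2\<close>.  This map is a
  contraction on a ball of radius \<open>r < 1\<close> in the operator norm, and it preserves self-adjointness.\<close>

lemma psd_square_root_exists_contraction:
  fixes B :: "(real^'d) \<Rightarrow>\<^sub>L (real^'d)"
  assumes nB: "norm B < 1" and symB: "\<And>x y. blinfun_apply B x \<bullet> y = x \<bullet> blinfun_apply B y"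
  obtains Z where "norm Z \<le> 1" "\<And>x y. blinfun_apply Z x \<bullet> y = x \<bullet> blinfun_apply Z y"
    "\<And>x. (x - Z x) - Z (x - Z x) = x - B x"
proof -
  define b where "b = norm B"
  \<comment> \<open>any radius with \<open>1 - \<surd>(1 - b) \<le> r < 1\<close> would do\<close>
  define r where "r = (1 + b) / 2"
  have b: "0 \<le> b" "b < 1" using nB by (auto simp: b_def)
  hence r: "0 \<le> r" "r < 1" by (auto simp: r_def)
  have rr: "(b + r\<^sup>2) / 2 \<le> r"
  proof -
    have "0 \<le> (1 - b) * (1 + b)" using b by auto
    hence "b\<^sup>2 \<le> 1" by (simp add: power2_eq_square algebra_simps)
    moreover have "(1-b)^2 \<ge> 0" by simp
    ultimately show ?thesis using b by (simp add: r_def power2_eq_square field_simps)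
  qed
  define X where "X = {Z :: (real^'d) \<Rightarrow>\<^sub>L (real^'d). norm Z \<le> r \<and> (\<forall>x y. blinfun_apply Z x \<bullet> y
      = x \<bullet> blinfun_apply Z y)}"
  define f where "f = (\<lambda>Z :: (real^'d) \<Rightarrow>\<^sub>L (real^'d). (1/2) *\<^sub>R (B + (Z o\<^sub>L Z)))"
  have "closed X"
  proof -
    have "X = cball 0 r \<inter> (\<Inter>x. \<Inter>y. {Z. blinfun_apply Z x \<bullet> y = x \<bullet> blinfun_apply Z y})"
      by (auto simp: X_def)
    moreover have "closed {Z :: (real^'d) \<Rightarrow>\<^sub>L (real^'d). blinfun_apply Z x \<bullet> y = x \<bullet> blinfun_apply Z y}" for x y
      by (intro closed_Collect_eq continuous_intros)
    ultimately show ?thesis by (auto intro!: closed_Int closed_INT)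
  qed
  note complete = this[folded complete_eq_closed]
  moreover have "X \<noteq> {}"
  proof -
    have "0 \<in> X" using r by (simp add: X_def)
    thus ?thesis by blast
  qed
  moreover have "f \<in> X \<rightarrow> X"
  proof
    fix Z assume Z: "Z \<in> X"
    have "norm (f Z) \<le> (norm B + norm (Z o\<^sub>L Z)) / 2"
      by (simp add: f_def norm_triangle_ineq)
    also have "\<dots> \<le> (b + r\<^sup>2) / 2"
    proof -
      have "norm (Z o\<^sub>L Z) \<le> norm Z * norm Z" by (rule norm_blinfun_compose)
      also have "\<dots> \<le> r * r" using Z r by (intro mult_mono) (auto simp: X_def)
      finally show ?thesis by (simp add: b_def power2_eq_square)
    qed
    finally have "norm (f Z) \<le> r" using rr by simp
    moreover have "blinfun_apply (f Z) x \<bullet> y = x \<bullet> blinfun_apply (f Z) y" for x y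
      using Z symB by (simp add: f_def X_def blinfun.bilinear_simps inner_add_left inner_add_right)
    ultimately show "f Z \<in> X" by (simp add: X_def)
  qed
  moreover have "dist (f Z) (f Z') \<le> r * dist Z Z'" if "Z \<in> X" "Z' \<in> X" for Z Z'
  proof -
    have "f Z - f Z' = (1/2) *\<^sub>R ((Z o\<^sub>L (Z - Z')) + ((Z - Z') o\<^sub>L Z'))"
      by (rule blinfun_eqI) (simp add: f_def blinfun.bilinear_simps algebra_simps)
    hence "norm (f Z - f Z') \<le> (norm (Z o\<^sub>L (Z - Z')) + norm ((Z - Z') o\<^sub>L Z')) / 2"
      by (simp add: norm_triangle_ineq)
    also have "\<dots> \<le> (norm Z * norm (Z - Z') + norm (Z - Z') * norm Z') / 2"
      by (intro divide_right_mono add_mono norm_blinfun_compose) simp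
    also have "\<dots> \<le> (r * norm (Z - Z') + norm (Z - Z') * r) / 2"
      using that by (intro divide_right_mono add_mono mult_right_mono mult_left_mono) (auto simp: X_def)
    finally show ?thesis by (simp add: dist_norm)
  qed
  ultimately obtain Z where Z: "Z \<in> X" "f Z = Z"
    using Banach_fix[of X r f] r by blast
  have "(x - Z x) - Z (x - Z x) = x - B x" for x
  proof -
    have "Z x = (1/2) *\<^sub>R (B x + Z (Z x))"
      using arg_cong[OF Z(2), of "\<lambda>g. blinfun_apply g x"] by (simp add: f_def blinfun.bilinear_simps)
    hence "2 *\<^sub>R Z x = 2 *\<^sub>R ((1/2) *\<^sub>R (B x + Z (Z x)))" by simp
    hence "2 *\<^sub>R Z x = B x + Z (Z x)" by (simp only: scaleR_scaleR) simp
    thus ?thesis by (simp add: blinfun.bilinear_simps scaleR_2 algebra_simps)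
  qed
  with Z r show ?thesis by (intro that[of Z]) (auto simp: X_def)
qed

text \<open>A suitable multiple \<open>A / L\<close> of the matrix has the form \<open>I - B\<close> with \<open>B\<close> of operator norm less
  than one.\<close>

lemma psd_square_root_exists:
  fixes A :: "real^'d^'d"
  assumes sym: "transpose A = A" and psd: "\<And>x. 0 \<le> x \<bullet> (A *v x)" and inv: "invertible A"
  obtains S where "transpose S = S" "\<And>x. 0 \<le> x \<bullet> (S *v x)" "S ** S = A"
proof -
  obtain L where L: "L > 0" "\<And>x. norm (A *v x) \<le> norm x * L"
    using bounded_linear.pos_bounded[OF matrix_vector_mul_bounded_linear[of A]] by blast
  obtain N where N: "N > 0" "\<And>x. norm (matrix_inv A *v x) \<le> norm x * N"
    using bounded_linear.pos_bounded[OF matrix_vector_mul_bounded_linear[of "matrix_inv A"]] by blast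
  have AL: "(norm (A *v x))\<^sup>2 \<le> L * (x \<bullet> (A *v x))" for x
  proof (cases "A *v x = 0")
    case False
    let ?y = "A *v x"
    have "((norm ?y)\<^sup>2)\<^sup>2 \<le> (?y \<bullet> (A *v ?y)) * (x \<bullet> (A *v x))"
      using psd_form_Cauchy_Schwarz[OF sym psd, of ?y x] by (simp add: power2_norm_eq_inner)
    also have "\<dots> \<le> (norm ?y * (norm ?y * L)) * (x \<bullet> (A *v x))"
      using norm_cauchy_schwarz[of ?y "A *v ?y"] L(2)[of ?y] psd[of x]
      by (intro mult_right_mono order_trans[OF norm_cauchy_schwarz] mult_left_mono) auto
    finally have "(norm ?y)\<^sup>2 * (norm ?y)\<^sup>2 \<le> (norm ?y)\<^sup>2 * (L * (x \<bullet> (A *v x)))"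
      by (simp only: power2_eq_square mult.assoc mult.left_commute mult.commute)
    thus ?thesis using False by (subst (asm) mult_le_cancel_left_pos) auto
  qed (use L psd[of x] in auto)
  have Nx: "norm x \<le> N * norm (A *v x)" for x
    using N(2)[of "A *v x"] matrix_inv_left_right(1)[OF inv]
    by (simp add: matrix_vector_mul_assoc mult.commute)
  define B where "B = Blinfun (\<lambda>x. x - (1/L) *\<^sub>R (A *v x))"
  have B: "blinfun_apply B x = x - (1/L) *\<^sub>R (A *v x)" for x
    unfolding B_def by (subst bounded_linear_Blinfun_apply)
      (auto intro!: bounded_linear_intros bounded_linear_compose[OF _ matrix_vector_mul_bounded_linear, where
          f = "\<lambda>x. (1/L) *\<^sub>R x", unfolded o_def])
  \<comment> \<open>\<open>\<mu>\<close> bounds the smallest eigenvalue of \<open>A / L\<close> from below\<close>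
  define \<mu> where "\<mu> = 1 / (N\<^sup>2 * L\<^sup>2)"
  have mu: "\<mu> > 0" using L N by (simp add: \<mu>_def)
  have B2: "(norm (B x))\<^sup>2 \<le> (1 - \<mu>) * (norm x)\<^sup>2" for x
  proof -
    have "(norm (B x))\<^sup>2 = (norm x)\<^sup>2 - 2 / L * (x \<bullet> (A *v x)) + (norm (A *v x))\<^sup>2 / L\<^sup>2"
      using dot_norm_neg[of x "(1/L) *\<^sub>R (A *v x)"] L(1) by (simp add: B power_divide)
    also have "\<dots> \<le> (norm x)\<^sup>2 - 2 / L * (x \<bullet> (A *v x)) + L * (x \<bullet> (A *v x)) / L\<^sup>2"
      using AL[of x] by (intro add_left_mono divide_right_mono) auto
    also have "\<dots> = (norm x)\<^sup>2 - (x \<bullet> (A *v x)) / L"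
      using L by (simp add: power2_eq_square field_simps)
    also have "\<dots> \<le> (norm x)\<^sup>2 - \<mu> * (norm x)\<^sup>2"
    proof -
      have "(norm x)\<^sup>2 \<le> N\<^sup>2 * (norm (A *v x))\<^sup>2"
        using power_mono[OF Nx[of x], of 2] by (simp add: power_mult_distrib)
      also have "\<dots> \<le> N\<^sup>2 * (L * (x \<bullet> (A *v x)))" using AL[of x] by (intro mult_left_mono) auto
      finally have "\<mu> * (norm x)\<^sup>2 \<le> \<mu> * (N\<^sup>2 * (L * (x \<bullet> (A *v x))))" using mu by (intro mult_left_mono) auto
      also have "\<dots> = (x \<bullet> (A *v x)) / L" using L N by (simp add: \<mu>_def power2_eq_square field_simps)
      finally show ?thesis by simp
    qed
    finally show ?thesis by (simp add: algebra_simps)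
  qed
  have mu1: "\<mu> \<le> 1"
  proof -
    have "0 \<le> (1 - \<mu>) * (norm (axis undefined 1 :: real^'d))\<^sup>2"
      using B2[of "axis undefined 1"] by (meson order_trans zero_le_power2)
    thus ?thesis by (simp add: norm_axis_1)
  qed
  have nB: "norm B \<le> sqrt (1 - \<mu>)"
  proof (rule norm_blinfun_bound)
    show "norm (B x) \<le> sqrt (1 - \<mu>) * norm x" for x
      using real_sqrt_le_mono[OF B2[of x]] by (simp add: real_sqrt_mult)
  qed (use mu1 in auto)
  also have "\<dots> < 1" using mu by (simp add: real_sqrt_lt_1_iff)
  finally have nB: "norm B < 1" .
  have symB: "blinfun_apply B x \<bullet> y = x \<bullet> blinfun_apply B y" for x y
    using inner_matrix_mult_symmetric[OF sym, of x y]
    by (simp add: B inner_diff_left inner_diff_right)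
  obtain Z where Z: "norm Z \<le> 1" "\<And>x y. blinfun_apply Z x \<bullet> y = x \<bullet> blinfun_apply Z y"
    "\<And>x. (x - Z x) - Z (x - Z x) = x - B x"
    using psd_square_root_exists_contraction[OF nB symB] by blast
  define S where "S = matrix (\<lambda>x. sqrt L *\<^sub>R (x - Z x))"
  have S: "S *v x = sqrt L *\<^sub>R (x - Z x)" for x
  proof -
    have "linear (\<lambda>x. sqrt L *\<^sub>R (x - Z x))"
      by (rule linearI) (auto simp: blinfun.bilinear_simps algebra_simps)
    thus ?thesis by (simp add: S_def matrix_works linear_matrix_vector_mul_eq)
  qed
  have "x \<bullet> ((transpose S) *v y) = x \<bullet> (S *v y)" for x y
  proof -
    have "x \<bullet> ((transpose S) *v y) = (y v* S) \<bullet> x" by (subst inner_commute) simp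
    also have "\<dots> = (S *v x) \<bullet> y" by (subst dot_lmul_matrix) (rule inner_commute)
    also have "\<dots> = x \<bullet> (S *v y)" by (simp add: S Z(2) inner_diff_left inner_diff_right)
    finally show ?thesis .
  qed
  hence "transpose S = S"
    by (metis matrix_eq vector_eq_ldot)
  moreover have "0 \<le> x \<bullet> (S *v x)" for x
  proof -
    have "x \<bullet> Z x \<le> norm x * norm (Z x)" by (rule norm_cauchy_schwarz)
    also have "\<dots> \<le> norm x * (norm Z * norm x)" by (intro mult_left_mono norm_blinfun) auto
    also have "\<dots> \<le> norm x * (1 * norm x)" using Z(1) by (intro mult_left_mono mult_right_mono) auto
    finally show ?thesis using L by (simp add: S inner_diff_right power2_norm_eq_inner[symmetric] power2_eq_square)
  qed
  moreover have "S ** S = A"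
  proof -
    have "(S ** S) *v x = A *v x" for x
    proof -
      have "(S ** S) *v x = (sqrt L * sqrt L) *\<^sub>R ((x - Z x) - Z (x - Z x))"
        by (simp only: matrix_vector_mul_assoc[symmetric] S blinfun.scaleR_right
            scaleR_diff_right[symmetric] scaleR_scaleR)
      also have "\<dots> = A *v x" using L by (simp add: Z(3) B)
      finally show ?thesis .
    qed
    thus ?thesis by (simp add: matrix_eq)
  qed
  ultimately show ?thesis by (rule that)
qed

text \<open>Existence and uniqueness turn the definite description in \<^const>\<open>psd_sqrt\<close> into usable facts.\<close>

lemma psd_sqrt:
  fixes A :: "real^'d^'d"
  assumes "transpose A = A" and "\<And>x. 0 \<le> x \<bullet> (A *v x)" and "invertible A"
  shows "transpose (psd_sqrt A) = psd_sqrt A" "0 \<le> x \<bullet> (psd_sqrt A *v x)"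
    "psd_sqrt A ** psd_sqrt A = A" "invertible (psd_sqrt A)"
proof -
  obtain S where S: "transpose S = S" "\<And>x. 0 \<le> x \<bullet> (S *v x)" "S ** S = A"
    using psd_square_root_exists[OF assms] by blast
  have *: "transpose (psd_sqrt A) = psd_sqrt A \<and> (\<forall>x. 0 \<le> x \<bullet> (psd_sqrt A *v x)) \<and> psd_sqrt A ** psd_sqrt A = A"
    unfolding psd_sqrt_def
  proof (rule theI[where a = S])
    show "T = S" if "transpose T = T \<and> (\<forall>x. 0 \<le> x \<bullet> (T *v x)) \<and> T ** T = A" for T
      using that S assms(3) by (intro psd_square_root_unique[of T A S]) auto
  qed (use S in auto)
  thus "transpose (psd_sqrt A) = psd_sqrt A" "0 \<le> x \<bullet> (psd_sqrt A *v x)"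
    and sq: "psd_sqrt A ** psd_sqrt A = A" by auto
  have "det (psd_sqrt A) \<noteq> 0"
    using assms(3) sq by (metis det_mul invertible_det_nz mult_eq_0_iff)
  thus "invertible (psd_sqrt A)" by (simp add: invertible_det_nz)
qed

section \<open>The trace of an inverse matrix\<close>

text \<open>Here \<open>l\<close> is a lower bound on the smallest eigenvalue, so the inverse has eigenvalues at most
  \<open>1 / l\<close>.\<close>

lemma invertible_of_coercive:
  fixes A :: "real^'d^'d"
  assumes "l > 0" and coercive: "\<And>x. l * (norm x)\<^sup>2 \<le> x \<bullet> (A *v x)"
  shows "invertible A" and "x \<bullet> (matrix_inv A *v x) \<le> (norm x)\<^sup>2 / l"
proof -
  have "x = 0" if "A *v x = 0" for x
    using coercive[of x] that \<open>l > 0\<close> by (simp add: mult_le_0_iff)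
  thus inv: "invertible A"
    by (simp add: invertible_left_inverse matrix_left_invertible_ker)
  define y where "y = matrix_inv A *v x"
  have Ay: "A *v y = x"
    by (simp add: y_def matrix_vector_mul_assoc matrix_inv_left_right[OF inv])
  have "l * (norm y)\<^sup>2 \<le> y \<bullet> x" using coercive[of y] Ay by simp
  also have "\<dots> \<le> norm y * norm x" by (rule norm_cauchy_schwarz)
  finally have "norm y * (l * norm y) \<le> norm y * norm x" by (simp add: power2_eq_square algebra_simps)
  hence "l * norm y \<le> norm x"
    by (cases "y = 0") auto
  hence y: "norm y \<le> norm x / l" using \<open>l > 0\<close> by (simp add: field_simps)
  have "x \<bullet> y \<le> norm x * norm y" by (rule norm_cauchy_schwarz)
  also have "\<dots> \<le> norm x * (norm x / l)" using y by (intro mult_left_mono) auto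
  finally show "x \<bullet> (matrix_inv A *v x) \<le> (norm x)\<^sup>2 / l" by (simp add: y_def power2_eq_square)
qed

lemma trace_inv_le_of_coercive:
  fixes A :: "real^'d^'d"
  assumes "l > 0" and coercive: "\<And>x. l * (norm x)\<^sup>2 \<le> x \<bullet> (A *v x)"
  shows "trace_inv A \<le> ennreal (real CARD('d) / l)"
proof -
  have "trace (matrix_inv A) \<le> (\<Sum>i\<in>(UNIV::'d set). 1 / l)"
    unfolding trace_eq_sum_axis using invertible_of_coercive(2)[OF assms, of "axis _ 1"]
    by (intro sum_mono) (simp add: norm_axis_1)
  thus ?thesis using invertible_of_coercive(1)[OF assms]
    by (auto simp: trace_inv_def intro!: ennreal_leI)
qed

lemma sum_norm_axis_eq_norm:
  fixes B :: "real^'d^'d"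
  assumes "transpose B = B"
  shows "(\<Sum>i\<in>UNIV. (norm (B *v axis i 1))\<^sup>2) = (norm B)\<^sup>2"
proof -
  have "B *v axis i 1 = B $ i" for i
    using assms by (simp add: vec_eq_iff matrix_vector_mul_component inner_axis transpose_def)
  thus ?thesis by (simp add: norm_vec_def L2_set_def sum_nonneg)
qed

text \<open>Expand \<open>(A - I) A\<^sup>-\<^sup>1 (A - I) = A - 2 I + A\<^sup>-\<^sup>1\<close> and bound the trace of the left side column by
  column.\<close>

lemma trace_inv_le_second_order:
  fixes A :: "real^'d^'d"
  assumes sym: "transpose A = A" and "l > 0" and coercive: "\<And>x. l * (norm x)\<^sup>2 \<le> x \<bullet> (A *v x)"
  shows "trace_inv A \<le> ennreal (2 * real CARD('d) + (norm (A - mat 1))\<^sup>2 / l - trace A)"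
proof -
  note inv = invertible_of_coercive(1)[OF assms(2,3)]
  let ?B = "A - mat 1"
  have symB: "transpose ?B = ?B" using sym by (simp add: transpose_def vec_eq_iff mat_def)
  have "?B ** matrix_inv A ** ?B = (A ** matrix_inv A) ** A - (A ** matrix_inv A) - (matrix_inv A ** A)
      + matrix_inv A"
    by (simp add: matrix_mult_distribs matrix_mul_assoc)
  also have "\<dots> = A - mat 1 - mat 1 + matrix_inv A"
    by (simp add: matrix_inv_left_right[OF inv])
  finally have "trace (?B ** matrix_inv A ** ?B) = trace A - 2 * real CARD('d) + trace (matrix_inv A)"
    by (simp only: trace_add trace_sub trace_I)
  moreover have "trace (?B ** matrix_inv A ** ?B) \<le> (norm ?B)\<^sup>2 / l"
    unfolding trace_sandwich[OF symB] sum_norm_axis_eq_norm[OF symB, symmetric] sum_divide_distrib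
    by (intro sum_mono invertible_of_coercive(2)[OF assms(2,3)])
  ultimately show ?thesis using inv by (auto simp: trace_inv_def intro!: ennreal_leI)
qed

text \<open>By Cauchy's inequality \<open>tr (A - I) \<le> \<surd>d |A - I|\<close>, and the inequality between arithmetic and geometric
  means absorbs the right side.  So the second order bound, with \<open>K\<close> in place of \<open>1 / l\<close>, may be kept as a
  nonnegative summand where the smallest eigenvalue is below \<open>1 / K\<close> and it bounds nothing.\<close>

lemma second_order_bound_nonneg:
  fixes A :: "real^'d^'d"
  assumes "K \<ge> 1/2"
  shows "0 \<le> 2 * real CARD('d) + K * (norm (A - mat 1))\<^sup>2 - trace A"
proof -
  let ?B = "A - mat 1" and ?d = "real CARD('d)"
  have "(trace ?B)\<^sup>2 \<le> ?d * (\<Sum>i\<in>UNIV. (?B $ i $ i)\<^sup>2)"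
    unfolding trace_def using sum_squared_le_sum_of_squares[of "\<lambda>i. ?B $ i $ i" "UNIV::'d set"]
    by (simp add: mult.commute)
  also have "(\<Sum>i\<in>UNIV. (?B $ i $ i)\<^sup>2) \<le> (\<Sum>i\<in>UNIV. (norm (?B $ i))\<^sup>2)"
  proof (rule sum_mono)
    fix i :: 'd
    show "(?B $ i $ i)\<^sup>2 \<le> (norm (?B $ i))\<^sup>2"
      using component_le_norm_cart[of "?B $ i" i] by (metis abs_ge_zero power2_abs power_mono)
  qed
  also have "(\<Sum>i\<in>UNIV. (norm (?B $ i))\<^sup>2) = (norm ?B)\<^sup>2"
    by (subst norm_vec_def, simp only: L2_set_def, rule real_sqrt_pow2[symmetric]) (simp add: sum_nonneg)
  finally have *: "(trace ?B)\<^sup>2 \<le> ?d * (norm ?B)\<^sup>2" by simp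
  have "trace ?B \<le> ?d + K * (norm ?B)\<^sup>2"
  proof (rule power2_le_imp_le)
    have "?d * (norm ?B)\<^sup>2 \<le> ?d * (2 * K * (norm ?B)\<^sup>2)"
      using assms by (intro mult_left_mono) (auto simp: mult_le_cancel_right1)
    with * have "(trace ?B)\<^sup>2 \<le> ?d * (2 * K * (norm ?B)\<^sup>2)" by (rule order_trans)
    hence "(trace ?B)\<^sup>2 \<le> 2 * ?d * (K * (norm ?B)\<^sup>2)" by (simp only: mult_ac)
    also have "\<dots> \<le> (?d + K * (norm ?B)\<^sup>2)\<^sup>2"
      by (simp add: power2_sum)
    finally show "(trace ?B)\<^sup>2 \<le> (?d + K * (norm ?B)\<^sup>2)\<^sup>2" .
  qed (use assms in auto)
  thus ?thesis by (simp add: trace_sub trace_I)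
qed

text \<open>The event \<open>B j\<close> contains all sample points at which the smallest eigenvalue is below
  \<open>1 / (K 2\<^sup>j)\<close>.  If \<open>w\<close> avoids \<open>B 0\<close>, the second order bound applies.  Otherwise let \<open>J\<close> be
  the first index with \<open>w \<notin> B J\<close>; then \<open>tr A\<^sup>-\<^sup>1 \<le> d K 2\<^sup>J\<close>, which is the summand with index
  \<open>J - 1\<close>.  If there is no such \<open>J\<close>, the series diverges, which leaves room for a singular \<open>A\<close>.
  The sets \<open>B j\<close> may be larger than the eigenvalue events, so that they can be chosen measurable.\<close>

lemma trace_inv_le_dyadic:
  fixes A :: "real^'d^'d" and B :: "nat \<Rightarrow> 'a set"
  assumes sym: "transpose A = A" and K: "K \<ge> 1/2"
    and good: "\<And>j x. w \<notin> B j \<Longrightarrow> (norm x)\<^sup>2 / (K * 2 ^ j) \<le> x \<bullet> (A *v x)"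
  shows "trace_inv A \<le> ennreal (2 * real CARD('d) + K * (norm (A - mat 1))\<^sup>2 - trace A)
           + (\<Sum>j. ennreal (real CARD('d) * (K * 2 ^ Suc j)) * indicator (B j) w)"
    (is "_ \<le> ennreal ?h + suminf ?g")
proof (cases "\<exists>j. w \<notin> B j")
  case True
  define J where "J = (LEAST j. w \<notin> B j)"
  have J: "w \<notin> B J" unfolding J_def using True by (rule LeastI_ex)
  have term_le: "f j \<le> suminf f" for f :: "nat \<Rightarrow> ennreal" and j
    using sum_le_suminf[of f "{j}"] by simp
  have pos: "1 / (K * 2 ^ j) > 0" for j :: nat using K by simp
  show ?thesis
  proof (cases J)
    case 0
    with J have "\<And>x. 1 / K * (norm x)\<^sup>2 \<le> x \<bullet> (A *v x)" using good[of 0] by simp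
    from trace_inv_le_second_order[OF sym _ this] K
    have "trace_inv A \<le> ennreal ?h" by (simp add: mult.commute)
    thus ?thesis by (rule order_trans) simp
  next
    case (Suc j)
    have "w \<in> B j" using not_less_Least[of j "\<lambda>j. w \<notin> B j"] Suc by (auto simp: J_def)
    have "\<And>x. 1 / (K * 2 ^ J) * (norm x)\<^sup>2 \<le> x \<bullet> (A *v x)" using good[OF J] by simp
    from trace_inv_le_of_coercive[OF pos this]
    have "trace_inv A \<le> ?g j" using \<open>w \<in> B j\<close> by (simp add: Suc)
    also have "?g j \<le> suminf ?g" by (rule term_le)
    finally show ?thesis by (rule order_trans) simp
  qed
next
  case False
  have "suminf ?g = \<top>"
  proof (rule ccontr)
    assume "suminf ?g \<noteq> \<top>"
    then obtain s where s: "suminf ?g = ennreal s" "s \<ge> 0" by (cases "suminf ?g") auto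
    obtain j where j: "s / (real CARD('d) * K) < 2 ^ j"
      using real_arch_pow[of 2] by auto
    have "ennreal (real CARD('d) * (K * 2 ^ Suc j)) \<le> ennreal s"
      using sum_le_suminf[of ?g "{j}"] False s by simp
    hence "real CARD('d) * K * 2 ^ Suc j \<le> s" using s by (simp add: ennreal_le_iff mult.assoc)
    moreover have "s < real CARD('d) * K * 2 ^ j"
      using j K by (simp add: divide_less_eq mult.commute)
    moreover have "0 < real CARD('d) * K * 2 ^ j" using K by simp
    ultimately show False by simp
  qed
  thus ?thesis by simp
qed

section \<open>Rounding to an integer grid\<close>

text \<open>Rounding \<open>a\<close> randomly to one of its two neighbours in \<open>\<eta> \<int>\<close>, with probabilities that make the
  error centred, has variance at most \<open>\<eta>\<^sup>2 / 4\<close>.  Hence one of the two outcomes is no worse than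
  the mean of \<open>e b + e\<^sup>2 c\<close> over the error \<open>e\<close>, whatever \<open>b\<close> is.\<close>

lemma round_one_coordinate:
  fixes \<eta> b c a :: real
  assumes "\<eta> > 0" "c \<ge> 0"
  obtains m :: int where "\<bar>\<eta> * of_int m - a\<bar> \<le> \<eta>"
    "(\<eta> * of_int m - a) * b + (\<eta> * of_int m - a)\<^sup>2 * c \<le> \<eta>\<^sup>2 / 4 * c"
proof -
  define m where "m = \<lfloor>a / \<eta>\<rfloor>"
  define p where "p = a - \<eta> * of_int m"
  have "of_int m \<le> a / \<eta>" "a / \<eta> < of_int m + 1" by (auto simp: m_def)
  hence p: "0 \<le> p" "p < \<eta>" using assms by (auto simp: p_def field_simps)
  define L where "L = - p * b + p\<^sup>2 * c"
  define R where "R = (\<eta> - p) * b + (\<eta> - p)\<^sup>2 * c"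
  have "(\<eta> - p) * L + p * R = \<eta> * (p * (\<eta> - p) * c)"
    by (simp add: L_def R_def power2_eq_square algebra_simps)
  also have "\<dots> \<le> \<eta> * (\<eta>\<^sup>2 / 4 * c)"
  proof -
    have "0 \<le> (\<eta> - 2 * p)\<^sup>2" by simp
    hence "p * (\<eta> - p) \<le> \<eta>\<^sup>2 / 4" by (simp add: power2_eq_square algebra_simps)
    thus ?thesis using assms by (intro mult_left_mono mult_right_mono) auto
  qed
  finally have *: "(\<eta> - p) * L + p * R \<le> \<eta> * (\<eta>\<^sup>2 / 4 * c)" .
  show ?thesis
  proof (cases "L \<le> \<eta>\<^sup>2 / 4 * c")
    case True
    show ?thesis
      by (rule that[of m]) (use True p in \<open>auto simp: L_def p_def power2_eq_square algebra_simps\<close>)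
  next
    case False
    have "R \<le> \<eta>\<^sup>2 / 4 * c"
    proof (rule ccontr)
      assume R: "\<not> R \<le> \<eta>\<^sup>2 / 4 * c"
      have "(\<eta> - p) * (\<eta>\<^sup>2 / 4 * c) < (\<eta> - p) * L"
        using p False by (intro mult_strict_left_mono) auto
      moreover have "p * (\<eta>\<^sup>2 / 4 * c) \<le> p * R"
        using p R by (intro mult_left_mono) auto
      ultimately have "(\<eta> - p) * (\<eta>\<^sup>2 / 4 * c) + p * (\<eta>\<^sup>2 / 4 * c) < \<eta> * (\<eta>\<^sup>2 / 4 * c)" using * by linarith
      moreover have "(\<eta> - p) * (\<eta>\<^sup>2 / 4 * c) + p * (\<eta>\<^sup>2 / 4 * c) = \<eta> * (\<eta>\<^sup>2 / 4 * c)"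
        by (simp only: distrib_right[symmetric]) simp
      ultimately show False by linarith
    qed
    moreover have "\<eta> * of_int (m + 1) - a = \<eta> - p" by (simp add: p_def algebra_simps)
    ultimately show ?thesis
      by (intro that[of "m + 1"]) (use p in \<open>auto simp: R_def\<close>)
  qed
qed

text \<open>Coordinates are rounded one after the other.  Each step changes \<open>q\<close> by a quadratic polynomial in
  the rounding error with leading coefficient \<open>c i\<close>, so the total increase is governed by
  \<open>\<Sum>\<^sub>i c i\<close>, the trace of the form, and not by its largest eigenvalue.\<close>

lemma round_quadratic_to_grid:
  fixes q :: "real^'d \<Rightarrow> real" and v :: "real^'d"
  assumes "\<eta> > 0" and c: "\<And>i. c i \<ge> 0"
    and quadratic: "\<And>x i. \<exists>b. \<forall>s. q (x + s *\<^sub>R axis i 1) = q x + s * b + s\<^sup>2 * c i"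
  obtains k :: "'d \<Rightarrow> int" where "\<And>i. \<bar>\<eta> * of_int (k i) - v $ i\<bar> \<le> \<eta>"
    "q (\<chi> i. \<eta> * of_int (k i)) \<le> q v + \<eta>\<^sup>2 / 4 * (\<Sum>i\<in>UNIV. c i)"
proof -
  have "\<exists>k :: 'd \<Rightarrow> int. (\<forall>i\<in>F. \<bar>\<eta> * of_int (k i) - v $ i\<bar> \<le> \<eta>) \<and>
    q (\<chi> i. if i \<in> F then \<eta> * of_int (k i) else v $ i) \<le> q v + \<eta>\<^sup>2 / 4 * (\<Sum>i\<in>F. c i)" for F :: "'d set"
  proof (induction F rule: finite_induct[OF finite])
    case 1
    show ?case by simp
  next
    case (2 j F)
    then obtain k :: "'d \<Rightarrow> int" where k: "\<forall>i\<in>F. \<bar>\<eta> * of_int (k i) - v $ i\<bar> \<le> \<eta>"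
      "q (\<chi> i. if i \<in> F then \<eta> * of_int (k i) else v $ i) \<le> q v + \<eta>\<^sup>2 / 4 * (\<Sum>i\<in>F. c i)" by blast
    define x where "x = (\<chi> i. if i \<in> F then \<eta> * of_int (k i) else v $ i)"
    obtain b where b: "\<And>s. q (x + s *\<^sub>R axis j 1) = q x + s * b + s\<^sup>2 * c j"
      using quadratic[of x j] by blast
    obtain m :: int where m: "\<bar>\<eta> * of_int m - v $ j\<bar> \<le> \<eta>"
      "(\<eta> * of_int m - v $ j) * b + (\<eta> * of_int m - v $ j)\<^sup>2 * c j \<le> \<eta>\<^sup>2 / 4 * c j"
      using round_one_coordinate[OF \<open>\<eta> > 0\<close> c] by blast
    have eq: "(\<chi> i. if i \<in> insert j F then \<eta> * of_int ((k(j := m)) i) else v $ i)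
      = x + (\<eta> * of_int m - v $ j) *\<^sub>R axis j 1"
      using 2(2) by (auto simp: x_def vec_eq_iff axis_def)
    have "q (x + (\<eta> * of_int m - v $ j) *\<^sub>R axis j 1) \<le> q v + \<eta>\<^sup>2 / 4 * (\<Sum>i\<in>insert j F. c i)"
    proof -
      have "\<eta>\<^sup>2 / 4 * (\<Sum>i\<in>insert j F. c i) = \<eta>\<^sup>2 / 4 * c j + \<eta>\<^sup>2 / 4 * (\<Sum>i\<in>F. c i)"
        using 2(2) by (simp add: distrib_left)
      thus ?thesis using k(2) m(2) unfolding b x_def[symmetric] by linarith
    qed
    thus ?case using k(1) m(1) 2(2) unfolding eq[symmetric]
      by (intro exI[of _ "k(j := m)"]) auto
  qed
  from this[of UNIV] show ?thesis using that by auto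
qed

lemma sum_power_abs_int_interval:
  fixes x :: real
  shows "(\<Sum>j\<in>{- int N..int N}. x ^ nat \<bar>j\<bar>) = 1 + 2 * (\<Sum>m<N. x ^ Suc m)"
proof (induction N)
  case (Suc N)
  have "{- int (Suc N)..int (Suc N)} = insert (int (Suc N)) (insert (- int (Suc N)) {- int N..int N})"
    by auto
  thus ?case using Suc by (simp add: nat_add_distrib)
qed simp

text \<open>On the \<open>\<ell>\<^sub>1\<close> ball the weight \<open>exp (d - |k|\<^sub>1 / \<rho>)\<close> is at least one, and its sum over all
  integer points is the \<open>d\<close>-th power of a geometric series.\<close>

lemma card_l1_ball_int:
  fixes \<rho> :: real
  assumes "\<rho> > 0"
  defines "G \<equiv> {k :: 'd::finite \<Rightarrow> int. (\<Sum>i\<in>UNIV. \<bar>of_int (k i)\<bar>) \<le> \<rho> * real CARD('d)}"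
  shows "finite G" "real (card G) \<le> (exp 1 * (2 * \<rho> + 1)) ^ CARD('d)"
proof -
  define N where "N = nat \<lceil>\<rho> * real CARD('d)\<rceil>"
  define x where "x = exp (- 1 / \<rho>)"
  let ?box = "PiE (UNIV::'d set) (\<lambda>_. {- int N..int N})"
  have sub: "G \<subseteq> ?box"
  proof
    fix k assume k: "k \<in> G"
    have "k i \<in> {- int N..int N}" for i
    proof -
      have "\<bar>real_of_int (k i)\<bar> \<le> (\<Sum>i\<in>UNIV. \<bar>of_int (k i)\<bar>)"
        by (rule member_le_sum) auto
      also have "\<dots> \<le> \<rho> * real CARD('d)" using k by (simp add: G_def)
      also have "\<dots> \<le> real N" unfolding N_def by (rule real_nat_ceiling_ge)
      finally show ?thesis by auto
    qed
    thus "k \<in> ?box" by auto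
  qed
  have fin: "finite ?box" by (intro finite_PiE) auto
  thus "finite G" using sub by (rule finite_subset[rotated])
  have x: "0 < x" "x < 1" using assms by (auto simp: x_def)
  have row: "(\<Sum>j\<in>{- int N..int N}. x ^ nat \<bar>j\<bar>) \<le> 2 * \<rho> + 1"
  proof -
    have "(\<Sum>m<N. x ^ Suc m) = x * ((1 - x ^ N) / (1 - x))"
      using x by (simp add: sum_distrib_left[symmetric] sum_gp_strict)
    also have "\<dots> \<le> x * (1 / (1 - x))" using x by (intro mult_left_mono divide_right_mono) auto
    also have "\<dots> \<le> \<rho>"
    proof -
      have "1 + 1 / \<rho> \<le> exp (1 / \<rho>)" by (rule exp_ge_add_one_self)
      hence "1 + 1 / \<rho> \<le> 1 / x" by (simp add: x_def exp_minus field_simps)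
      hence "x * (\<rho> + 1) \<le> \<rho>" using x assms by (simp add: field_simps)
      thus ?thesis using x by (simp add: field_simps)
    qed
    finally show ?thesis unfolding sum_power_abs_int_interval by simp
  qed
  have "real (card G) = (\<Sum>k\<in>G. 1)" by simp
  also have "\<dots> \<le> (\<Sum>k\<in>G. exp (real CARD('d)) * (\<Prod>i\<in>UNIV. x ^ nat \<bar>k i\<bar>))"
  proof (rule sum_mono)
    fix k assume "k \<in> G"
    hence "(\<Sum>i\<in>UNIV. \<bar>of_int (k i)\<bar>) \<le> \<rho> * real CARD('d)" by (simp add: G_def)
    hence "0 \<le> real CARD('d) - (\<Sum>i\<in>UNIV. \<bar>of_int (k i)\<bar>) / \<rho>" using assms by (simp add: field_simps)
    moreover have "(\<Prod>i\<in>UNIV. x ^ nat \<bar>k i\<bar>) = exp (- (\<Sum>i\<in>UNIV. \<bar>of_int (k i)\<bar>) / \<rho>)"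
    proof -
      have "x ^ nat \<bar>k i\<bar> = exp (- \<bar>of_int (k i)\<bar> / \<rho>)" for i
        unfolding x_def exp_of_nat_mult[symmetric] by simp
      thus ?thesis by (simp add: exp_sum[symmetric] sum_divide_distrib sum_negf)
    qed
    ultimately show "1 \<le> exp (real CARD('d)) * (\<Prod>i\<in>UNIV. x ^ nat \<bar>k i\<bar>)"
      by (simp add: exp_add[symmetric])
  qed
  also have "\<dots> \<le> (\<Sum>k\<in>?box. exp (real CARD('d)) * (\<Prod>i\<in>UNIV. x ^ nat \<bar>k i\<bar>))"
    using sub fin x by (intro sum_mono2) (auto intro!: mult_nonneg_nonneg prod_nonneg)
  also have "\<dots> = exp (real CARD('d)) * (\<Prod>i\<in>(UNIV::'d set). \<Sum>j\<in>{- int N..int N}. x ^ nat \<bar>j\<bar>)"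
    by (subst prod_sum_PiE) (auto simp: sum_distrib_left)
  also have "\<dots> \<le> exp (real CARD('d)) * (\<Prod>i\<in>(UNIV::'d set). 2 * \<rho> + 1)"
    using row x by (intro mult_left_mono prod_mono) (auto intro!: sum_nonneg)
  also have "\<dots> = (exp 1 * (2 * \<rho> + 1)) ^ CARD('d)"
    by (simp add: power_mult_distrib exp_of_nat_mult[symmetric])
  finally show "real (card G) \<le> (exp 1 * (2 * \<rho> + 1)) ^ CARD('d)" .
qed

section \<open>The lower tail of the smallest eigenvalue\<close>

text \<open>Shortens a vector to length \<open>\<surd>d\<close> and leaves shorter vectors unchanged.  At \<open>0\<close> the quotient is
  \<open>0\<close> by convention, which gives the right value.\<close>

definition clip :: "real^'d \<Rightarrow> real^'d" where
  "clip x = min 1 (sqrt (real CARD('d)) / norm x) *\<^sub>R x"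

lemma norm_clip_le: "norm (clip (x :: real^'d)) \<le> sqrt (real CARD('d))"
  by (cases "x = 0") (auto simp: clip_def min_def field_simps abs_mult)

lemma abs_inner_clip_le: "\<bar>\<theta> \<bullet> clip x\<bar> \<le> \<bar>\<theta> \<bullet> x\<bar>"
  unfolding clip_def by (simp add: abs_mult abs_of_nonneg mult_left_le_one_le)

lemma abs_inner_le_clip:
  fixes x :: "real^'d"
  assumes "norm x \<le> a * sqrt (real CARD('d))" "1 \<le> a"
  shows "\<bar>\<theta> \<bullet> x\<bar> \<le> a * \<bar>\<theta> \<bullet> clip x\<bar>"
proof (cases "x = 0")
  case False
  have "1 \<le> a * min 1 (sqrt (real CARD('d)) / norm x)"
    using False assms by (auto simp: min_def field_simps)
  hence "1 * \<bar>\<theta> \<bullet> x\<bar> \<le> (a * min 1 (sqrt (real CARD('d)) / norm x)) * \<bar>\<theta> \<bullet> x\<bar>"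
    by (intro mult_right_mono) auto
  thus ?thesis by (simp add: clip_def abs_mult mult.assoc abs_of_nonneg)
qed (simp add: clip_def)

lemma measurable_clip [measurable]: "clip \<in> borel_measurable borel"
  unfolding clip_def[abs_def] by measurable

text \<open>If \<open>|f x| \<le> a \<surd>d\<close>, clipping shrinks inner products by a factor at most \<open>a\<close>; the exceptional event has
  probability at most \<open>a\<^sup>-\<^sup>2\<close> by Markov's inequality.  The choice \<open>a = (C s)\<^bsup>-1/3\<^esup>\<close> makes
  the first contribution \<open>(C s)\<^bsup>2\<alpha>/3\<^esup>\<close> and the second \<open>(C s)\<^bsup>2/3\<^esup>\<close>, which is smaller
  when \<open>C s < 1\<close>.  For larger \<open>s\<close> the bound exceeds one.\<close>

lemma clip_small_ball:
  fixes f :: "'a \<Rightarrow> real^'d"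
  assumes M: "prob_space M" and f[measurable]: "f \<in> borel_measurable M"
    and int: "integrable M (\<lambda>x. (norm (f x))\<^sup>2)" and E: "(LINT x|M. (norm (f x))\<^sup>2) = real CARD('d)"
    and small: "\<And>\<theta> t. \<theta> \<noteq> 0 \<Longrightarrow> t > 0 \<Longrightarrow>
        measure M {x\<in>space M. \<bar>\<theta> \<bullet> f x\<bar> \<le> t * norm \<theta>} \<le> (C * t) powr \<alpha>"
    and \<alpha>: "0 < \<alpha>" "\<alpha> \<le> 1" and C: "C \<ge> 1" and \<theta>: "\<theta> \<noteq> 0" and s: "s > 0"
  shows "measure M {x\<in>space M. \<bar>\<theta> \<bullet> clip (f x)\<bar> \<le> s * norm \<theta>} \<le> 2 * (C * s) powr (2 * \<alpha> / 3)"
proof -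
  interpret prob_space M by fact
  let ?d = "real CARD('d)"
  let ?S = "{x\<in>space M. \<bar>\<theta> \<bullet> clip (f x)\<bar> \<le> s * norm \<theta>}"
  show ?thesis
  proof (cases "C * s \<ge> 1")
    case True
    have "measure M ?S \<le> 1" by simp
    also have "1 \<le> (C * s) powr (2 * \<alpha> / 3)" using True \<alpha> by (intro ge_one_powr_ge_zero) auto
    finally show ?thesis using powr_ge_zero[of "C * s" "2 * \<alpha> / 3"] by linarith
  next
    case False
    define y where "y = C * s"
    have y: "0 < y" "y < 1" using False C s by (auto simp: y_def)
    \<comment> \<open>the clipping loss that balances the small-ball and the Markov bound\<close>
    define a where "a = y powr (- 1 / 3)"
    let ?F = "{x\<in>space M. \<bar>\<theta> \<bullet> f x\<bar> \<le> (a * s) * norm \<theta>}"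
    let ?T = "{x\<in>space M. (norm (f x))\<^sup>2 \<ge> a\<^sup>2 * ?d}"
    have a: "1 \<le> a" using y unfolding a_def
      by (metis (no_types, opaque_lifting) divide_minus_left less_eq_real_def neg_le_0_iff_le powr_mono_both'
          zero_le_divide_1_iff
          powr_zero_eq_one order_less_imp_not_eq2 zero_le_numeral powr_mono')
    have "measure M ?S
        \<le> measure M (?F \<union> ?T)"
    proof (rule finite_measure_mono)
      show "?S \<subseteq>
        ?F \<union> ?T"
      proof
        fix x assume x: "x \<in> ?S"
        show "x \<in> ?F \<union> ?T"
        proof (cases "norm (f x) \<le> a * sqrt ?d")
          case True
          have "\<bar>\<theta> \<bullet> f x\<bar> \<le> a * \<bar>\<theta> \<bullet> clip (f x)\<bar>" by (rule abs_inner_le_clip[OF True a])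
          also have "\<dots> \<le> a * (s * norm \<theta>)" using x a by (intro mult_left_mono) auto
          finally show ?thesis using x by (simp add: mult.assoc)
        next
          case False
          hence "(a * sqrt ?d)\<^sup>2 \<le> (norm (f x))\<^sup>2" using a by (intro power_mono) auto
          thus ?thesis using x by (simp add: power_mult_distrib)
        qed
      qed
    qed measurable
    also have "\<dots> \<le> measure M ?F
          + measure M ?T"
      by (rule measure_Un_le) measurable
    also have "measure M ?F \<le> (C * (a * s)) powr \<alpha>"
      using a s \<theta> by (intro small) auto
    also have "(C * (a * s)) powr \<alpha> = y powr (2 * \<alpha> / 3)"
    proof -
      have "C * (a * s) = y powr (- 1 / 3) * y powr 1" using y by (simp add: y_def a_def)
      also have "\<dots> = y powr (2 / 3)" by (subst powr_add[symmetric]) simp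
      finally show ?thesis by (simp add: powr_powr)
    qed
    also have "measure M ?T \<le> (LINT x|M. (norm (f x))\<^sup>2) / (a\<^sup>2 * ?d)"
      using a by (intro integral_Markov_inequality_measure[where A = "space M", simplified] int) auto
    also have "\<dots> = y powr (2 / 3)"
    proof -
      have "a\<^sup>2 = y powr (- (2 / 3))" unfolding a_def power2_eq_square by (subst powr_add[symmetric]) simp
      thus ?thesis by (simp add: E powr_minus_divide)
    qed
    also have "\<dots> \<le> y powr (2 * \<alpha> / 3)" using y \<alpha> by (intro powr_mono') auto
    finally show ?thesis by (simp add: y_def)
  qed
qed

text \<open>The tangent line at \<open>u = 1\<close> lies above the concave function \<open>u\<^sup>x\<close>.\<close>

lemma powr_le_affine:
  fixes u x :: real
  assumes "u > 0" "0 \<le> x" "x \<le> 1"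
  shows "u powr x \<le> 1 - x + x * u"
proof -
  define y where "y = ln u"
  have u: "u = exp y" using assms by (simp add: y_def)
  have *: "exp (x * y) * (1 + z) \<le> exp (x * y + z)" for z
    unfolding exp_add by (intro mult_left_mono exp_ge_add_one_self) auto
  have "exp (x * y) = x * (exp (x * y) * (1 + (1 - x) * y)) + (1 - x) * (exp (x * y) * (1 + (- x * y)))"
    by (simp add: algebra_simps)
  also have "\<dots> \<le> x * exp (x * y + (1 - x) * y) + (1 - x) * exp (x * y + (- x * y))"
    using assms by (intro add_mono mult_left_mono *) auto
  also have "\<dots> = x * u + (1 - x)" by (simp add: u algebra_simps)
  finally show ?thesis by (simp add: powr_def u)
qed

text \<open>This is the bound \<open>\<Gamma>(1 + x) \<le> 1\<close> for \<open>0 \<le> x \<le> 1\<close>.\<close>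

lemma nn_integral_exp_powr_le_1:
  assumes "0 \<le> x" "x \<le> 1"
  shows "(\<integral>\<^sup>+u. ennreal (exp (- u) * u powr x) * indicator {0..} u \<partial>lborel) \<le> 1"
proof -
  have "(\<integral>\<^sup>+u. ennreal (exp (- u) * u powr x) * indicator {0..} u \<partial>lborel)
      \<le> (\<integral>\<^sup>+u. ennreal (1 - x) * (ennreal (u ^ 0 * exp (- u)) * indicator {0..} u)
             + ennreal x * (ennreal (u ^ 1 * exp (- u)) * indicator {0..} u) \<partial>lborel)"
  proof (intro nn_integral_mono)
    fix u :: real
    have "exp (- u) * u powr x \<le> (1 - x) * exp (- u) + x * (u * exp (- u))" if "u \<ge> 0"
    proof (cases "u = 0")
      case False
      have "exp (- u) * u powr x \<le> exp (- u) * (1 - x + x * u)"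
        using False that assms by (intro mult_left_mono powr_le_affine) auto
      thus ?thesis by (simp add: algebra_simps)
    qed (use assms in auto)
    thus "ennreal (exp (- u) * u powr x) * indicator {0..} u \<le>
       ennreal (1 - x) * (ennreal (u ^ 0 * exp (- u)) * indicator {0..} u)
             + ennreal x * (ennreal (u ^ 1 * exp (- u)) * indicator {0..} u)"
      using assms by (auto simp: indicator_def ennreal_mult'[symmetric] ennreal_plus[symmetric] simp del: ennreal_plus
           intro!: ennreal_leI)
  qed
  also have "\<dots> = ennreal (1 - x) * 1 + ennreal x * 1"
    by (subst nn_integral_add, measurable, subst nn_integral_cmult, measurable, subst nn_integral_cmult, measurable,
        simp only: nn_intergal_power_times_exp_Ici) simp
  also have "\<dots> = 1" using assms by (simp add: ennreal_plus[symmetric] del: ennreal_plus)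
  finally show ?thesis .
qed

text \<open>Write \<open>exp (- l U)\<close> as the integral of \<open>exp (- u)\<close> over \<open>u \<ge> l U\<close> and exchange the integrals:
  the Laplace transform becomes an average of the probabilities \<open>P(U \<le> u / l)\<close>.\<close>

lemma laplace_le_of_small_ball:
  fixes U :: "'a \<Rightarrow> real"
  assumes M: "prob_space M" and U[measurable]: "U \<in> borel_measurable M" and U0: "\<And>w. 0 \<le> U w"
    and small: "\<And>u. u > 0 \<Longrightarrow> measure M {w\<in>space M. U w \<le> u} \<le> c * u powr x"
    and x: "0 \<le> x" "x \<le> 1" and c: "c \<ge> 0" and l: "l > 0"
  shows "(\<integral>\<^sup>+w. ennreal (exp (- (l * U w))) \<partial>M) \<le> ennreal (c * l powr (- x))"
proof -
  interpret prob_space M by fact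
  let ?c = "ennreal (c * l powr (- x))"
  let ?e = "\<lambda>u. ennreal (exp (- u) * u powr x) * indicator {0..} u"
  let ?T = "{p\<in>space (M \<Otimes>\<^sub>M lborel). l * U (fst p) \<le> snd p}"
  have expo: "ennreal (exp (- z)) = (\<integral>\<^sup>+u. ennreal (exp (- u)) * indicator {z..} u \<partial>lborel)" for z :: real
  proof -
    have "(\<integral>\<^sup>+u. ennreal (exp (- u)) * indicator {z..} u \<partial>lborel) = ennreal (0 - (- exp (- z)))"
    proof (rule nn_integral_FTC_atLeast)
      show "((\<lambda>u :: real. - exp (- u)) \<longlongrightarrow> 0) at_top"
        using tendsto_minus[OF filterlim_compose[OF exp_at_bot filterlim_uminus_at_bot_at_top]] by simp
    qed (auto intro!: derivative_eq_intros)
    thus ?thesis by simp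
  qed
  have "(\<integral>\<^sup>+w. ennreal (exp (- (l * U w))) \<partial>M)
      = (\<integral>\<^sup>+w. (\<integral>\<^sup>+u. ennreal (exp (- u)) * indicator {l * U w..} u \<partial>lborel) \<partial>M)"
    by (intro nn_integral_cong expo)
  also have "\<dots> = (\<integral>\<^sup>+w. (\<integral>\<^sup>+u. ennreal (exp (- u)) * indicator {p. l * U (fst p) \<le> snd p} (w, u) \<partial>lborel) \<partial>M)"
    by (intro nn_integral_cong) (auto simp: indicator_def)
  also have "\<dots> = (\<integral>\<^sup>+w. (\<integral>\<^sup>+u. ennreal (exp (- u)) * indicator ?T (w, u) \<partial>lborel) \<partial>M)"
    by (intro nn_integral_cong) (auto simp: indicator_def space_pair_measure)
  also have "\<dots> = (\<integral>\<^sup>+u. (\<integral>\<^sup>+w. ennreal (exp (- u)) * indicator ?T (w, u) \<partial>M) \<partial>lborel)"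
  proof -
    interpret pair_sigma_finite M "lborel :: real measure" by standard
    show ?thesis
      by (rule Fubini'[symmetric]) measurable
  qed
  also have "\<dots> \<le> (\<integral>\<^sup>+u. ?c * ?e u \<partial>lborel)"
  proof (rule nn_integral_mono_AE, rule AE_mp[OF AE_lborel_singleton[of 0]], intro AE_I2 impI)
    fix u :: real assume "u \<noteq> 0"
    have "(\<integral>\<^sup>+w. ennreal (exp (- u)) * indicator ?T (w, u) \<partial>M)
      = (\<integral>\<^sup>+w. ennreal (exp (- u)) * indicator {w\<in>space M. U w \<le> u / l} w \<partial>M)"
    proof -
      have "l * U w \<le> u \<longleftrightarrow> U w \<le> u / l" for w using l by (simp add: le_divide_eq mult.commute)
      thus ?thesis by (intro nn_integral_cong) (simp add: indicator_def space_pair_measure)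
    qed
    also have "\<dots> = ennreal (exp (- u) * measure M {w\<in>space M. U w \<le> u / l})"
      by (subst nn_integral_cmult_indicator) (auto simp: emeasure_eq_measure ennreal_mult)
    also have "\<dots> \<le> ?c * ?e u"
    proof (cases "u > 0")
      case True
      have "exp (- u) * measure M {w\<in>space M. U w \<le> u / l} \<le> exp (- u) * (c * (u / l) powr x)"
        using True l by (intro mult_left_mono small) auto
      also have "\<dots> = (c * l powr (- x)) * (exp (- u) * u powr x)"
        using True l by (simp add: powr_divide powr_minus field_simps)
      finally show ?thesis using True c by (simp add: ennreal_mult'[symmetric] ennreal_leI)
    next
      case False
      have "{w\<in>space M. U w \<le> u / l} = {}"
      proof -
        have "u / l < 0" using False \<open>u \<noteq> 0\<close> l by (simp add: divide_less_0_iff)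
        thus ?thesis using U0 by (auto simp: not_le intro: less_le_trans)
      qed
      thus ?thesis by (simp only: measure_empty) simp
    qed
    finally show "(\<integral>\<^sup>+w. ennreal (exp (- u)) * indicator ?T (w, u) \<partial>M)
      \<le> ?c * ?e u" .
  qed
  also have "\<dots> = ?c * (\<integral>\<^sup>+u. ?e u \<partial>lborel)"
    by (rule nn_integral_cmult) measurable
  also have "\<dots> \<le> ?c * 1"
    by (intro mult_left_mono nn_integral_exp_powr_le_1 x) auto
  finally show ?thesis by simp
qed

lemma chernoff_lower_tail_iid:
  fixes U :: "'a \<Rightarrow> real"
  assumes M: "prob_space M" and U[measurable]: "U \<in> borel_measurable M"
    and laplace: "(\<integral>\<^sup>+w. ennreal (exp (- (l * U w))) \<partial>M) \<le> ennreal L" and L: "L \<ge> 0" and l: "l \<ge> 0"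
  shows "measure (\<Pi>\<^sub>M k\<in>{..<n}. M) {X\<in>space (\<Pi>\<^sub>M k\<in>{..<n}. M). (\<Sum>k<n. U (X k)) \<le> b} \<le> exp (l * b) * L ^ n"
proof -
  interpret M: prob_space M by fact
  interpret P: product_prob_space "\<lambda>_. M" "{..<n}" by standard
  let ?P = "\<Pi>\<^sub>M k\<in>{..<n}. M"
  let ?E = "{X\<in>space ?P. (\<Sum>k<n. U (X k)) \<le> b}"
  let ?e = "\<lambda>X. \<Prod>k<n. ennreal (exp (- (l * U (X k))))"
  have "emeasure ?P ?E
     = (\<integral>\<^sup>+X. indicator ?E X \<partial>?P)"
    by (subst nn_integral_indicator) auto
  also have "\<dots> \<le> (\<integral>\<^sup>+X. ennreal (exp (l * b)) * ?e X \<partial>?P)"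
  proof (intro nn_integral_mono)
    fix X
    have "1 \<le> exp (l * b) * (\<Prod>k<n. exp (- (l * U (X k))))" if "(\<Sum>k<n. U (X k)) \<le> b"
    proof -
      have "l * (\<Sum>k<n. U (X k)) \<le> l * b" using that l by (rule mult_left_mono)
      thus ?thesis
        by (simp add: exp_sum[symmetric] sum_negf sum_distrib_left[symmetric] exp_add[symmetric])
    qed
    hence "ennreal 1 \<le> ennreal (exp (l * b) * (\<Prod>k<n. exp (- (l * U (X k)))))" if "(\<Sum>k<n. U (X k)) \<le> b"
      using that by (intro ennreal_leI) auto
    thus "indicator ?E X \<le> ennreal (exp (l * b)) * ?e X"
      by (auto simp: indicator_def ennreal_mult prod_nonneg prod_ennreal)
  qed
  also have "\<dots> = ennreal (exp (l * b)) * (\<integral>\<^sup>+w. ennreal (exp (- (l * U w))) \<partial>M) ^ n"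
    by (subst nn_integral_cmult, measurable, subst P.product_nn_integral_prod) auto
  also have "\<dots> \<le> ennreal (exp (l * b)) * ennreal L ^ n"
    by (intro mult_left_mono power_mono laplace) auto
  finally have "emeasure ?P ?E \<le> ennreal (exp (l * b) * L ^ n)"
    using L by (simp add: ennreal_mult ennreal_power)
  thus ?thesis using L by (simp add: P.emeasure_eq_measure)
qed

text \<open>The arithmetic behind \<open>C'\<close>.  The first factor counts the grid points at mesh \<open>2 \<surd>t / \<surd>d\<close>, and the
  second is the Chernoff bound for one of them.  Taking logarithms and dividing by
  \<open>r = \<alpha> n / 6 \<ge> d\<close>, the grid contributes \<open>t\<^bsup>-1/2\<^esup>\<close> and the Chernoff bound \<open>t\<^sup>2\<close>.  Only one power of
  \<open>t\<close> is wanted; the surplus \<open>t\<^bsup>1/2\<^esup> \<le> C'\<^bsup>-1/2\<^esup>\<close> pays for all remaining constants.\<close>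

lemma tail_constants:
  fixes C \<alpha> t C' :: real
  assumes \<alpha>: "0 < \<alpha>" "\<alpha> \<le> 1" and C: "C \<ge> 1" and C': "C' = 3 * C ^ 4 * exp (1 + 9 / \<alpha>)"
    and t: "0 < t" "C' * t \<le> 1" and n: "6 / \<alpha> * real d \<le> real n"
  shows "sqrt t \<le> 1 / 100"
    and "(exp 1 * (2 * (1 + 1 / (2 * sqrt t)) + 1)) ^ d *
      (exp (\<alpha> * real n / 3) * (2 * (24 * C\<^sup>2 * t / \<alpha>) powr (\<alpha> / 3)) ^ n) \<le> (C' * t) powr (\<alpha> * real n / 6)"
proof -
  let ?L = "(2 * (24 * C\<^sup>2 * t / \<alpha>) powr (\<alpha> / 3))"
  let ?N = "exp 1 * (2 * (1 + 1 / (2 * sqrt t)) + 1)"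
  define w where "w = 1 / \<alpha>"
  let ?E = "ln 24 + 2 * ln C + ln t + ln w"
  have w: "w \<ge> 1" using \<alpha> by (simp add: w_def)
  have e25: "exp (1::real) \<ge> 5 / 2" using exp_lower_Taylor_quadratic[of 1] by simp
  have C'big: "C' \<ge> 10000"
  proof -
    have "(5/2::real) ^ 10 \<le> exp 1 ^ 10" using e25 by (intro power_mono) auto
    also have "\<dots> = exp 10" by (simp add: exp_of_nat_mult[symmetric])
    also have "\<dots> \<le> exp (1 + 9 / \<alpha>)" using w by (simp add: w_def)
    finally have "5000 \<le> exp (1 + 9 / \<alpha>)" by (simp add: power_numeral_reduce)
    moreover have "1 \<le> C ^ 4" using C by simp
    ultimately have "3 * 1 * 5000 \<le> C'" unfolding C' by (intro mult_mono) auto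
    thus ?thesis by simp
  qed
  have "10000 * t \<le> C' * t" using C'big t by (intro mult_right_mono) auto
  hence "10000 * t \<le> 1" using t by linarith
  hence "t \<le> (1/100)\<^sup>2" by (simp add: power2_eq_square)
  thus st: "sqrt t \<le> 1 / 100" by (rule real_le_lsqrt[rotated -1]) (use t in auto)
  have st0: "sqrt t > 0" using t by simp
  have base: "?N \<le> 3 / sqrt t"
  proof -
    have "?N = exp 1 * ((3 * sqrt t + 1) / sqrt t)" using st0 by (simp add: field_simps)
    also have "\<dots> \<le> 2.72 * ((3 * sqrt t + 1) / sqrt t)" using e_less_272 st0 by (intro mult_right_mono) auto
    also have "\<dots> \<le> 3 / sqrt t" using st0 st by (simp add: field_simps)
    finally show ?thesis .
  qed
  define r where "r = \<alpha> * real n / 6"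
  have nr: "real n = 6 * w * r" using \<alpha> by (simp add: r_def w_def)
  have dr: "real d \<le> r" using n \<alpha> by (simp add: r_def field_simps)
  have r0: "r \<ge> 0" using dr by linarith
  have lnC': "ln C' = ln 3 + 4 * ln C + 1 + 9 * w"
    using C by (simp add: C' ln_mult ln_realpow w_def)
  have lnt: "ln t \<le> - ln C'"
  proof -
    have "ln (C' * t) \<le> 0" using t C'big by (subst ln_le_zero_iff) auto
    thus ?thesis using t C'big by (simp add: ln_mult)
  qed
  have A: "(3 / sqrt t) ^ d \<le> exp (r * (ln 3 - ln t / 2))"
  proof -
    have "(3 / sqrt t) ^ d = exp (real d * (ln 3 - ln t / 2))"
      using t by (simp add: exp_of_nat_mult exp_diff ln_sqrt[symmetric])
    also have "\<dots> \<le> exp (r * (ln 3 - ln t / 2))"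
    proof -
      have "ln C' \<ge> 0" using C'big by simp
      hence "0 \<le> ln 3 - ln t / 2" using lnt ln_ge_zero[of 3] by linarith
      thus ?thesis using dr by (simp add: mult_right_mono)
    qed
    finally show ?thesis .
  qed
  have B: "?L ^ n = exp (6 * w * r * ln 2 + 2 * r * (?E))"
  proof -
    have "?L = exp (ln 2 + \<alpha> / 3 * ln (24 * C\<^sup>2 * t * w))"
      using C t w \<alpha> by (simp add: powr_def exp_add w_def)
    also have "ln (24 * C\<^sup>2 * t * w) = ?E"
      using C t w by (simp add: ln_mult ln_realpow)
    finally have "?L ^ n = exp (real n * (ln 2 + \<alpha> / 3 * (?E)))"
      by (simp only: exp_of_nat_mult)
    also have "real n * (ln 2 + \<alpha> / 3 * (?E)) = real n * ln 2 + (\<alpha> * real n / 3) * (?E)"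
      by (simp add: algebra_simps)
    also have "\<alpha> * real n / 3 = 2 * r" by (simp add: r_def)
    finally show ?thesis by (simp add: nr)
  qed
  have "(?N) ^ d *
      (exp (\<alpha> * real n / 3) * ?L ^ n)
      \<le> exp (r * (ln 3 - ln t / 2)) * (exp (2 * r) * exp (6 * w * r * ln 2 + 2 * r * (?E)))"
  proof (intro mult_mono)
    show "(?N) ^ d \<le> exp (r * (ln 3 - ln t / 2))"
      by (rule order_trans[OF power_mono[OF base] A]) (use st0 in \<open>auto intro!: mult_nonneg_nonneg add_nonneg_nonneg\<close>)
    show "?L ^ n \<le> exp (6 * w * r * ln 2 + 2 * r * (?E))"
      by (simp only: B order_refl)
  qed (auto simp: r_def)
  also have "\<dots> = exp (r * (ln 3 - ln t / 2 + 2 + 6 * w * ln 2 + 2 * (?E)))"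
    by (simp add: exp_add[symmetric] algebra_simps)
  also have "\<dots> \<le> exp (r * (ln C' + ln t))"
  proof -
    have "ln w \<le> w - 1" using w ln_le_minus_one[of w] by auto
    moreover have "6 * w * ln 2 \<le> 25 / 6 * w"
      using mult_left_mono[OF ln2_le_25_over_36, of "6 * w"] w by simp
    moreover have "ln (24::real) \<le> 125 / 36"
    proof -
      have "ln (24::real) \<le> ln (2 ^ 5)" by (subst ln_le_cancel_iff) auto
      also have "ln (2 ^ 5 :: real) = real 5 * ln 2" by (rule ln_realpow)
      finally show ?thesis using ln2_le_25_over_36 by simp
    qed
    moreover have "ln (3::real) \<ge> 0" "ln C \<ge> 0" using C by simp_all
    moreover have "A - T / 2 + 2 + P + 2 * (F + 2 * c + T + W) \<le> D + T"
      if "W \<le> w - 1" "P \<le> 25 / 6 * w" "F \<le> 125 / 36" "0 \<le> A" "0 \<le> c" "T \<le> - D" "D = A + 4 * c + 1 + 9 * w"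
      for A T P F c W D :: real
      using that w by argo
    ultimately have "ln 3 - ln t / 2 + 2 + 6 * w * ln 2 + 2 * (?E) \<le> ln C' + ln t"
      using lnt lnC' by blast
    thus ?thesis using r0 by (simp add: mult_left_mono)
  qed
  also have "\<dots> = (C' * t) powr (\<alpha> * real n / 6)"
    using t C'big by (simp add: powr_def ln_mult r_def)
  finally show "(?N) ^ d *
      (exp (\<alpha> * real n / 3) * ?L ^ n) \<le> (C' * t) powr (\<alpha> * real n / 6)" .
qed

lemma sum_inner_power2_axis_shift:
  fixes g :: "nat \<Rightarrow> real^'d"
  shows "(\<Sum>j<n. ((x + s *\<^sub>R axis i 1) \<bullet> g j)\<^sup>2)
    = (\<Sum>j<n. (x \<bullet> g j)\<^sup>2) + s * (\<Sum>j<n. 2 * (x \<bullet> g j) * (g j $ i)) + s\<^sup>2 * (\<Sum>j<n. (g j $ i)\<^sup>2)"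
  unfolding sum_distrib_left sum.distrib[symmetric]
  by (intro sum.cong) (auto simp: inner_add_left inner_axis' power2_eq_square algebra_simps)

text \<open>The set \<open>B\<close> is the event that one of finitely many grid points \<open>\<theta>\<close>, all of norm at least \<open>1/2\<close>, has
  \<open>\<langle>\<theta>, A' \<theta>\<rangle> \<le> 2 t\<close>, where \<open>A'\<close> is the sample covariance of the clipped vectors.  Outside \<open>B\<close> no
  unit vector \<open>v\<close> can have \<open>\<langle>v, A v\<rangle> \<le> t\<close>, since rounding \<open>v\<close> costs at most another \<open>t\<close>.\<close>

lemma lower_tail_smallest_eigenvalue:
  fixes f :: "'a \<Rightarrow> real^'d"
  assumes M: "prob_space M" and f[measurable]: "f \<in> borel_measurable M"
    and int: "integrable M (\<lambda>x. (norm (f x))\<^sup>2)" and E: "(LINT x|M. (norm (f x))\<^sup>2) = real CARD('d)"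
    and small: "\<And>\<theta> t. \<theta> \<noteq> 0 \<Longrightarrow> t > 0 \<Longrightarrow>
        measure M {x\<in>space M. \<bar>\<theta> \<bullet> f x\<bar> \<le> t * norm \<theta>} \<le> (C * t) powr \<alpha>"
    and \<alpha>: "0 < \<alpha>" "\<alpha> \<le> 1" and C: "C \<ge> 1" and C': "C' = 3 * C ^ 4 * exp (1 + 9 / \<alpha>)"
    and t: "0 < t" "C' * t \<le> 1" and n: "6 / \<alpha> * real CARD('d) \<le> real n"
  obtains B where "B \<in> sets (\<Pi>\<^sub>M k\<in>{..<n}. M)"
    "measure (\<Pi>\<^sub>M k\<in>{..<n}. M) B \<le> (C' * t) powr (\<alpha> * real n / 6)"
    "\<And>X v. X \<in> space (\<Pi>\<^sub>M k\<in>{..<n}. M) \<Longrightarrow> X \<notin> B \<Longrightarrow> real n * t * (norm v)\<^sup>2 \<le> (\<Sum>j<n. (v \<bullet> f (X j))\<^sup>2)"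
proof -
  interpret M: prob_space M by fact
  interpret P: product_prob_space "\<lambda>_. M" "{..<n}" by standard
  let ?P = "\<Pi>\<^sub>M k\<in>{..<n}. M"
  let ?d = "real CARD('d)"
  let ?L = "2 * (24 * C\<^sup>2 * t / \<alpha>) powr (\<alpha> / 3)"
  note tail = tail_constants[OF \<alpha> C C' t n]
  \<comment> \<open>the mesh for which the rounding loss \<open>\<eta>\<^sup>2 d / 4\<close> equals \<open>t\<close>; a unit vector then moves by at most \<open>2 \<surd>t\<close>\<close>
  define \<eta> where "\<eta> = 2 * sqrt t / sqrt ?d"
  define \<rho> where "\<rho> = 1 + 1 / (2 * sqrt t)"
  have st: "sqrt t > 0" using t by simp
  have \<eta>: "\<eta> > 0" using st by (simp add: \<eta>_def)
  have \<rho>: "\<rho> > 0" using st by (simp add: \<rho>_def add_pos_pos)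
  define pt :: "('d \<Rightarrow> int) \<Rightarrow> real^'d" where "pt = (\<lambda>k. \<chi> i. \<eta> * of_int (k i))"
  define G where "G = {k :: 'd \<Rightarrow> int. (\<Sum>i\<in>UNIV. \<bar>of_int (k i)\<bar>) \<le> \<rho> * ?d}"
  define G' where "G' = {k \<in> G. norm (pt k) \<ge> 1/2}"
  define U where "U = (\<lambda>k x. (pt k \<bullet> clip (f x))\<^sup>2)"
  let ?E = "\<lambda>k. {X\<in>space ?P. (\<Sum>j<n. U k (X j)) \<le> 2 * real n * t}"
  have [measurable]: "U k \<in> borel_measurable M" for k unfolding U_def by measurable
  define B where "B = (\<Union>k\<in>G'. ?E k)"
  have finG: "finite G" and cardG: "real (card G) \<le> (exp 1 * (2 * \<rho> + 1)) ^ CARD('d)"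
    unfolding G_def using card_l1_ball_int[OF \<rho>] by auto
  have finG': "finite G'" and cardG': "card G' \<le> card G"
    using finG by (auto simp: G'_def intro: card_mono)
  define Q where "Q = exp (\<alpha> * real n / 3) * ?L ^ n"
  have single: "measure ?P (?E k) \<le> Q" if "k \<in> G'" for k
  proof -
    have pk: "norm (pt k) \<ge> 1/2" "pt k \<noteq> 0" using that by (auto simp: G'_def)
    \<comment> \<open>the minimiser of \<open>exp (2 l t) l\<^bsup>- \<alpha> / 3\<^esup>\<close>\<close>
    define l where "l = \<alpha> / (6 * t)"
    have l: "l > 0" using \<alpha> t by (simp add: l_def)
    define c where "c = 2 * (4 * C\<^sup>2) powr (\<alpha> / 3)"
    have sb: "measure M {x\<in>space M. U k x \<le> u} \<le> c * u powr (\<alpha> / 3)" if "u > 0" for u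
    proof -
      have "measure M {x\<in>space M. U k x \<le> u}
        \<le> measure M {x\<in>space M. \<bar>pt k \<bullet> clip (f x)\<bar> \<le> (2 * sqrt u) * norm (pt k)}"
      proof (rule M.finite_measure_mono)
        show "{x\<in>space M. U k x \<le> u} \<subseteq> {x\<in>space M. \<bar>pt k \<bullet> clip (f x)\<bar> \<le> (2 * sqrt u) * norm (pt k)}"
        proof safe
          fix x assume "U k x \<le> u"
          hence "\<bar>pt k \<bullet> clip (f x)\<bar> \<le> sqrt u" unfolding U_def using real_sqrt_le_mono by fastforce
          also have "\<dots> \<le> (2 * sqrt u) * norm (pt k)"
            using mult_left_mono[OF pk(1), of "2 * sqrt u"] \<open>u > 0\<close> by simp
          finally show "\<bar>pt k \<bullet> clip (f x)\<bar> \<le> (2 * sqrt u) * norm (pt k)" .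
        qed
      qed measurable
      also have "\<dots> \<le> 2 * (C * (2 * sqrt u)) powr (2 * \<alpha> / 3)"
        using \<open>u > 0\<close> by (intro clip_small_ball[OF M f int E small \<alpha> C pk(2)]) auto
      also have "(C * (2 * sqrt u)) powr (2 * \<alpha> / 3) = (4 * C\<^sup>2 * u) powr (\<alpha> / 3)"
      proof -
        have "(4 * C\<^sup>2 * u) powr (\<alpha> / 3) = ((C * (2 * sqrt u)) powr 2) powr (\<alpha> / 3)"
          using C \<open>u > 0\<close> by (simp add: powr_numeral power_mult_distrib mult_ac)
        also have "\<dots> = (C * (2 * sqrt u)) powr (2 * \<alpha> / 3)" by (subst powr_powr) simp
        finally show ?thesis by simp
      qed
      finally show ?thesis using C \<open>u > 0\<close> by (simp add: c_def powr_mult)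
    qed
    have "(\<integral>\<^sup>+x. ennreal (exp (- (l * U k x))) \<partial>M) \<le> ennreal (c * l powr (- (\<alpha> / 3)))"
      by (rule laplace_le_of_small_ball[OF M _ _ sb]) (use \<alpha> l in \<open>auto simp: U_def c_def\<close>)
    also have "c * l powr (- (\<alpha> / 3)) = ?L"
    proof -
      have "l powr (- (\<alpha> / 3)) = (6 * t / \<alpha>) powr (\<alpha> / 3)"
        using \<alpha> t by (simp add: l_def powr_minus powr_divide)
      thus ?thesis using C \<alpha> t by (simp add: c_def powr_mult[symmetric] mult_ac)
    qed
    finally have laplace: "(\<integral>\<^sup>+x. ennreal (exp (- (l * U k x))) \<partial>M) \<le> ennreal ?L" .
    have "measure ?P (?E k)
      \<le> exp (l * (2 * real n * t)) * ?L ^ n"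
      by (rule chernoff_lower_tail_iid[OF M _ laplace]) (use l in auto)
    also have "l * (2 * real n * t) = \<alpha> * real n / 3" using t by (simp add: l_def)
    finally show ?thesis by (simp add: Q_def)
  qed
  have Q0: "Q \<ge> 0" by (simp add: Q_def)
  show ?thesis
  proof (rule that)
    show "B \<in> sets ?P" unfolding B_def using finG' by (intro sets.finite_UN) auto
    have "measure ?P B \<le> (\<Sum>k\<in>G'. measure ?P (?E k))"
      unfolding B_def using finG' by (intro measure_UNION_le) auto
    also have "\<dots> \<le> (\<Sum>k\<in>G'. Q)" by (intro sum_mono single)
    also have "\<dots> \<le> real (card G) * Q" using cardG' Q0 by (simp add: mult_right_mono)
    also have "\<dots> \<le> (exp 1 * (2 * \<rho> + 1)) ^ CARD('d) * Q" by (intro mult_right_mono cardG Q0)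
    also have "\<dots> \<le> (C' * t) powr (\<alpha> * real n / 6)" unfolding Q_def \<rho>_def by (rule tail)
    finally show "measure ?P B \<le> (C' * t) powr (\<alpha> * real n / 6)" .
  next
    fix X v assume X: "X \<in> space ?P" "X \<notin> B"
    let ?tr = "(\<Sum>i\<in>UNIV. (\<Sum>j<n. (clip (f (X j)) $ i)\<^sup>2))"
    have unit: "real n * t < (\<Sum>j<n. (v \<bullet> f (X j))\<^sup>2)" if v: "norm v = 1" for v
    proof (rule ccontr)
      assume "\<not> real n * t < (\<Sum>j<n. (v \<bullet> f (X j))\<^sup>2)"
      hence le: "(\<Sum>j<n. (v \<bullet> f (X j))\<^sup>2) \<le> real n * t" by simp
      define q where "q = (\<lambda>x. \<Sum>j<n. (x \<bullet> clip (f (X j)))\<^sup>2)"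
      have "\<exists>b. \<forall>s. q (x + s *\<^sub>R axis i 1) = q x + s * b + s\<^sup>2 * (\<Sum>j<n. (clip (f (X j)) $ i)\<^sup>2)" for x i
        unfolding q_def sum_inner_power2_axis_shift by blast
      from round_quadratic_to_grid[OF \<eta> _ this, of v] obtain k :: "'d \<Rightarrow> int" where
        k: "\<And>i. \<bar>\<eta> * of_int (k i) - v $ i\<bar> \<le> \<eta>"
        "q (\<chi> i. \<eta> * of_int (k i)) \<le> q v + \<eta>\<^sup>2 / 4 * ?tr"
        by (auto simp: sum_nonneg)
      have "?tr = (\<Sum>j<n. (norm (clip (f (X j))))\<^sup>2)"
        by (subst sum.swap) (simp add: norm_vec_def L2_set_def sum_nonneg)
      also have "\<dots> \<le> (\<Sum>j<n. ?d)"
      proof (rule sum_mono)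
        show "(norm (clip (f (X j))))\<^sup>2 \<le> ?d" for j
          using power_mono[OF norm_clip_le[of "f (X j)"], of 2] by simp
      qed
      finally have "\<eta>\<^sup>2 / 4 * ?tr \<le> \<eta>\<^sup>2 / 4 * (real n * ?d)"
        by (intro mult_left_mono) auto
      also have "\<dots> = real n * t" using t by (simp add: \<eta>_def power_divide power_mult_distrib)
      finally have "q (pt k) \<le> q v + real n * t" using k(2) unfolding pt_def by linarith
      moreover have "q v \<le> real n * t"
        unfolding q_def by (rule order_trans[OF _ le], intro sum_mono)
          (simp add: abs_le_square_iff[symmetric] abs_inner_clip_le)
      ultimately have "q (pt k) \<le> 2 * real n * t" by simp
      moreover have "k \<in> G'"
      proof -
        have "(\<Sum>i\<in>UNIV. \<bar>real_of_int (k i)\<bar>) \<le> (\<Sum>i\<in>UNIV. 1 + \<bar>v $ i\<bar> / \<eta>)"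
        proof (rule sum_mono)
          fix i
          have "\<eta> * \<bar>real_of_int (k i)\<bar> \<le> \<eta> + \<bar>v $ i\<bar>"
          proof -
            have "\<eta> * \<bar>real_of_int (k i)\<bar> = \<bar>\<eta> * real_of_int (k i)\<bar>" using \<eta> by (simp add: abs_mult)
            thus ?thesis using k(1)[of i] by linarith
          qed
          thus "\<bar>real_of_int (k i)\<bar> \<le> 1 + \<bar>v $ i\<bar> / \<eta>" using \<eta> by (simp add: field_simps)
        qed
        also have "\<dots> = ?d + (\<Sum>i\<in>UNIV. \<bar>v $ i\<bar>) / \<eta>" by (simp add: sum.distrib sum_divide_distrib)
        also have "(\<Sum>i\<in>UNIV. \<bar>v $ i\<bar>) \<le> sqrt ?d"
        proof (rule power2_le_imp_le)
          have "(\<Sum>i\<in>UNIV. \<bar>v $ i\<bar>)\<^sup>2 \<le> (\<Sum>i\<in>UNIV. \<bar>v $ i\<bar>\<^sup>2) * ?d"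
            using sum_squared_le_sum_of_squares[of "\<lambda>i. \<bar>v $ i\<bar>" "UNIV :: 'd set"] by simp
          also have "(\<Sum>i\<in>UNIV. \<bar>v $ i\<bar>\<^sup>2) = (norm v)\<^sup>2" by (simp add: norm_vec_def L2_set_def sum_nonneg)
          finally show "(\<Sum>i\<in>UNIV. \<bar>v $ i\<bar>)\<^sup>2 \<le> (sqrt ?d)\<^sup>2" using v by simp
        qed simp
        also have "?d + sqrt ?d / \<eta> = \<rho> * ?d"
          using st by (simp add: \<eta>_def \<rho>_def field_simps)
        finally have "k \<in> G" using \<eta> by (simp add: G_def divide_right_mono)
        moreover have "norm (pt k) \<ge> 1 / 2"
        proof -
          have "(norm (pt k - v))\<^sup>2 = (\<Sum>i\<in>UNIV. \<bar>\<eta> * of_int (k i) - v $ i\<bar>\<^sup>2)"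
            by (simp add: norm_vec_def L2_set_def sum_nonneg pt_def)
          also have "\<dots> \<le> (\<Sum>i\<in>(UNIV::'d set). \<eta>\<^sup>2)" using k(1) by (intro sum_mono power_mono) auto
          also have "\<dots> = (2 * sqrt t)\<^sup>2" by (simp add: \<eta>_def power_divide)
          finally have "norm (pt k - v) \<le> 2 * sqrt t" by (rule power2_le_imp_le) (use st in auto)
          moreover have "norm v \<le> norm (pt k) + norm (pt k - v)"
            by (metis norm_minus_commute norm_triangle_sub)
          ultimately show ?thesis using tail(1) v by simp
        qed
        ultimately show ?thesis by (simp add: G'_def)
      qed
      ultimately have "X \<in> B" using X(1) by (auto simp: B_def q_def U_def)
      thus False using X by simp
    qed
    show "real n * t * (norm v)\<^sup>2 \<le> (\<Sum>j<n. (v \<bullet> f (X j))\<^sup>2)"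
    proof (cases "v = 0")
      case False
      define u where "u = v /\<^sub>R norm v"
      have "norm u = 1" using False by (simp add: u_def)
      from unit[OF this] have "real n * t \<le> (\<Sum>j<n. (u \<bullet> f (X j))\<^sup>2)" by simp
      hence "real n * t * (norm v)\<^sup>2 \<le> (\<Sum>j<n. (u \<bullet> f (X j))\<^sup>2) * (norm v)\<^sup>2" by (rule mult_right_mono) simp
      also have "\<dots> = (\<Sum>j<n. (v \<bullet> f (X j))\<^sup>2)"
      proof -
        have "v = norm v *\<^sub>R u" using False by (simp add: u_def)
        hence "v \<bullet> y = (u \<bullet> y) * norm v" for y by (metis inner_scaleR_left mult.commute)
        thus ?thesis by (simp add: sum_distrib_right power_mult_distrib)
      qed
      finally show ?thesis .
    qed (simp add: sum_nonneg)
  qed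
qed

section \<open>The sample covariance matrix of isotropic vectors\<close>

lemma outer_mult_vec: "outer x *v y = (x \<bullet> y) *\<^sub>R (x :: real^'d)"
  by (simp add: vec_eq_iff outer_def matrix_vector_mult_def inner_vec_def sum_distrib_left sum_distrib_right mult_ac)

lemma trace_outer: "trace (outer x) = (norm x)\<^sup>2"
  by (simp add: trace_def outer_def power2_norm_eq_inner inner_vec_def)

lemma sample_cov_mult_vec: "sample_cov n X *v v = (1 / real n) *\<^sub>R (\<Sum>k<n. (X k \<bullet> v) *\<^sub>R X k)"
  by (simp add: sample_cov_def scaleR_matrix_vector_assoc[symmetric] outer_mult_vec[symmetric])
     (simp add: vec_eq_iff matrix_vector_mult_def sum_distrib_right sum.swap[of _ "{..<n}"])

text \<open>Used with \<open>W = \<Sigma>\<^bsup>-1/2\<^esup>\<close> to whiten, and with the inverse of the sample covariance itself.\<close>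

lemma sample_cov_congruence:
  fixes W :: "real^'d^'d"
  assumes "transpose W = W"
  shows "W ** sample_cov n X ** W = sample_cov n (\<lambda>k. W *v X k)"
proof -
  have "(W ** sample_cov n X ** W) *v y = sample_cov n (\<lambda>k. W *v X k) *v y" for y
  proof -
    have "(W ** sample_cov n X ** W) *v y = W *v ((1 / real n) *\<^sub>R (\<Sum>k<n. (X k \<bullet> (W *v y)) *\<^sub>R X k))"
      by (simp only: matrix_vector_mul_assoc[symmetric] sample_cov_mult_vec)
    also have "\<dots> = (1 / real n) *\<^sub>R (\<Sum>k<n. (X k \<bullet> (W *v y)) *\<^sub>R (W *v X k))"
      by (simp add: matrix_vector_mult_scaleR linear_sum[OF matrix_vector_mul_linear])
    finally show ?thesis by (simp only: inner_matrix_mult_symmetric[OF assms] sample_cov_mult_vec)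
  qed
  thus ?thesis by (simp add: matrix_eq)
qed

lemma sample_cov_quadratic_form: "v \<bullet> (sample_cov n X *v v) = (\<Sum>k<n. (v \<bullet> X k)\<^sup>2) / real n"
  by (simp add: sample_cov_mult_vec inner_sum_right power2_eq_square inner_commute)

lemma transpose_sample_cov: "transpose (sample_cov n X) = sample_cov n X"
  by (simp add: sample_cov_def transpose_def vec_eq_iff outer_def mult.commute)

lemma trace_sample_cov: "trace (sample_cov n X) = (\<Sum>k<n. (norm (X k))\<^sup>2) / real n"
  by (simp add: trace_def sample_cov_def sum.swap[of _ "{..<n}"] trace_outer[symmetric] flip: sum_distrib_left
      sum_divide_distrib)

lemma
  fixes g :: "'a \<Rightarrow> real" and n :: nat
  assumes M: "prob_space M" and g: "integrable M g" and k: "k < n"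
  shows integrable_PiM_component: "integrable (\<Pi>\<^sub>M k\<in>{..<n}. M) (\<lambda>X. g (X k))"
    and integral_PiM_component: "(LINT X|(\<Pi>\<^sub>M k\<in>{..<n}. M). g (X k)) = (LINT x|M. g x)"
proof -
  interpret M: prob_space M by fact
  interpret P: product_prob_space "\<lambda>_. M" "{..<n}" by standard
  let ?P = "\<Pi>\<^sub>M k\<in>{..<n}. M"
  have *: "distr ?P M (\<lambda>X. X k) = M" using k by (intro P.PiM_component) simp
  have m: "(\<lambda>X. X k) \<in> ?P \<rightarrow>\<^sub>M M" using k by (intro measurable_component_singleton) auto
  have "integrable (distr ?P M (\<lambda>X. X k)) g" unfolding * by (rule g)
  thus "integrable ?P (\<lambda>X. g (X k))" using m g by (subst (asm) integrable_distr_eq) auto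
  have "(LINT x|distr ?P M (\<lambda>X. X k). g x) = (LINT X|?P. g (X k))" using m g by (subst integral_distr) auto
  thus "(LINT X|?P. g (X k)) = (LINT x|M. g x)" unfolding * by simp
qed

text \<open>Each product \<open>g (X k) g (X l)\<close> is written as a product over all coordinates, so that
  the integral of a product over a product measure can be applied; off the diagonal it vanishes.\<close>

lemma
  fixes g :: "'a \<Rightarrow> real"
  assumes M: "prob_space M" and g: "integrable M g" and g2: "integrable M (\<lambda>x. (g x)\<^sup>2)" and g0: "(LINT x|M. g x) = 0"
    and n: "n > 0"
  shows integrable_sample_mean_power2: "integrable (\<Pi>\<^sub>M k\<in>{..<n}. M) (\<lambda>X. ((\<Sum>k<n. g (X k)) / real n)\<^sup>2)"
    and integral_sample_mean_power2: "(LINT X|(\<Pi>\<^sub>M k\<in>{..<n}. M). ((\<Sum>k<n. g (X k)) / real n)\<^sup>2)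
        = (LINT x|M. (g x)\<^sup>2) / real n"
proof -
  interpret M: prob_space M by fact
  interpret P: product_prob_space "\<lambda>_. M" "{..<n}" by standard
  let ?P = "\<Pi>\<^sub>M k\<in>{..<n}. M"
  \<comment> \<open>the factor of \<open>g (X k) g (X l)\<close> that belongs to coordinate \<open>i\<close>\<close>
  define h where "h = (\<lambda>(k::nat) l i x. if i = k then (if k = l then (g x)\<^sup>2 else g x) else if i = l then g x else 1)"
  have hi: "integrable M (h k l i)" for k l i
    using g g2 by (cases "i = k"; cases "k = l"; cases "i = l") (simp_all add: h_def)
  have prod: "g (X k) * g (X l) = (\<Prod>i<n. h k l i (X i))" if "k < n" "l < n" for k l X
  proof (cases "k = l")
    case True
    have "(\<Prod>i<n. h k l i (X i)) = (\<Prod>i<n. if i = k then (g (X i))\<^sup>2 else 1)"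
      using True by (intro prod.cong) (auto simp: h_def)
    also have "\<dots> = (g (X k))\<^sup>2" using that by (simp add: prod.delta)
    finally show ?thesis using True by (simp add: power2_eq_square)
  next
    case False
    have "(\<Prod>i<n. h k l i (X i)) = (\<Prod>i<n. (if i = k then g (X i) else 1) * (if i = l then g (X i) else 1))"
      using False by (intro prod.cong) (auto simp: h_def)
    also have "\<dots> = g (X k) * g (X l)" using that by (simp add: prod.distrib prod.delta)
    finally show ?thesis by simp
  qed
  have int: "integrable ?P (\<lambda>X. g (X k) * g (X l))" if "k < n" "l < n" for k l
    unfolding prod[OF that] by (rule P.product_integrable_prod) (auto intro: hi)
  have val: "(LINT X|?P. g (X k) * g (X l)) = (if k = l then (LINT x|M. (g x)\<^sup>2) else 0)" if "k < n" "l < n" for k l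
  proof -
    have "(LINT X|?P. g (X k) * g (X l)) = (\<Prod>i<n. LINT x|M. h k l i x)"
      unfolding prod[OF that] by (rule P.product_integral_prod) (auto intro: hi)
    also have "\<dots> = (\<Prod>i<n. if i = k then (if k = l then (LINT x|M. (g x)\<^sup>2) else 0) else if i = l then 0 else 1)"
      by (intro prod.cong) (auto simp: h_def g0 M.prob_space)
    also have "\<dots> = (if k = l then (LINT x|M. (g x)\<^sup>2) else 0)"
    proof (cases "k = l")
      case True
      have "(\<Prod>i<n. if i = k then (if k = l then (LINT x|M. (g x)\<^sup>2) else 0) else if i = l then 0 else 1)
         = (\<Prod>i<n. if i = k then (LINT x|M. (g x)\<^sup>2) else 1)" using True by (intro prod.cong) auto
      thus ?thesis using that True by (simp add: prod.delta)
    next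
      case False
      thus ?thesis using that by (auto intro!: prod_zero bexI[of _ k])
    qed
    finally show ?thesis .
  qed
  have expand: "((\<Sum>k<n. g (X k)) / real n)\<^sup>2 = (\<Sum>k<n. \<Sum>l<n. g (X k) * g (X l)) / (real n)\<^sup>2" for X
    by (simp add: power2_eq_square sum_product)
  show "integrable ?P (\<lambda>X. ((\<Sum>k<n. g (X k)) / real n)\<^sup>2)"
    unfolding expand by (intro integrable_divide Bochner_Integration.integrable_sum int) auto
  have "(LINT X|?P. ((\<Sum>k<n. g (X k)) / real n)\<^sup>2) = (\<Sum>k<n. \<Sum>l<n. if k
      = l then (LINT x|M. (g x)\<^sup>2) else 0) / (real n)\<^sup>2"
  proof -
    have "(LINT X|?P. (\<Sum>k<n. \<Sum>l<n. g (X k) * g (X l))) = (\<Sum>k<n. LINT X|?P. (\<Sum>l<n. g (X k) * g (X l)))"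
      by (intro Bochner_Integration.integral_sum Bochner_Integration.integrable_sum int) auto
    also have "\<dots> = (\<Sum>k<n. \<Sum>l<n. LINT X|?P. g (X k) * g (X l))"
      by (intro sum.cong refl Bochner_Integration.integral_sum int) auto
    also have "\<dots> = (\<Sum>k<n. \<Sum>l<n. if k = l then (LINT x|M. (g x)\<^sup>2) else 0)"
      by (intro sum.cong refl val) auto
    finally show ?thesis unfolding expand by simp
  qed
  also have "\<dots> = (LINT x|M. (g x)\<^sup>2) / real n" using n by (simp add: power2_eq_square)
  finally show "(LINT X|?P. ((\<Sum>k<n. g (X k)) / real n)\<^sup>2) = (LINT x|M. (g x)\<^sup>2) / real n" .
qed

lemma norm_matrix_power2: "(norm (B :: real^'d^'d))\<^sup>2 = (\<Sum>i\<in>UNIV. \<Sum>j\<in>UNIV. (B $ i $ j)\<^sup>2)"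
  by (simp add: norm_vec_def L2_set_def sum_nonneg)

lemma borel_measurable_component [measurable (raw)]:
  fixes f :: "'a \<Rightarrow> real^'d"
  assumes "f \<in> borel_measurable M"
  shows "(\<lambda>x. f x $ i) \<in> borel_measurable M"
proof -
  have "(\<lambda>x. f x $ i) = (\<lambda>x. f x \<bullet> axis i 1)" by (simp add: inner_axis)
  thus ?thesis using assms by simp
qed

text \<open>Every entry of \<open>A - I\<close> is the mean of \<open>n\<close> independent centred variables, so its second moment is
  \<open>1 / n\<close> times a variance, and these variances sum to \<open>E |f|\<^sup>4 - d\<close>.\<close>

lemma sample_cov_deviation:
  fixes f :: "'a \<Rightarrow> real^'d"
  assumes M: "prob_space M" and f[measurable]: "f \<in> borel_measurable M"
    and iso: "\<And>i j. integrable M (\<lambda>x. f x $ i * f x $ j)"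
       "\<And>i j. (LINT x|M. f x $ i * f x $ j) = (if i = j then 1 else 0)"
    and f4: "integrable M (\<lambda>x. norm (f x) ^ 4)" and n: "n > 0"
  shows "integrable (\<Pi>\<^sub>M k\<in>{..<n}. M) (\<lambda>X. (norm (sample_cov n (\<lambda>k. f (X k)) - mat 1))\<^sup>2)"
    and "(LINT X|(\<Pi>\<^sub>M k\<in>{..<n}. M). (norm (sample_cov n (\<lambda>k. f (X k)) - mat 1))\<^sup>2)
           \<le> (LINT x|M. norm (f x) ^ 4) / real n"
proof -
  interpret M: prob_space M by fact
  let ?P = "\<Pi>\<^sub>M k\<in>{..<n}. M"
  define g where "g = (\<lambda>i j x. f x $ i * f x $ j - (if i = j then 1 else 0))"
  have gi: "integrable M (g i j)" and g0: "(LINT x|M. g i j x) = 0" for i j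
    using iso[of i j] by (auto simp: g_def M.prob_space)
  have ff2: "integrable M (\<lambda>x. (f x $ i * f x $ j)\<^sup>2)" for i j
  proof (rule Bochner_Integration.integrable_bound[OF f4])
    show "AE x in M. norm ((f x $ i * f x $ j)\<^sup>2) \<le> norm (norm (f x) ^ 4)"
    proof (rule AE_I2)
      fix x
      have "\<bar>f x $ i * f x $ j\<bar> \<le> norm (f x) * norm (f x)"
        unfolding abs_mult by (intro mult_mono component_le_norm_cart) auto
      hence "\<bar>f x $ i * f x $ j\<bar>\<^sup>2 \<le> (norm (f x) * norm (f x))\<^sup>2" by (rule power_mono) simp
      also have "(norm (f x) * norm (f x))\<^sup>2 = norm (f x) ^ 4" by (simp add: power2_eq_square power4_eq_xxxx)
      finally show "norm ((f x $ i * f x $ j)\<^sup>2) \<le> norm (norm (f x) ^ 4)" by simp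
    qed
  qed measurable
  have g2: "integrable M (\<lambda>x. (g i j x)\<^sup>2)"
    and Eg2: "(LINT x|M. (g i j x)\<^sup>2) = (LINT x|M. (f x $ i * f x $ j)\<^sup>2) - (if i = j then 1 else 0)" for i j
  proof -
    have eq: "(g i j x)\<^sup>2 = (f x $ i * f x $ j)\<^sup>2 - (if i = j then 2 * (f x $ i * f x $ j) - 1 else 0)" for x
      by (simp add: g_def power2_diff)
    show "integrable M (\<lambda>x. (g i j x)\<^sup>2)" unfolding eq using ff2[of i j] iso(1)[of i j] by (cases "i = j") simp_all
    show "(LINT x|M. (g i j x)\<^sup>2) = (LINT x|M. (f x $ i * f x $ j)\<^sup>2) - (if i = j then 1 else 0)"
      unfolding eq using ff2[of i j] iso(1)[of i j] iso(2)[of i j]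
      by (cases "i = j") (simp_all add: M.prob_space)
  qed
  have dev: "(norm (sample_cov n (\<lambda>k. f (X k)) - mat 1))\<^sup>2
      = (\<Sum>i\<in>UNIV. \<Sum>j\<in>UNIV. ((\<Sum>k<n. g i j (X k)) / real n)\<^sup>2)" for X
    unfolding norm_matrix_power2 using n
    by (intro sum.cong refl arg_cong[where f = "\<lambda>z. z\<^sup>2"])
      (simp add: sample_cov_def outer_def mat_def g_def sum_subtractf diff_divide_distrib)
  note mean = integrable_sample_mean_power2[OF M gi g2 g0 n] integral_sample_mean_power2[OF M gi g2 g0 n]
  show "integrable ?P (\<lambda>X. (norm (sample_cov n (\<lambda>k. f (X k)) - mat 1))\<^sup>2)"
    unfolding dev by (intro Bochner_Integration.integrable_sum mean)
  have "(LINT X|?P. (norm (sample_cov n (\<lambda>k. f (X k)) - mat 1))\<^sup>2)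
      = (\<Sum>i\<in>UNIV. \<Sum>j\<in>UNIV. (LINT x|M. (g i j x)\<^sup>2) / real n)"
    unfolding dev by (simp add: Bochner_Integration.integral_sum mean Bochner_Integration.integrable_sum)
  also have "\<dots> \<le> (\<Sum>i\<in>UNIV. \<Sum>j\<in>UNIV. (LINT x|M. (f x $ i * f x $ j)\<^sup>2) / real n)"
    unfolding Eg2 by (intro sum_mono divide_right_mono) auto
  also have "\<dots> = (LINT x|M. (\<Sum>i\<in>UNIV. \<Sum>j\<in>UNIV. (f x $ i * f x $ j)\<^sup>2)) / real n"
    by (simp add: Bochner_Integration.integral_sum ff2 Bochner_Integration.integrable_sum sum_divide_distrib)
  also have "(\<lambda>x. \<Sum>i\<in>UNIV. \<Sum>j\<in>UNIV. (f x $ i * f x $ j)\<^sup>2) = (\<lambda>x. norm (f x) ^ 4)"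
  proof
    fix x
    have "norm (f x) ^ 4 = (norm (f x))\<^sup>2 * (norm (f x))\<^sup>2" by (simp add: power2_eq_square power4_eq_xxxx)
    also have "(norm (f x))\<^sup>2 = (\<Sum>i\<in>UNIV. (f x $ i)\<^sup>2)" by (simp add: norm_vec_def L2_set_def sum_nonneg)
    finally show "(\<Sum>i\<in>UNIV. \<Sum>j\<in>UNIV. (f x $ i * f x $ j)\<^sup>2) = norm (f x) ^ 4"
      by (simp add: sum_product power_mult_distrib)
  qed
  finally show "(LINT X|?P. (norm (sample_cov n (\<lambda>k. f (X k)) - mat 1))\<^sup>2)
           \<le> (LINT x|M. norm (f x) ^ 4) / real n" .
qed

text \<open>With \<open>y = r / 2\<close> the hypothesis on \<open>n\<close> says \<open>12 / \<alpha> \<le> e\<^sup>y\<close>, so \<open>4 n = 4 y (12 / \<alpha>)\<close> is at most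
  \<open>e\<^sup>y e\<^sup>y = e\<^sup>r \<le> 4\<^sup>r\<close>.\<close>

lemma sample_size_beats_tail:
  fixes \<alpha> :: real
  assumes \<alpha>: "0 < \<alpha>" "\<alpha> \<le> 1" and n: "real n \<ge> 12 / \<alpha> * ln (12 / \<alpha>)"
  defines "r \<equiv> \<alpha> * real n / 6"
  shows "2 \<le> r" and "4 * real n * (1 / 4) powr r \<le> 1"
proof -
  define y where "y = r / 2"
  have m: "12 / \<alpha> \<ge> 12" using \<alpha> by (simp add: field_simps)
  have "12 / \<alpha> * ln (12 / \<alpha>) * (\<alpha> / 12) \<le> real n * (\<alpha> / 12)"
    using n \<alpha> by (intro mult_right_mono) auto
  hence y: "ln (12 / \<alpha>) \<le> y" using \<alpha> by (simp add: y_def r_def mult_ac)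
  have "ln 12 \<le> ln (12 / \<alpha>)" using m using \<alpha> by (subst ln_le_cancel_iff) auto
  with y have y12: "ln 12 \<le> y" by simp
  have ln12: "1 \<le> ln (12::real)" "ln (12::real) \<le> 3"
  proof -
    have "exp 1 \<le> (12::real)" using exp_le by simp
    thus "1 \<le> ln (12::real)" by (subst ln_ge_iff) auto
    have e25: "exp (1::real) \<ge> 5 / 2" using exp_lower_Taylor_quadratic[of 1] by simp
    have "(12::real) \<le> (5/2) ^ 3" by (simp add: power3_eq_cube)
    also have "\<dots> \<le> exp 1 ^ 3" using e25 by (intro power_mono) auto
    also have "\<dots> = exp 3" by (simp add: exp_of_nat_mult[symmetric])
    finally have "ln (12::real) \<le> ln (exp 3)" by (subst ln_le_cancel_iff) auto
    thus "ln (12::real) \<le> 3" by simp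
  qed
  show "2 \<le> r" using y12 ln12 by (simp add: y_def)
  have m_le: "12 / \<alpha> \<le> exp y" using y \<alpha> by (metis divide_pos_pos exp_le_cancel_iff exp_ln zero_less_numeral)
  have y4: "4 * y \<le> exp y"
  proof -
    have "12 * (1 + (y - ln 12)) \<le> exp (ln 12) * exp (y - ln 12)"
      by (intro mult_mono exp_ge_add_one_self) (use y12 in auto)
    also have "\<dots> = exp y" by (simp add: exp_diff)
    finally show ?thesis using y12 ln12 by argo
  qed
  have "(1 / 4 :: real) powr r \<le> exp (- r)"
  proof -
    have "(1::real) \<le> ln 4"
    proof -
      have "exp 1 \<le> (4::real)" using exp_le by simp
      thus ?thesis by (subst ln_ge_iff) auto
    qed
    hence "r * 1 \<le> r * ln 4" using \<open>2 \<le> r\<close> by (intro mult_left_mono) auto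
    thus ?thesis by (simp add: powr_def ln_div)
  qed
  hence "4 * real n * (1 / 4) powr r \<le> 4 * real n * exp (- r)" by (intro mult_left_mono) auto
  also have "\<dots> = 4 * y * (12 / \<alpha>) * exp (- r)" using \<alpha> by (simp add: y_def r_def)
  also have "\<dots> \<le> exp y * exp y * exp (- r)"
    using y4 m_le y12 ln12 \<alpha> by (intro mult_right_mono mult_mono) auto
  also have "\<dots> = 1" by (simp add: exp_add[symmetric] y_def)
  finally show "4 * real n * (1 / 4) powr r \<le> 1" .
qed

section \<open>The expected trace of the inverse sample covariance\<close>

text \<open>The threshold \<open>K = 4 C'\<close> for \<open>1 / \<lambda>\<close> splits the constant \<open>8 C'\<close> evenly: half bounds
  \<open>K E |A - I|\<^sup>2\<close>, half the series over the dyadic events, which sums to \<open>4 d K 4\<^bsup>-r\<^esup>\<close>.\<close>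

lemma expected_trace_inv_sample_cov:
  fixes f :: "'a \<Rightarrow> real^'d"
  assumes M: "prob_space M" and f[measurable]: "f \<in> borel_measurable M"
    and iso: "\<And>i j. integrable M (\<lambda>x. f x $ i * f x $ j)"
       "\<And>i j. (LINT x|M. f x $ i * f x $ j) = (if i = j then 1 else 0)"
    and f4: "integrable M (\<lambda>x. norm (f x) ^ 4)" and \<kappa>: "(LINT x|M. norm (f x) ^ 4) \<le> \<kappa> * real CARD('d) ^ 2"
    and small: "\<And>\<theta> t. \<theta> \<noteq> 0 \<Longrightarrow> t > 0 \<Longrightarrow>
        measure M {x\<in>space M. \<bar>\<theta> \<bullet> f x\<bar> \<le> t * norm \<theta>} \<le> (C * t) powr \<alpha>"
    and \<alpha>: "0 < \<alpha>" "\<alpha> \<le> 1" and C: "C \<ge> 1" and C': "C' = 3 * C ^ 4 * exp (1 + 9 / \<alpha>)"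
    and n1: "n \<ge> 1" and n6: "6 / \<alpha> * real CARD('d) \<le> real n" and n12: "12 / \<alpha> * ln (12 / \<alpha>) \<le> real n"
  shows "(\<integral>\<^sup>+X. trace_inv (sample_cov n (\<lambda>k. f (X k))) \<partial>(\<Pi>\<^sub>M k\<in>{..<n}. M))
    \<le> ennreal (real CARD('d) + 8 * C' * \<kappa> * real CARD('d) ^ 2 / real n)"
proof -
  interpret M: prob_space M by fact
  interpret P: product_prob_space "\<lambda>_. M" "{..<n}" by standard
  let ?P = "\<Pi>\<^sub>M k\<in>{..<n}. M"
  have PS: "prob_space ?P" by (intro prob_space_PiM M)
  let ?d = "real CARD('d)"
  define A where "A = (\<lambda>X. sample_cov n (\<lambda>k. f (X k)))"
  have n0: "n > 0" using n1 by simp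
  have sq: "(norm (f x))\<^sup>2 = (\<Sum>i\<in>UNIV. f x $ i * f x $ i)" for x
    by (simp add: power2_norm_eq_inner inner_vec_def)
  have int2: "integrable M (\<lambda>x. (norm (f x))\<^sup>2)" and E2: "(LINT x|M. (norm (f x))\<^sup>2) = ?d"
    unfolding sq using iso by (auto simp: Bochner_Integration.integral_sum)
  have d1: "?d \<ge> 1" by (simp add: Suc_leI)
  have \<kappa>1: "\<kappa> \<ge> 1"
  proof -
    \<comment> \<open>\<open>|f|\<^sup>2\<close> has mean \<open>d\<close>, so its second moment is at least \<open>d\<^sup>2\<close>\<close>
    have "0 \<le> (LINT x|M. ((norm (f x))\<^sup>2 - ?d)\<^sup>2)" by simp
    also have "(\<lambda>x. ((norm (f x))\<^sup>2 - ?d)\<^sup>2) = (\<lambda>x. norm (f x) ^ 4 - 2 * ?d * (norm (f x))\<^sup>2 + ?d ^ 2)"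
      by (simp add: fun_eq_iff power2_diff flip: power_mult)
    also have "(LINT x|M. norm (f x) ^ 4 - 2 * ?d * (norm (f x))\<^sup>2 + ?d ^ 2) = (LINT x|M. norm (f x) ^ 4) - ?d ^ 2"
      using f4 int2 by (simp add: E2 M.prob_space) (simp add: power2_eq_square)
    finally have "1 * ?d ^ 2 \<le> \<kappa> * ?d ^ 2" using \<kappa> by linarith
    thus ?thesis by (rule mult_right_le_imp_le) simp
  qed
  have C'1: "C' \<ge> 1"
  proof -
    have "1 * 1 * 1 \<le> 3 * C ^ 4 * exp (1 + 9 / \<alpha>)" using C \<alpha> by (intro mult_mono) auto
    thus ?thesis by (simp add: C')
  qed
  define K where "K = 4 * C'"
  have K: "K \<ge> 1/2" "K > 0" using C'1 by (auto simp: K_def)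
  define r where "r = \<alpha> * real n / 6"
  have r2: "2 \<le> r" and rn: "4 * real n * (1 / 4) powr r \<le> 1"
    unfolding r_def using sample_size_beats_tail[OF \<alpha> n12] by auto
  have "\<exists>B. B \<in> sets ?P \<and> measure ?P B \<le> (1 / 4) powr r * (1 / 4) ^ j \<and>
     (\<forall>X v. X \<in> space ?P \<longrightarrow> X \<notin> B \<longrightarrow> (norm v)\<^sup>2 / (K * 2 ^ j) \<le> v \<bullet> (A X *v v))" for j :: nat
  proof -
    define t where "t = 1 / (K * 2 ^ j)"
    have t: "t > 0" "C' * t = (1 / 4) * (1 / 2) ^ j" using K C'1 by (auto simp: t_def K_def power_one_over)
    have "(1 / 2 :: real) ^ j \<le> 1" by (simp add: power_le_one)
    hence t1: "C' * t \<le> 1" unfolding t(2) by simp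
    from lower_tail_smallest_eigenvalue[OF M f int2 E2 small \<alpha> C C' t(1) t1 n6]
    obtain B where B: "B \<in> sets ?P" "measure ?P B \<le> (C' * t) powr r"
       "\<And>X v. X \<in> space ?P \<Longrightarrow> X \<notin> B \<Longrightarrow> real n * t * (norm v)\<^sup>2 \<le> (\<Sum>j<n. (v \<bullet> f (X j))\<^sup>2)"
      unfolding r_def by blast
    have "(C' * t) powr r = (1 / 4) powr r * ((1 / 2) ^ j) powr r"
      unfolding t(2) by (rule powr_mult)
    also have "((1 / 2 :: real) ^ j) powr r \<le> ((1 / 2) ^ j) powr 2"
      using r2 by (intro powr_mono') (auto simp: power_le_one)
    also have "((1 / 2 :: real) ^ j) powr 2 = (1 / 4) ^ j"
      by (simp add: powr_numeral power2_eq_square flip: power_mult_distrib)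
    finally have "measure ?P B \<le> (1 / 4) powr r * (1 / 4) ^ j" using B(2) by (simp add: mult_left_mono)
    moreover have "(norm v)\<^sup>2 / (K * 2 ^ j) \<le> v \<bullet> (A X *v v)" if "X \<in> space ?P" "X \<notin> B" for X v
      using B(3)[OF that, of v] n0 unfolding A_def sample_cov_quadratic_form t_def
      by (simp add: field_simps)
    ultimately show ?thesis using B(1) by blast
  qed
  then obtain B where B: "\<And>j. B j \<in> sets ?P" "\<And>j. measure ?P (B j) \<le> (1 / 4) powr r * (1 / 4) ^ j"
    "\<And>j X v. X \<in> space ?P \<Longrightarrow> X \<notin> B j \<Longrightarrow> (norm v)\<^sup>2 / (K * 2 ^ j) \<le> v \<bullet> (A X *v v)"
    by metis
  note [measurable] = B(1)
  define h where "h = (\<lambda>X. 2 * ?d + K * (norm (A X - mat 1))\<^sup>2 - trace (A X))"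
  have h0: "h X \<ge> 0" for X unfolding h_def using second_order_bound_nonneg[OF K(1)] by simp
  have A: "sample_cov n (\<lambda>k. f (X k)) = A X" for X by (simp add: A_def)
  note dev = sample_cov_deviation[OF M f iso f4 n0, unfolded A]
  have int_comp: "integrable ?P (\<lambda>X. (norm (f (X k)))\<^sup>2)" "(LINT X|?P. (norm (f (X k)))\<^sup>2) = ?d" if "k < n" for k
    using integrable_PiM_component[OF M int2 that] integral_PiM_component[OF M int2 that] by (simp_all add: E2)
  have int_tr: "integrable ?P (\<lambda>X. trace (A X))" and E_tr: "(LINT X|?P. trace (A X)) = ?d"
  proof -
    show "integrable ?P (\<lambda>X. trace (A X))" unfolding A_def trace_sample_cov
      by (intro integrable_divide Bochner_Integration.integrable_sum int_comp) auto
    have "(LINT X|?P. (\<Sum>k<n. (norm (f (X k)))\<^sup>2)) = (\<Sum>k<n. (LINT X|?P. (norm (f (X k)))\<^sup>2))"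
      by (intro Bochner_Integration.integral_sum int_comp) auto
    also have "\<dots> = real n * ?d" using int_comp(2) by simp
    finally show "(LINT X|?P. trace (A X)) = ?d" unfolding A_def trace_sample_cov using n0 by simp
  qed
  have int_h: "integrable ?P h" unfolding h_def using dev(1) int_tr by auto
  have "(LINT X|?P. h X) = 2 * ?d + K * (LINT X|?P. (norm (A X - mat 1))\<^sup>2) - ?d"
    unfolding h_def using dev(1) int_tr E_tr by (simp add: prob_space.prob_space[OF PS])
  also have "\<dots> \<le> ?d + K * (\<kappa> * ?d ^ 2 / real n)"
  proof -
    have "(LINT X|?P. (norm (A X - mat 1))\<^sup>2) \<le> \<kappa> * ?d ^ 2 / real n"
      by (rule order_trans[OF dev(2)]) (use \<kappa> in \<open>simp add: divide_right_mono\<close>)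
    from mult_left_mono[OF this, of K] K show ?thesis by simp
  qed
  finally have Eh: "(LINT X|?P. h X) \<le> ?d + K * (\<kappa> * ?d ^ 2 / real n)" .
  have "(\<integral>\<^sup>+X. trace_inv (A X) \<partial>?P) \<le> (\<integral>\<^sup>+X. ennreal (h X) + (\<Sum>j. ennreal (?d * (K * 2 ^ Suc j))
      * indicator (B j) X) \<partial>?P)"
  proof (intro nn_integral_mono)
    fix X assume "X \<in> space ?P"
    from B(3)[OF this] show "trace_inv (A X) \<le> ennreal (h X) + (\<Sum>j. ennreal (?d * (K * 2 ^ Suc j))
        * indicator (B j) X)"
      unfolding h_def by (intro trace_inv_le_dyadic K) (auto simp: A_def transpose_sample_cov)
  qed
  also have "\<dots> = (\<integral>\<^sup>+X. ennreal (h X) \<partial>?P) + (\<integral>\<^sup>+X. (\<Sum>j. ennreal (?d * (K * 2 ^ Suc j)) * indicator (B j) X) \<partial>?P)"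
    using int_h by (intro nn_integral_add) auto
  also have "(\<integral>\<^sup>+X. ennreal (h X) \<partial>?P) = ennreal (LINT X|?P. h X)"
    using int_h h0 by (intro nn_integral_eq_integral) auto
  also have "(\<integral>\<^sup>+X. (\<Sum>j. ennreal (?d * (K * 2 ^ Suc j)) * indicator (B j) X) \<partial>?P)
     = (\<Sum>j. ennreal (?d * (K * 2 ^ Suc j)) * emeasure ?P (B j))"
    by (subst nn_integral_suminf) (auto simp: nn_integral_cmult_indicator)
  also have "\<dots> \<le> (\<Sum>j. ennreal (?d * K * (1 / 4) powr r * 2 * (1 / 2) ^ j))"
  proof (intro suminf_le summableI)
    fix j
    have "ennreal (?d * (K * 2 ^ Suc j)) * emeasure ?P (B j) \<le> ennreal (?d * (K * 2 ^ Suc j))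
        * ennreal ((1 / 4) powr r * (1 / 4) ^ j)"
      using B(2)[of j] by (intro mult_left_mono) (auto simp: P.emeasure_eq_measure intro!: ennreal_leI)
    also have "\<dots> = ennreal (?d * K * (1 / 4) powr r * 2 * (2 ^ j * (1 / 4) ^ j))"
      using K by (simp add: ennreal_mult'[symmetric] mult_ac)
    also have "2 ^ j * (1 / 4 :: real) ^ j = (1 / 2) ^ j"
      by (simp add: power_mult_distrib[symmetric])
    finally show "ennreal (?d * (K * 2 ^ Suc j)) * emeasure ?P (B j) \<le> ennreal (?d * K * (1 / 4) powr r * 2
        * (1 / 2) ^ j)" .
  qed
  also have "\<dots> = ennreal (?d * K * (1 / 4) powr r * 2 * 2)"
  proof -
    have "(\<lambda>j. (1 / 2 :: real) ^ j) sums 2" using geometric_sums[of "1 / 2 :: real"] by simp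
    hence "(\<lambda>j. ?d * K * (1 / 4) powr r * 2 * (1 / 2) ^ j) sums (?d * K * (1 / 4) powr r * 2 * 2)" by (rule sums_mult)
    thus ?thesis using K by (intro sums_unique[symmetric] sums_ennreal[THEN iffD2]) auto
  qed
  finally have "(\<integral>\<^sup>+X. trace_inv (A X) \<partial>?P) \<le> ennreal (LINT X|?P. h X) + ennreal (?d * K * (1 / 4) powr r * 2 * 2)"
    by (simp add: add_left_mono)
  also have "\<dots> = ennreal ((LINT X|?P. h X) + ?d * K * (1 / 4) powr r * 2 * 2)"
    using K h0 by (intro ennreal_plus[symmetric]) auto
  also have "\<dots> \<le> ennreal (?d + 8 * C' * \<kappa> * ?d ^ 2 / real n)"
  proof (rule ennreal_leI)
    have "4 * (1 / 4) powr r \<le> 1 / real n" using rn n0 by (simp add: field_simps)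
    hence "?d * K * (4 * (1 / 4) powr r) \<le> ?d * K * (1 / real n)" using K by (intro mult_left_mono) auto
    also have "\<dots> \<le> (?d * (\<kappa> * ?d)) * K * (1 / real n)"
    proof -
      have "1 * 1 \<le> \<kappa> * ?d" using \<kappa>1 d1 by (intro mult_mono) auto
      hence "?d * 1 \<le> ?d * (\<kappa> * ?d)" by (intro mult_left_mono) auto
      thus ?thesis using K by (intro mult_right_mono) auto
    qed
    finally have "?d * K * (1 / 4) powr r * 2 * 2 \<le> K * (\<kappa> * ?d ^ 2 / real n)"
      by (simp add: power2_eq_square mult_ac)
    thus "(LINT X|?P. h X) + ?d * K * (1 / 4) powr r * 2 * 2 \<le> ?d + 8 * C' * \<kappa> * ?d ^ 2 / real n"
      using Eh by (simp add: K_def)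
  qed
  finally show ?thesis by (simp add: A_def)
qed

section \<open>Random design and well-specified laws\<close>

text \<open>The assumptions on the covariates that give meaning to whitening.\<close>

locale linear_design = prob_space PX for PX :: "(real^'d) measure" +
  assumes sets_PX [measurable_cong]: "sets PX = sets borel"
    and integrable_norm_power2: "integrable PX (\<lambda>x. (norm x)\<^sup>2)"
    and invertible_second_moment: "invertible (second_moment PX)"
begin

abbreviation S :: "real^'d^'d" where "S \<equiv> psd_sqrt (second_moment PX)"
abbreviation W :: "real^'d^'d" where "W \<equiv> matrix_inv S"

lemma space_PX [simp]: "space PX = UNIV"
  using sets_eq_imp_space_eq[OF sets_PX] by simp

lemma integrable_component_mult: "integrable PX (\<lambda>x. x $ i * x $ j)"
proof (rule Bochner_Integration.integrable_bound[OF integrable_norm_power2])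
  have "\<bar>x $ i * x $ j\<bar> \<le> norm x * norm x" for x :: "real^'d"
    unfolding abs_mult by (intro mult_mono component_le_norm_cart) auto
  thus "AE x in PX. norm (x $ i * x $ j) \<le> norm ((norm x)\<^sup>2)" by (simp add: power2_eq_square)
qed measurable

lemma integrable_inner_mult: "integrable PX (\<lambda>x. (u \<bullet> x) * (w \<bullet> x))"
proof -
  have "(u \<bullet> x) * (w \<bullet> x) = (\<Sum>i\<in>UNIV. \<Sum>j\<in>UNIV. (u $ i * w $ j) * (x $ i * x $ j))" for x
    by (simp add: inner_vec_def sum_product mult_ac)
  thus ?thesis using integrable_component_mult by (simp only:) (intro Bochner_Integration.integrable_sum
      integrable_mult_right)
qed

lemma integrable_outer: "integrable PX outer"
proof (rule Bochner_Integration.integrable_bound[OF integrable_norm_power2])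
  have "(norm (outer x))\<^sup>2 = ((norm x)\<^sup>2)\<^sup>2" for x :: "real^'d"
    by (simp add: norm_matrix_power2 outer_def power_mult_distrib power2_norm_eq_inner inner_vec_def)
      (simp add: power2_eq_square sum_product)
  hence "norm (outer x) = (norm x)\<^sup>2" for x :: "real^'d"
    by (metis norm_ge_zero power2_eq_imp_eq zero_le_power2)
  thus "AE x in PX. norm (outer x) \<le> norm ((norm x)\<^sup>2)" by simp
  have "continuous_on UNIV (outer :: real^'d \<Rightarrow> _)" unfolding outer_def by (intro continuous_intros)
  hence "outer \<in> borel_measurable (borel :: (real^'d) measure)" by (rule borel_measurable_continuous_onI)
  thus "outer \<in> borel_measurable PX" by simp
qed

text \<open>A continuous linear functional of a matrix commutes with the entrywise integral.\<close>

lemma second_moment_bilinear: "u \<bullet> (second_moment PX *v w) = (LINT x|PX. (u \<bullet> x) * (w \<bullet> x))"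
proof -
  have "linear (\<lambda>A :: real^'d^'d. u \<bullet> (A *v w))"
    by (rule linearI) (simp_all add: matrix_vector_mult_add_rdistrib inner_add_right
        scaleR_matrix_vector_assoc[symmetric])
  hence "bounded_linear (\<lambda>A :: real^'d^'d. u \<bullet> (A *v w))" by (simp add: linear_conv_bounded_linear)
  from integral_bounded_linear[OF this integrable_outer]
  have "u \<bullet> (second_moment PX *v w) = (LINT x|PX. u \<bullet> (outer x *v w))" by (simp add: second_moment_def)
  thus ?thesis by (simp add: outer_mult_vec mult.commute inner_commute)
qed

lemma
  shows transpose_S: "transpose S = S" and S_square: "S ** S = second_moment PX" and invertible_S: "invertible S"
proof -
  have sym: "transpose (second_moment PX) = second_moment PX"
  proof -
    have "u \<bullet> (transpose (second_moment PX) *v w) = u \<bullet> (second_moment PX *v w)" for u w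
    proof -
      have "u \<bullet> (transpose (second_moment PX) *v w) = (w v* second_moment PX) \<bullet> u" by (simp add: inner_commute)
      also have "\<dots> = w \<bullet> (second_moment PX *v u)" by (rule dot_lmul_matrix)
      finally show ?thesis by (simp add: second_moment_bilinear mult.commute)
    qed
    thus ?thesis by (metis matrix_eq vector_eq_ldot)
  qed
  have psd: "0 \<le> x \<bullet> (second_moment PX *v x)" for x
    unfolding second_moment_bilinear by (rule integral_nonneg_AE) simp
  note * = psd_sqrt[OF sym psd invertible_second_moment]
  show "transpose S = S" "S ** S = second_moment PX" "invertible S" by (rule *)+
qed

lemma W_S: "W ** S = mat 1" and S_W: "S ** W = mat 1"
  using matrix_inv_left_right[OF invertible_S] by auto

lemma W_S_vec [simp]: "W *v (S *v x) = x" and S_W_vec [simp]: "S *v (W *v x) = x"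
  by (simp_all add: matrix_vector_mul_assoc W_S S_W)

lemma inner_S: "u \<bullet> (S *v w) = (S *v u) \<bullet> w"
  by (rule inner_matrix_mult_symmetric[OF transpose_S])

lemma transpose_W: "transpose W = W"
  by (rule transpose_matrix_inv[OF transpose_S invertible_S])

lemma inner_W: "u \<bullet> (W *v w) = (W *v u) \<bullet> w"
  by (rule inner_matrix_mult_symmetric[OF transpose_W])

lemma inner_whitened: "(S *v u) \<bullet> (W *v x) = u \<bullet> x"
  by (simp add: inner_W)

lemma norm_S_power2: "(norm (S *v v))\<^sup>2 = (LINT x|PX. (v \<bullet> x)\<^sup>2)"
proof -
  have "(norm (S *v v))\<^sup>2 = v \<bullet> ((S ** S) *v v)"
    by (simp add: power2_norm_eq_inner inner_S[symmetric] matrix_vector_mul_assoc[symmetric])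
  thus ?thesis unfolding S_square second_moment_bilinear by (simp add: power2_eq_square)
qed

lemma whitened_isotropic:
  "integrable PX (\<lambda>x. (W *v x) $ i * (W *v x) $ j)"
  "(LINT x|PX. (W *v x) $ i * (W *v x) $ j) = (if i = j then 1 else 0)"
proof -
  have *: "(W *v x) $ i = (W *v axis i 1) \<bullet> x" for x i
    by (simp add: inner_W[symmetric] inner_axis')
  show "integrable PX (\<lambda>x. (W *v x) $ i * (W *v x) $ j)" unfolding * by (rule integrable_inner_mult)
  have "(LINT x|PX. (W *v x) $ i * (W *v x) $ j) = (W *v axis i 1) \<bullet> (second_moment PX *v (W *v axis j 1))"
    unfolding * second_moment_bilinear ..
  also have "\<dots> = (W *v axis i 1) \<bullet> (S *v axis j 1)"
    using arg_cong[OF S_square, of "\<lambda>A. A *v (W *v axis j 1)"] by (simp add: matrix_vector_mul_assoc[symmetric])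
  also have "\<dots> = axis i 1 \<bullet> axis j (1::real)"
    by (subst inner_S) simp
  also have "\<dots> = (if i = j then 1 else 0)" by (simp add: inner_axis_axis)
  finally show "(LINT x|PX. (W *v x) $ i * (W *v x) $ j) = (if i = j then 1 else 0)" .
qed

lemma measurable_W [measurable]: "(\<lambda>x. W *v x) \<in> borel_measurable borel"
  by (intro borel_measurable_continuous_onI linear_continuous_on) (simp add: matrix_vector_mul_bounded_linear)

lemma measurable_S [measurable]: "(\<lambda>x. S *v x) \<in> borel_measurable borel"
  by (intro borel_measurable_continuous_onI linear_continuous_on) (simp add: matrix_vector_mul_bounded_linear)

lemma whitened_small_ball:
  assumes "small_ball PX C \<alpha>" "\<theta> \<noteq> 0" "t > 0"
  shows "measure PX {x\<in>space PX. \<bar>\<theta> \<bullet> (W *v x)\<bar> \<le> t * norm \<theta>} \<le> (C * t) powr \<alpha>"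
proof -
  have "W *v \<theta> \<noteq> 0" using \<open>\<theta> \<noteq> 0\<close> S_W_vec[of \<theta>] by (metis matrix_vector_mult_0_right)
  with assms have "measure PX {x\<in>space PX. \<bar>(W *v \<theta>) \<bullet> x\<bar> \<le> t * norm (S *v (W *v \<theta>))} \<le> (C * t) powr \<alpha>"
    unfolding small_ball_def by blast
  thus ?thesis by (simp add: inner_W)
qed

lemma whitened_sample_cov_eq: "whitened_sample_cov PX n X = sample_cov n (\<lambda>k. W *v X k)"
  by (simp add: whitened_sample_cov_def Let_def sample_cov_congruence[OF transpose_W])

end

locale well_specified_law = linear_design PX for PX :: "(real^'d) measure" +
  fixes P :: "((real^'d) \<times> real) measure" and \<sigma>2 :: real and \<beta> :: "real^'d"
  assumes well_specified: "well_specified_at PX \<sigma>2 P \<beta>" and \<sigma>2: "\<sigma>2 > 0"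
begin

abbreviation noise :: "(real^'d) \<times> real \<Rightarrow> real" where "noise \<equiv> residual \<beta>"

sublocale P: prob_space P
  using well_specified by (simp add: well_specified_at_def)

lemma sets_P [measurable_cong]: "sets P = sets borel"
  and distr_fst: "distr P borel fst = PX"
  and cond_noise: "AE z in P. real_cond_exp P (sigma_X P) noise z = 0"
  and cond_noise2: "AE z in P. nn_cond_exp P (sigma_X P) (\<lambda>z. ennreal ((noise z)\<^sup>2)) z \<le> ennreal \<sigma>2"
  using well_specified by (auto simp: well_specified_at_def)

lemma space_P [simp]: "space P = UNIV"
  using sets_eq_imp_space_eq[OF sets_P] by simp

lemma measurable_fst_P [measurable]: "fst \<in> P \<rightarrow>\<^sub>M borel"
proof -
  have "fst \<in> (borel :: ((real^'d) \<times> real) measure) \<rightarrow>\<^sub>M borel"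
    using measurable_fst[of "borel :: (real^'d) measure" "borel :: real measure"] by (simp add: borel_prod)
  thus ?thesis by (simp cong: measurable_cong_sets add: sets_P)
qed

lemma measurable_snd_P [measurable]: "snd \<in> P \<rightarrow>\<^sub>M borel"
proof -
  have "snd \<in> (borel :: ((real^'d) \<times> real) measure) \<rightarrow>\<^sub>M borel"
    using measurable_snd[of "borel :: (real^'d) measure" "borel :: real measure"] by (simp add: borel_prod)
  thus ?thesis by (simp cong: measurable_cong_sets add: sets_P)
qed

lemma measurable_residual [measurable]: "residual b \<in> borel_measurable P"
  unfolding residual_def[abs_def] by measurable

lemma measurable_fst_sigma_X: "fst \<in> sigma_X P \<rightarrow>\<^sub>M borel"
  unfolding sigma_X_def by (rule measurable_vimage_algebra1) simp

lemma subalgebra_sigma_X: "subalgebra P (sigma_X P)"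
proof -
  have "fst -` A \<inter> space P \<in> sets P" if "A \<in> sets borel" for A :: "(real^'d) set"
    using measurable_sets[OF measurable_fst_P that] .
  thus ?thesis
    by (auto simp: subalgebra_def sigma_X_def sets_vimage_algebra2)
qed

sublocale cond: sigma_finite_subalgebra P "sigma_X P"
  by (intro finite_measure_subalgebra_is_sigma_finite finite_measure_subalgebra.intro
      finite_measure_subalgebra_axioms.intro subalgebra_sigma_X P.finite_measure_axioms)

lemma nn_integral_fst: "g \<in> borel_measurable borel \<Longrightarrow> (\<integral>\<^sup>+z. g (fst z) \<partial>P) = (\<integral>\<^sup>+x. g x \<partial>PX)"
  unfolding distr_fst[symmetric] by (simp add: nn_integral_distr)

lemma integrable_fst:
  fixes g :: "real^'d \<Rightarrow> real"
  shows "g \<in> borel_measurable borel \<Longrightarrow> integrable P (\<lambda>z. g (fst z)) \<longleftrightarrow> integrable PX g"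
  unfolding distr_fst[symmetric] by (simp add: integrable_distr_eq)

lemma integral_fst:
  fixes g :: "real^'d \<Rightarrow> real"
  shows "g \<in> borel_measurable borel \<Longrightarrow> (LINT z|P. g (fst z)) = (LINT x|PX. g x)"
  unfolding distr_fst[symmetric] by (simp add: integral_distr)

text \<open>For an integrable product this is the defining property of conditional expectation; the Bochner integral of a
  product that is not integrable is \<open>0\<close> by convention.\<close>

lemma integral_noise_mult_fst:
  fixes g :: "real^'d \<Rightarrow> real"
  assumes g[measurable]: "g \<in> borel_measurable borel"
  shows "(LINT z|P. noise z * g (fst z)) = 0"
proof (cases "integrable P (\<lambda>z. g (fst z) * noise z)")
  case True
  have "(\<lambda>z. g (fst z)) \<in> borel_measurable (sigma_X P)"
    by (rule measurable_compose[OF measurable_fst_sigma_X g])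
  from cond.real_cond_exp_intg(2)[OF True this]
  have "(LINT z|P. g (fst z) * noise z) = (LINT z|P. g (fst z) * real_cond_exp P (sigma_X P) noise z)" by simp
  also have "\<dots> = (LINT z|P. 0)" using cond_noise by (intro integral_cong_AE) auto
  finally show ?thesis by (simp add: mult.commute)
qed (simp add: not_integrable_integral_eq mult.commute)

lemma nn_integral_noise2_mult_fst:
  assumes g[measurable]: "g \<in> borel_measurable borel"
  shows "(\<integral>\<^sup>+z. ennreal ((noise z)\<^sup>2) * g (fst z) \<partial>P) \<le> ennreal \<sigma>2 * (\<integral>\<^sup>+z. g (fst z) \<partial>P)"
proof -
  have "(\<lambda>z. g (fst z)) \<in> borel_measurable (sigma_X P)"
    by (rule measurable_compose[OF measurable_fst_sigma_X g])
  from cond.nn_cond_exp_intg[OF this, of "\<lambda>z. ennreal ((noise z)\<^sup>2)"]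
  have "(\<integral>\<^sup>+z. ennreal ((noise z)\<^sup>2) * g (fst z) \<partial>P)
     = (\<integral>\<^sup>+z. g (fst z) * nn_cond_exp P (sigma_X P) (\<lambda>z. ennreal ((noise z)\<^sup>2)) z \<partial>P)"
    by (simp add: mult.commute)
  also have "\<dots> \<le> (\<integral>\<^sup>+z. g (fst z) * ennreal \<sigma>2 \<partial>P)"
    using cond_noise2 by (intro nn_integral_mono_AE) (auto elim!: eventually_mono intro: mult_left_mono)
  also have "\<dots> = ennreal \<sigma>2 * (\<integral>\<^sup>+z. g (fst z) \<partial>P)"
    by (subst nn_integral_multc) (auto simp: mult.commute)
  finally show ?thesis .
qed

lemma integrable_noise2: "integrable P (\<lambda>z. (noise z)\<^sup>2)"
proof (rule integrableI_bounded)
  have "(\<integral>\<^sup>+z. ennreal ((noise z)\<^sup>2) * 1 \<partial>P) \<le> ennreal \<sigma>2 * (\<integral>\<^sup>+z. 1 \<partial>P)"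
    using nn_integral_noise2_mult_fst[of "\<lambda>_. 1"] by simp
  also have "\<dots> < \<infinity>" using P.emeasure_space_1 by (simp add: ennreal_mult_less_top)
  finally show "(\<integral>\<^sup>+z. ennreal (norm ((noise z)\<^sup>2)) \<partial>P) < \<infinity>" by simp
qed simp

lemma integrable_inner_fst2: "integrable P (\<lambda>z. (v \<bullet> fst z)\<^sup>2)"
  using integrable_inner_mult[of v v] by (subst integrable_fst) (auto simp: power2_eq_square)

text \<open>The noise is orthogonal to every linear function of the covariate, so the cross term vanishes.\<close>

lemma risk_eq: "risk P b = (LINT z|P. (noise z)\<^sup>2) + (norm (S *v (b - \<beta>)))\<^sup>2"
proof -
  let ?v = "b - \<beta>"
  have eq: "(residual b z)\<^sup>2 = (noise z)\<^sup>2 - 2 * (noise z * (?v \<bullet> fst z)) + (?v \<bullet> fst z)\<^sup>2" for z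
    by (simp add: residual_def inner_diff_left power2_eq_square algebra_simps)
  have int: "integrable P (\<lambda>z. noise z * (?v \<bullet> fst z))"
  proof (rule Bochner_Integration.integrable_bound[OF Bochner_Integration.integrable_add[OF integrable_noise2
      integrable_inner_fst2[of ?v]]])
    have "\<bar>a * c\<bar> \<le> a\<^sup>2 + c\<^sup>2" for a c :: real
    proof -
      have "2 * (\<bar>a\<bar> * \<bar>c\<bar>) \<le> \<bar>a\<bar>\<^sup>2 + \<bar>c\<bar>\<^sup>2" using sum_squares_bound[of "\<bar>a\<bar>" "\<bar>c\<bar>"] by simp
      moreover have "0 \<le> \<bar>a\<bar> * \<bar>c\<bar>" by simp
      ultimately show ?thesis unfolding abs_mult power2_abs by linarith
    qed
    thus "AE z in P. norm (noise z * (?v \<bullet> fst z)) \<le> norm ((noise z)\<^sup>2 + (?v \<bullet> fst z)\<^sup>2)" by (simp add: abs_of_nonneg)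
  qed measurable
  have "risk P b = (LINT z|P. (noise z)\<^sup>2) - 2 * (LINT z|P. noise z * (?v \<bullet> fst z)) + (LINT z|P. (?v \<bullet> fst z)\<^sup>2)"
    unfolding risk_def eq using int integrable_noise2 integrable_inner_fst2 by simp
  also have "(LINT z|P. noise z * (?v \<bullet> fst z)) = 0" by (rule integral_noise_mult_fst) simp
  also have "(LINT z|P. (?v \<bullet> fst z)\<^sup>2) = (norm (S *v ?v))\<^sup>2"
    unfolding norm_S_power2 by (rule integral_fst) simp
  finally show ?thesis by simp
qed

text \<open>If two parameters were both well specified, the risk decomposition around each of them would make the risk of either
  exceed that of the other, unless they coincide.\<close>

lemma true_param_eq: "true_param PX \<sigma>2 P = \<beta>"
  unfolding true_param_def
proof (rule the_equality)
  show "well_specified_at PX \<sigma>2 P \<beta>" by (rule well_specified)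
next
  fix b assume b: "well_specified_at PX \<sigma>2 P b"
  interpret B: well_specified_law PX P \<sigma>2 b
    by unfold_locales (use b \<sigma>2 in auto)
  have "risk P b = (LINT z|P. (noise z)\<^sup>2) + (norm (S *v (b - \<beta>)))\<^sup>2" by (rule risk_eq)
  moreover have "risk P \<beta> = (LINT z|P. (residual b z)\<^sup>2) + (norm (S *v (\<beta> - b)))\<^sup>2" by (rule B.risk_eq)
  ultimately have "(norm (S *v (b - \<beta>)))\<^sup>2 + (norm (S *v (\<beta> - b)))\<^sup>2 = 0"
    by (simp add: risk_def)
  hence "S *v (b - \<beta>) = 0" by (simp add: add_nonneg_eq_0_iff)
  hence "b - \<beta> = 0" using W_S_vec[of "b - \<beta>"] by simp
  thus "b = \<beta>" by simp
qed

lemma excess_risk_eq: "excess_risk PX \<sigma>2 P b = (norm (S *v b - S *v \<beta>))\<^sup>2"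
  unfolding excess_risk_def true_param_eq risk_eq by (simp add: matrix_vector_mult_diff_distrib)

end

section \<open>The risk of ordinary least squares\<close>

lemma borel_measurable_vec_lambda [measurable (raw)]:
  fixes f :: "'a \<Rightarrow> 'd::finite \<Rightarrow> real"
  assumes "\<And>i. (\<lambda>x. f x i) \<in> borel_measurable M"
  shows "(\<lambda>x. \<chi> i. f x i) \<in> borel_measurable M"
proof -
  have "(\<lambda>x. \<chi> i. f x i) = (\<lambda>x. \<Sum>i\<in>UNIV. f x i *\<^sub>R axis i (1::real))"
    by (simp add: fun_eq_iff vec_eq_iff axis_def if_distrib[of "\<lambda>a. _ * a"] cong: if_cong)
  thus ?thesis using assms by simp
qed

lemma borel_measurable_det:
  fixes A :: "'a \<Rightarrow> real^'d^'d"
  assumes [measurable]: "\<And>i j. (\<lambda>x. A x $ i $ j) \<in> borel_measurable M"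
  shows "(\<lambda>x. det (A x)) \<in> borel_measurable M"
  unfolding det_def by measurable

text \<open>Cramer's rule.  It agrees with \<open>A\<^sup>-\<^sup>1 u\<close> when \<open>A\<close> is invertible, but it is visibly measurable in \<open>A\<close>
  and \<open>u\<close>, and it is \<open>0\<close> when \<open>A\<close> is singular.\<close>

definition cramer_solve :: "real^'d^'d \<Rightarrow> real^'d \<Rightarrow> real^'d" where
  "cramer_solve A u = (\<chi> k. det (\<chi> i j. if j = k then u $ i else A $ i $ j) / det A)"

lemma cramer_solve_invertible:
  assumes "invertible A"
  shows "cramer_solve A u = matrix_inv A *v u"
proof -
  have "det A \<noteq> 0" using assms by (simp add: invertible_det_nz)
  moreover have "A *v (matrix_inv A *v u) = u"
    by (simp add: matrix_vector_mul_assoc matrix_inv_left_right[OF assms])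
  ultimately show ?thesis unfolding cramer_solve_def by (simp add: cramer)
qed

lemma borel_measurable_cramer_solve:
  fixes A :: "'a \<Rightarrow> real^'d^'d"
  assumes A[measurable]: "\<And>i j. (\<lambda>x. A x $ i $ j) \<in> borel_measurable M" and u[measurable]: "\<And>i. (\<lambda>x. u x $ i)
      \<in> borel_measurable M"
  shows "(\<lambda>x. cramer_solve (A x) (u x)) \<in> borel_measurable M"
proof -
  have "(\<lambda>x. det (\<chi> i j. if j = k then u x $ i else A x $ i $ j)) \<in> borel_measurable M" for k
    by (intro borel_measurable_det) simp
  moreover have "(\<lambda>x. det (A x)) \<in> borel_measurable M" by (intro borel_measurable_det A)
  ultimately show ?thesis unfolding cramer_solve_def by (intro borel_measurable_vec_lambda borel_measurable_divide)
qed

lemma trace_inv_cramer: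
  "trace_inv A = (if det A = 0 then \<infinity> else ennreal (\<Sum>i\<in>UNIV. cramer_solve A (axis i 1) $ i))"
  by (auto simp: trace_inv_def invertible_det_nz cramer_solve_invertible trace_eq_sum_axis inner_axis')

lemma borel_measurable_trace_inv:
  fixes A :: "'a \<Rightarrow> real^'d^'d"
  assumes A[measurable]: "\<And>i j. (\<lambda>x. A x $ i $ j) \<in> borel_measurable M"
  shows "(\<lambda>x. trace_inv (A x)) \<in> borel_measurable M"
proof -
  have [measurable]: "(\<lambda>x. det (A x)) \<in> borel_measurable M" by (intro borel_measurable_det A)
  have [measurable]: "(\<lambda>x. cramer_solve (A x) (axis i 1)) \<in> borel_measurable M" for i
    by (intro borel_measurable_cramer_solve A) simp
  show ?thesis unfolding trace_inv_cramer by measurable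
qed

lemma sample_cov_component: "sample_cov n X $ i $ j = (\<Sum>k<n. X k $ i * X k $ j) / real n"
  by (simp add: sample_cov_def outer_def)

lemma sample_cov_cong: "(\<And>k. k < n \<Longrightarrow> X k = Y k) \<Longrightarrow> sample_cov n X = sample_cov n Y"
  by (simp add: sample_cov_def)

text \<open>For \<open>B = A\<^sup>-\<^sup>1\<close> the vectors \<open>B x\<^sub>k\<close> have sample covariance \<open>B A B = B\<close>; compare traces.\<close>

lemma sum_norm_inverse_sample_cov:
  fixes X :: "nat \<Rightarrow> real^'d"
  assumes n: "n \<ge> 1"
  defines "A \<equiv> sample_cov n X"
  shows "ennreal (\<Sum>k<n. (norm ((1 / real n) *\<^sub>R cramer_solve A (X k)))\<^sup>2) \<le> ennreal (1 / real n) * trace_inv A"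
proof (cases "invertible A")
  case True
  define B where "B = matrix_inv A"
  note AB = matrix_inv_left_right[OF True, folded B_def]
  have tA: "transpose A = A" by (simp add: A_def transpose_sample_cov)
  have tB: "transpose B = B"
    unfolding B_def by (rule transpose_matrix_inv[OF tA True])
  have "(\<Sum>k<n. (norm (B *v X k))\<^sup>2) / real n = trace (sample_cov n (\<lambda>k. B *v X k))" by (simp add: trace_sample_cov)
  also have "\<dots> = trace B" unfolding sample_cov_congruence[OF tB, symmetric] A_def[symmetric] by (simp add: AB)
  finally have tr: "(\<Sum>k<n. (norm (B *v X k))\<^sup>2) = real n * trace B" using n by (simp add: field_simps)
  hence "0 \<le> real n * trace B" by (metis sum_nonneg zero_le_power2)
  hence "0 \<le> trace B" using n by (simp add: zero_le_mult_iff)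
  have "(\<Sum>k<n. (norm ((1 / real n) *\<^sub>R cramer_solve A (X k)))\<^sup>2) = (\<Sum>k<n. (norm (B *v X k))\<^sup>2) / (real n)\<^sup>2"
    by (simp add: cramer_solve_invertible[OF True] B_def power_divide sum_divide_distrib)
  also have "\<dots> = 1 / real n * trace B" unfolding tr using n by (simp add: power2_eq_square)
  finally have eq: "(\<Sum>k<n. (norm ((1 / real n) *\<^sub>R cramer_solve A (X k)))\<^sup>2) = 1 / real n * trace B" .
  have "ennreal (1 / real n * trace B) = ennreal (1 / real n) * ennreal (trace B)"
    by (rule ennreal_mult) (use \<open>0 \<le> trace B\<close> in auto)
  thus ?thesis unfolding eq using True by (simp only: trace_inv_def B_def if_True order_refl)
next
  case False
  thus ?thesis using n by (simp add: trace_inv_def ennreal_mult_top)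
qed

lemma compose_fun_upd:
  assumes "k \<notin> I"
  shows "compose (insert k I) f (x(k := y)) = (compose I f x)(k := f y)"
  using assms by (auto simp: compose_def fun_eq_iff)

context well_specified_law
begin

abbreviation sample :: "nat \<Rightarrow> (nat \<Rightarrow> (real^'d) \<times> real) measure" where
  "sample n \<equiv> (\<Pi>\<^sub>M k\<in>{..<n}. P)"

lemma measurable_compose_fst [measurable]: "compose I fst \<in> (\<Pi>\<^sub>M k\<in>I. P) \<rightarrow>\<^sub>M (\<Pi>\<^sub>M k\<in>I. PX)"
proof -
  have "fst \<in> P \<rightarrow>\<^sub>M PX" using measurable_fst_P by (simp cong: measurable_cong_sets add: sets_PX)
  note [measurable] = this
  show ?thesis unfolding compose_def by measurable
qed

lemma nn_integral_covariates:
  assumes [measurable]: "F \<in> borel_measurable (\<Pi>\<^sub>M k\<in>{..<n}. PX)"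
  shows "(\<integral>\<^sup>+z. F (compose {..<n} fst z) \<partial>sample n) = (\<integral>\<^sup>+X. F X \<partial>(\<Pi>\<^sub>M k\<in>{..<n}. PX))"
proof -
  have m: "fst \<in> P \<rightarrow>\<^sub>M PX" using measurable_fst_P by (simp cong: measurable_cong_sets add: sets_PX)
  have "distr P PX fst = PX"
    using distr_fst distr_cong[OF refl sets_PX refl, of P fst] by simp
  hence "(\<Pi>\<^sub>M k\<in>{..<n}. PX) = distr (sample n) (\<Pi>\<^sub>M k\<in>{..<n}. PX) (compose {..<n} fst)"
    using distr_PiM_finite_prob_space'[of "{..<n}" "\<lambda>_. P" "\<lambda>_. PX" fst] m P.prob_space_axioms
        prob_space_axioms by simp
  hence "(\<integral>\<^sup>+X. F X \<partial>(\<Pi>\<^sub>M k\<in>{..<n}. PX)) = (\<integral>\<^sup>+X. F X \<partial>distr (sample n) (\<Pi>\<^sub>M k\<in>{..<n}. PX) (compose {..<n}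
      fst))" by simp
  also have "\<dots> = (\<integral>\<^sup>+z. F (compose {..<n} fst z) \<partial>sample n)" by (rule nn_integral_distr) measurable
  finally show ?thesis by simp
qed

lemma measurable_fun_upd_covariate:
  assumes g[measurable]: "g \<in> (\<Pi>\<^sub>M k\<in>insert k I. PX) \<rightarrow>\<^sub>M N" and x: "x \<in> space (\<Pi>\<^sub>M k\<in>I. P)" and k: "k \<notin> I"
  shows "(\<lambda>a. g ((compose I fst x)(k := a))) \<in> borel \<rightarrow>\<^sub>M N"
proof -
  have "compose I fst x \<in> space (\<Pi>\<^sub>M k\<in>I. PX)" using measurable_space[OF measurable_compose_fst x] .
  from measurable_component_update[OF this k] have "(\<lambda>a. (compose I fst x)(k := a)) \<in> PX \<rightarrow>\<^sub>M (\<Pi>\<^sub>M k\<in>insert k I. PX)" .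
  from measurable_compose[OF this g] show ?thesis by (simp cong: measurable_cong_sets add: sets_PX)
qed

text \<open>Fix all observations but the \<open>k\<close>-th and use the conditional second moment of that one.\<close>

lemma nn_integral_noise2_mult_covariates:
  assumes k: "k < n" and g[measurable]: "g \<in> borel_measurable (\<Pi>\<^sub>M k\<in>{..<n}. PX)"
  shows "(\<integral>\<^sup>+z. ennreal ((noise (z k))\<^sup>2) * g (compose {..<n} fst z) \<partial>sample n)
       \<le> ennreal \<sigma>2 * (\<integral>\<^sup>+z. g (compose {..<n} fst z) \<partial>sample n)"
proof -
  interpret product_sigma_finite "\<lambda>_::nat. P" by standard
  define I where "I = {..<n} - {k}"
  have I: "finite I" "k \<notin> I" and nI: "{..<n} = insert k I" using k by (auto simp: I_def)
  note g' = g[unfolded nI]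
  let ?kI = "(\<Pi>\<^sub>M k\<in>insert k I. P)"
  let ?I = "(\<Pi>\<^sub>M k\<in>I. P)"
  note [measurable] = g'
  have [measurable]: "(\<lambda>z. noise (z k)) \<in> borel_measurable ?kI" by measurable
  have "(\<integral>\<^sup>+z. ennreal ((noise (z k))\<^sup>2) * g (compose (insert k I) fst z) \<partial>?kI)
    = (\<integral>\<^sup>+x. (\<integral>\<^sup>+y. ennreal ((noise y)\<^sup>2) * g ((compose I fst x)(k := fst y)) \<partial>P) \<partial>?I)"
    by (subst product_nn_integral_insert[OF I]) (simp_all add: compose_fun_upd[OF I(2)])
  also have "\<dots> \<le> (\<integral>\<^sup>+x. ennreal \<sigma>2 * (\<integral>\<^sup>+y. g ((compose I fst x)(k := fst y)) \<partial>P) \<partial>?I)"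
    by (intro nn_integral_mono nn_integral_noise2_mult_fst measurable_fun_upd_covariate[OF g' _ I(2)])
  also have "\<dots> = (\<integral>\<^sup>+x. (\<integral>\<^sup>+y. ennreal \<sigma>2 * g (compose (insert k I) fst (x(k := y))) \<partial>P) \<partial>?I)"
  proof (intro nn_integral_cong)
    fix x assume x: "x \<in> space ?I"
    have "(\<lambda>y. g ((compose I fst x)(k := fst y))) \<in> borel_measurable P"
      by (rule measurable_compose[OF measurable_fst_P measurable_fun_upd_covariate[OF g' x I(2)]])
    thus "ennreal \<sigma>2 * (\<integral>\<^sup>+y. g ((compose I fst x)(k := fst y)) \<partial>P) = (\<integral>\<^sup>+y. ennreal \<sigma>2
        * g (compose (insert k I) fst (x(k := y))) \<partial>P)"
      by (simp add: nn_integral_cmult compose_fun_upd[OF I(2)])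
  qed
  also have "\<dots> = (\<integral>\<^sup>+z. ennreal \<sigma>2 * g (compose (insert k I) fst z) \<partial>?kI)"
    by (subst product_nn_integral_insert[OF I]) simp_all
  also have "\<dots> = ennreal \<sigma>2 * (\<integral>\<^sup>+z. g (compose (insert k I) fst z) \<partial>?kI)"
    by (rule nn_integral_cmult) simp
  finally show ?thesis by (simp add: nI)
qed

text \<open>Fix all observations but the \<open>k\<close>-th; then \<open>noise (z l)\<close> is a constant and the conditional mean of
  \<open>noise (z k)\<close> vanishes.\<close>

lemma integral_cross_noise:
  assumes k: "k < n" "k \<noteq> l" and g[measurable]: "g \<in> borel_measurable (\<Pi>\<^sub>M k\<in>{..<n}. PX)"
    and int: "integrable (sample n) (\<lambda>z. noise (z k) * (noise (z l) * g (compose {..<n} fst z)))"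
  shows "(LINT z|sample n. noise (z k) * (noise (z l) * g (compose {..<n} fst z))) = 0"
proof -
  interpret product_sigma_finite "\<lambda>_::nat. P" by standard
  define I where "I = {..<n} - {k}"
  have I: "finite I" "k \<notin> I" and nI: "{..<n} = insert k I" using k by (auto simp: I_def)
  note g' = g[unfolded nI]
  let ?I = "(\<Pi>\<^sub>M k\<in>I. P)"
  have "(LINT z|(\<Pi>\<^sub>M k\<in>insert k I. P). noise (z k) * (noise (z l) * g (compose (insert k I) fst z)))
    = (LINT x|?I. (LINT y|P. noise y * (noise (x l) * g ((compose I fst x)(k := fst y)))))"
    using k by (subst product_integral_insert[OF I int[unfolded nI]]) (simp add: compose_fun_upd[OF I(2)])
  also have "\<dots> = (LINT x|?I. 0)"
  proof (intro Bochner_Integration.integral_cong refl)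
    fix x assume x: "x \<in> space ?I"
    have [measurable]: "(\<lambda>a. g ((compose I fst x)(k := a))) \<in> borel_measurable borel"
      by (rule measurable_fun_upd_covariate[OF g' x I(2)])
    show "(LINT y|P. noise y * (noise (x l) * g ((compose I fst x)(k := fst y)))) = 0"
      by (rule integral_noise_mult_fst[of "\<lambda>a. noise (x l) * g ((compose I fst x)(k := a))"]) measurable
  qed
  finally show ?thesis by (simp add: nI)
qed

text \<open>The weights depend on the whole design but not on the responses.  Finiteness of the right side makes
  the diagonal terms integrable, and these dominate the cross terms, whose integrals are zero.\<close>

lemma nn_integral_noise_combination:
  fixes w :: "nat \<Rightarrow> (nat \<Rightarrow> real^'d) \<Rightarrow> real^'d"
  assumes w[measurable]: "\<And>k. k < n \<Longrightarrow> w k \<in> borel_measurable (\<Pi>\<^sub>M k\<in>{..<n}. PX)"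
    and fin: "(\<integral>\<^sup>+X. ennreal (\<Sum>k<n. (norm (w k X))\<^sup>2) \<partial>(\<Pi>\<^sub>M k\<in>{..<n}. PX)) < \<infinity>"
  shows "(\<integral>\<^sup>+z. ennreal ((norm (\<Sum>k<n. noise (z k) *\<^sub>R w k (compose {..<n} fst z)))\<^sup>2) \<partial>sample n)
     \<le> ennreal \<sigma>2 * (\<integral>\<^sup>+X. ennreal (\<Sum>k<n. (norm (w k X))\<^sup>2) \<partial>(\<Pi>\<^sub>M k\<in>{..<n}. PX))"
proof -
  let ?PX = "(\<Pi>\<^sub>M k\<in>{..<n}. PX)"
  let ?W = "\<lambda>k. (\<integral>\<^sup>+X. ennreal ((norm (w k X))\<^sup>2) \<partial>?PX)"
  define v where "v = (\<lambda>k (z :: nat \<Rightarrow> (real^'d) \<times> real). w k (compose {..<n} fst z))"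
  let ?c = "\<lambda>k l z. noise (z k) * (noise (z l) * (v k z \<bullet> v l z))"
  let ?n = "\<lambda>z. (norm (\<Sum>k<n. noise (z k) *\<^sub>R v k z))\<^sup>2"
  let ?v = "\<lambda>k z. (noise (z k))\<^sup>2 * (norm (v k z))\<^sup>2"
  have [measurable]: "v k \<in> borel_measurable (sample n)" if "k < n" for k
    using that unfolding v_def by measurable
  have noise_m[measurable]: "(\<lambda>z. noise (z k)) \<in> borel_measurable (sample n)" if "k < n" for k
    by (rule measurable_compose[OF _ measurable_residual]) (use that in simp)
  have w2: "(\<lambda>X. ennreal ((norm (w k X))\<^sup>2)) \<in> borel_measurable ?PX" if "k < n" for k
    using w[OF that] by measurable
  have diag_le: "(\<integral>\<^sup>+z. ennreal (?v k z) \<partial>sample n) \<le> ennreal \<sigma>2 * ?W k"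
    if k: "k < n" for k
  proof -
    note m = w2[OF k]
    show ?thesis
      using nn_integral_noise2_mult_covariates[OF k m] nn_integral_covariates[OF m]
      by (simp add: v_def ennreal_mult)
  qed
  have diag_int: "integrable (sample n) (\<lambda>z. ?v k z)" if k: "k < n" for k
  proof (rule integrableI_bounded)
    show "(\<lambda>z. ?v k z) \<in> borel_measurable (sample n)" using k by measurable
    have "?W k \<le> (\<integral>\<^sup>+X. ennreal (\<Sum>k<n. (norm (w k X))\<^sup>2) \<partial>?PX)"
      using k by (intro nn_integral_mono ennreal_leI member_le_sum) auto
    hence "?W k < \<infinity>" using fin by (rule le_less_trans)
    with diag_le[OF k] show "(\<integral>\<^sup>+z. ennreal (norm (?v k z)) \<partial>sample n) < \<infinity>"
      by (auto simp: ennreal_mult_less_top intro: le_less_trans)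
  qed
  have cross_int: "integrable (sample n) (\<lambda>z. ?c k l z)" if k: "k < n" and l: "l < n" for k l
  proof (rule Bochner_Integration.integrable_bound[OF Bochner_Integration.integrable_add[OF diag_int[OF k]
      diag_int[OF l]]])
    show "(\<lambda>z. ?c k l z) \<in> borel_measurable (sample n)" using k l by measurable
    show "AE z in sample n. norm (?c k l z)
        \<le> norm (?v k z + ?v l z)"
    proof (rule AE_I2)
      fix z
      define a b where "a = \<bar>noise (z k)\<bar> * norm (v k z)" and "b = \<bar>noise (z l)\<bar> * norm (v l z)"
      have "norm (?c k l z) = \<bar>noise (z k)\<bar> * \<bar>noise (z l)\<bar> * \<bar>v k z \<bullet> v l z\<bar>"
        by (simp add: abs_mult)
      also have "\<dots> \<le> \<bar>noise (z k)\<bar> * \<bar>noise (z l)\<bar> * (norm (v k z) * norm (v l z))"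
        by (intro mult_left_mono Cauchy_Schwarz_ineq2) auto
      also have "\<dots> = a * b" by (simp add: a_def b_def)
      also have "\<dots> \<le> a\<^sup>2 + b\<^sup>2"
      proof -
        have "0 \<le> a * b" by (simp add: a_def b_def)
        thus ?thesis using sum_squares_bound[of a b] by linarith
      qed
      finally show "norm (?c k l z)
        \<le> norm (?v k z + ?v l z)"
        by (simp add: a_def b_def power_mult_distrib)
    qed
  qed
  have cross_zero: "(LINT z|sample n. ?c k l z) = 0" if k: "k < n" and l: "l < n" and kl: "k \<noteq> l" for k l
  proof -
    have "(\<lambda>X. w k X \<bullet> w l X) \<in> borel_measurable ?PX" using w[OF k] w[OF l] by measurable
    from integral_cross_noise[OF k kl this] cross_int[OF k l] show ?thesis by (simp add: v_def)
  qed
  have expand: "?n z = (\<Sum>k<n. \<Sum>l<n. ?c k l z)" for z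
    by (simp add: power2_norm_eq_inner inner_sum_left inner_sum_right sum_distrib_left mult.left_commute
        inner_commute)
  have int: "integrable (sample n) (\<lambda>z. ?n z)"
    unfolding expand by (intro Bochner_Integration.integrable_sum cross_int) auto
  have "(LINT z|sample n. ?n z) = (\<Sum>k<n. (LINT z|sample n. (\<Sum>l<n. ?c k l z)))"
    unfolding expand by (intro Bochner_Integration.integral_sum Bochner_Integration.integrable_sum cross_int) auto
  also have "\<dots> = (\<Sum>k<n. \<Sum>l<n. (LINT z|sample n. ?c k l z))"
    by (intro sum.cong refl Bochner_Integration.integral_sum cross_int) auto
  also have "\<dots> = (\<Sum>k<n. \<Sum>l<n. if k = l then (LINT z|sample n. ?c k k z) else 0)"
    by (intro sum.cong refl) (auto simp: cross_zero)
  also have "\<dots> = (\<Sum>k<n. (LINT z|sample n. ?v k z))"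
    by (simp add: power2_eq_square power2_norm_eq_inner[unfolded power2_eq_square] mult_ac)
  finally have val: "(LINT z|sample n. ?n z) = (\<Sum>k<n. (LINT z|sample n. ?v k z))" .
  have "(\<integral>\<^sup>+z. ennreal (?n z) \<partial>sample n) = ennreal (LINT z|sample n. ?n z)"
    by (rule nn_integral_eq_integral[OF int]) simp
  also have "\<dots> = (\<Sum>k<n. ennreal (LINT z|sample n. ?v k z))"
    unfolding val by (rule sum_ennreal[symmetric]) (rule integral_nonneg_AE, simp)
  also have "\<dots> = (\<Sum>k<n. (\<integral>\<^sup>+z. ennreal (?v k z) \<partial>sample n))"
    by (intro sum.cong refl nn_integral_eq_integral[symmetric] diag_int) auto
  also have "\<dots> \<le> (\<Sum>k<n. ennreal \<sigma>2 * ?W k)"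
    by (intro sum_mono diag_le) auto
  also have "\<dots> = ennreal \<sigma>2 * (\<integral>\<^sup>+X. (\<Sum>k<n. ennreal ((norm (w k X))\<^sup>2)) \<partial>?PX)"
    by (subst nn_integral_sum) (auto simp: sum_distrib_left intro!: w2)
  finally show ?thesis by (simp add: v_def sum_ennreal sum_nonneg)
qed

end

context linear_design
begin

text \<open>Least squares in whitened coordinates, where the excess risk is a Euclidean distance.\<close>

definition ols :: "nat \<Rightarrow> (nat \<Rightarrow> (real^'d) \<times> real) \<Rightarrow> real^'d" where
  "ols n z = W *v cramer_solve (sample_cov n (\<lambda>k. W *v fst (z k)))
                 ((1 / real n) *\<^sub>R (\<Sum>k<n. snd (z k) *\<^sub>R (W *v fst (z k))))"

lemma ols_in_estimators: "ols n \<in> estimators n"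
proof -
  let ?B = "\<Pi>\<^sub>M k\<in>{..<n}. (borel :: ((real^'d) \<times> real) measure)"
  have fst: "fst \<in> (borel :: ((real^'d) \<times> real) measure) \<rightarrow>\<^sub>M borel"
    using measurable_fst[of "borel :: (real^'d) measure" "borel :: real measure"] by (simp add: borel_prod)
  have snd: "snd \<in> (borel :: ((real^'d) \<times> real) measure) \<rightarrow>\<^sub>M borel"
    using measurable_snd[of "borel :: (real^'d) measure" "borel :: real measure"] by (simp add: borel_prod)
  have x[measurable]: "(\<lambda>z. W *v fst (z k)) \<in> borel_measurable ?B" if "k < n" for k
    using that by (intro measurable_compose[OF _ measurable_W] measurable_compose[OF _ fst]) measurable
  have y[measurable]: "(\<lambda>z. snd (z k)) \<in> borel_measurable ?B" if "k < n" for k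
    using that by (intro measurable_compose[OF _ snd]) measurable
  have "(\<lambda>z. cramer_solve (sample_cov n (\<lambda>k. W *v fst (z k)))
                 ((1 / real n) *\<^sub>R (\<Sum>k<n. snd (z k) *\<^sub>R (W *v fst (z k))))) \<in> borel_measurable ?B"
    by (intro borel_measurable_cramer_solve) (simp_all add: sample_cov_component)
  thus ?thesis unfolding estimators_def ols_def[abs_def] by (intro measurable_compose[OF _ measurable_W]) auto
qed

end

text \<open>A finite expected trace entails that the sample covariance is almost surely invertible, and then the
  error of the estimator is a linear combination of the noise.\<close>

lemma (in well_specified_law) expected_excess_risk_ols:
  assumes n: "n \<ge> 1" and fin: "expected_trace_inv PX n < \<infinity>"
  shows "(\<integral>\<^sup>+z. ennreal (excess_risk PX \<sigma>2 P (ols n z)) \<partial>sample n) \<le> ennreal (\<sigma>2 / real n) * expected_trace_inv PX n"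
proof -
  let ?PX = "\<Pi>\<^sub>M k\<in>{..<n}. PX"
  let ?X = "compose {..<n} fst"
  let ?E = "expected_trace_inv PX n"
  define A where "A = (\<lambda>X. sample_cov n (\<lambda>k. W *v X k))"
  have A_compose: "A (?X z) = sample_cov n (\<lambda>k. W *v fst (z k))" for z
    unfolding A_def by (intro sample_cov_cong) (simp add: compose_def)
  have x[measurable]: "(\<lambda>X. W *v X k) \<in> borel_measurable ?PX" if "k < n" for k
    using that by (intro measurable_compose[OF _ measurable_W]) measurable
  have A_m: "(\<lambda>X. A X $ i $ j) \<in> borel_measurable ?PX" for i j
    unfolding A_def sample_cov_component by measurable
  define w where "w = (\<lambda>k X. (1 / real n) *\<^sub>R cramer_solve (A X) (W *v X k))"
  have w: "w k \<in> borel_measurable ?PX" if "k < n" for k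
    unfolding w_def using that by (intro borel_measurable_scaleR borel_measurable_cramer_solve A_m
        borel_measurable_component x) auto
  have tr_m[measurable]: "(\<lambda>X. trace_inv (A X)) \<in> borel_measurable ?PX" by (intro borel_measurable_trace_inv A_m)
  have E: "?E = (\<integral>\<^sup>+X. trace_inv (A X) \<partial>?PX)"
    by (simp add: expected_trace_inv_def whitened_sample_cov_eq A_def)
  have w_le: "(\<integral>\<^sup>+X. ennreal (\<Sum>k<n. (norm (w k X))\<^sup>2) \<partial>?PX) \<le> ennreal (1 / real n) * ?E"
  proof -
    have "(\<integral>\<^sup>+X. ennreal (\<Sum>k<n. (norm (w k X))\<^sup>2) \<partial>?PX) \<le> (\<integral>\<^sup>+X. ennreal (1 / real n) * trace_inv (A X) \<partial>?PX)"
      unfolding w_def A_def by (intro nn_integral_mono sum_norm_inverse_sample_cov n)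
    thus ?thesis unfolding E by (simp add: nn_integral_cmult)
  qed
  also have "\<dots> < \<infinity>" using fin by (simp add: ennreal_mult_less_top)
  finally have w_fin: "(\<integral>\<^sup>+X. ennreal (\<Sum>k<n. (norm (w k X))\<^sup>2) \<partial>?PX) < \<infinity>" .
  have "AE z in sample n. trace_inv (A (?X z)) \<noteq> \<infinity>"
  proof (rule nn_integral_PInf_AE)
    show "(\<lambda>z. trace_inv (A (?X z))) \<in> borel_measurable (sample n)" by measurable
    show "(\<integral>\<^sup>+z. trace_inv (A (?X z)) \<partial>sample n) \<noteq> \<infinity>"
      using fin nn_integral_covariates[OF tr_m] by (simp add: E)
  qed
  hence inv: "AE z in sample n. invertible (sample_cov n (\<lambda>k. W *v fst (z k)))"
    by eventually_elim (auto simp: trace_inv_def A_compose split: if_splits)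
  have "AE z in sample n. excess_risk PX \<sigma>2 P (ols n z) = (norm (\<Sum>k<n. noise (z k) *\<^sub>R w k (?X z)))\<^sup>2"
    using inv
  proof eventually_elim
    case (elim z)
    let ?A = "sample_cov n (\<lambda>k. W *v fst (z k))" and ?x = "\<lambda>k. W *v fst (z k)"
    have y: "snd (z k) = (?x k \<bullet> (S *v \<beta>)) + noise (z k)" for k
      using inner_whitened[of \<beta> "fst (z k)"] by (simp add: residual_def inner_commute)
    have "(1 / real n) *\<^sub>R (\<Sum>k<n. snd (z k) *\<^sub>R ?x k) = ?A *v (S *v \<beta>)
        + (1 / real n) *\<^sub>R (\<Sum>k<n. noise (z k) *\<^sub>R ?x k)"
      unfolding sample_cov_mult_vec y by (simp add: scaleR_add_left sum.distrib scaleR_add_right)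
    hence "S *v ols n z = matrix_inv ?A *v (?A *v (S *v \<beta>))
        + matrix_inv ?A *v ((1 / real n) *\<^sub>R (\<Sum>k<n. noise (z k) *\<^sub>R ?x k))"
      by (simp add: ols_def cramer_solve_invertible[OF elim] matrix_vector_right_distrib)
    also have "matrix_inv ?A *v (?A *v (S *v \<beta>)) = S *v \<beta>"
      by (simp add: matrix_vector_mul_assoc matrix_inv_left_right[OF elim] matrix_mul_assoc)
    also have "matrix_inv ?A *v ((1 / real n) *\<^sub>R (\<Sum>k<n. noise (z k) *\<^sub>R ?x k))
        = (\<Sum>k<n. noise (z k) *\<^sub>R ((1 / real n) *\<^sub>R (matrix_inv ?A *v ?x k)))"
      by (simp add: matrix_vector_mult_scaleR linear_sum[OF matrix_vector_mul_linear] scaleR_sum_right mult.commute)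
    also have "\<dots> = (\<Sum>k<n. noise (z k) *\<^sub>R w k (?X z))"
      by (intro sum.cong refl) (simp add: w_def A_compose cramer_solve_invertible[OF elim] compose_eq)
    finally show ?case unfolding excess_risk_eq by simp
  qed
  hence "(\<integral>\<^sup>+z. ennreal (excess_risk PX \<sigma>2 P (ols n z)) \<partial>sample n)
      = (\<integral>\<^sup>+z. ennreal ((norm (\<Sum>k<n. noise (z k) *\<^sub>R w k (?X z)))\<^sup>2) \<partial>sample n)"
    by (intro nn_integral_cong_AE) (auto elim: eventually_mono)
  also have "\<dots> \<le> ennreal \<sigma>2 * (\<integral>\<^sup>+X. ennreal (\<Sum>k<n. (norm (w k X))\<^sup>2) \<partial>?PX)"
    by (rule nn_integral_noise_combination[OF w w_fin])
  also have "\<dots> \<le> ennreal \<sigma>2 * (ennreal (1 / real n) * ?E)"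
    by (intro mult_left_mono w_le) auto
  also have "\<dots> = ennreal (\<sigma>2 / real n) * ?E"
    using \<sigma>2 by (simp add: mult.assoc[symmetric] ennreal_mult'[symmetric])
  finally show ?thesis .
qed

section \<open>Gaussian posteriors and the Bayes lower bound\<close>

text \<open>The update of precision and mean when one Gaussian observation of \<open>m + s x\<close> is added to a Gaussian
  prior with mean \<open>\<mu>\<close> and precision \<open>J\<close>.\<close>

lemma quadratic_complete_square:
  fixes x y m \<mu> J \<sigma> s :: real
  assumes "J > 0" "\<sigma> > 0"
  defines "J' \<equiv> J + x\<^sup>2 / \<sigma>\<^sup>2"
  defines "\<mu>' \<equiv> (J * \<mu> + x * (y - m) / \<sigma>\<^sup>2) / J'"
  shows "(y - (m + s * x))\<^sup>2 / \<sigma>\<^sup>2 + J * (s - \<mu>)\<^sup>2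
    = J' * (s - \<mu>')\<^sup>2 + ((y - (m + \<mu>' * x))\<^sup>2 / \<sigma>\<^sup>2 + J * (\<mu>' - \<mu>)\<^sup>2)"
proof -
  have J': "J' > 0" using assms by (simp add: J'_def add_pos_nonneg)
  hence mu: "J' * \<mu>' = J * \<mu> + x * (y - m) / \<sigma>\<^sup>2" by (simp add: \<mu>'_def)
  define a where "a = 1 / \<sigma>\<^sup>2"
  have J'a: "J' = J + x\<^sup>2 * a" by (simp add: J'_def a_def)
  have mua: "(J + x\<^sup>2 * a) * \<mu>' = J * \<mu> + x * (y - m) * a" using mu by (simp add: J'a a_def)
  have "(y - (m + s * x))\<^sup>2 * a + J * (s - \<mu>)\<^sup>2 - ((J + x\<^sup>2 * a) * (s - \<mu>')\<^sup>2 + ((y - (m + \<mu>' * x))\<^sup>2 * a + J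
      * (\<mu>' - \<mu>)\<^sup>2))
     = 2 * (s - \<mu>') * ((J + x\<^sup>2 * a) * \<mu>' - (J * \<mu> + x * (y - m) * a))"
    by (simp add: power2_eq_square algebra_simps)
  thus ?thesis unfolding mua by (simp add: J'a a_def)
qed

lemma normal_density_precision:
  assumes "J > 0"
  shows "normal_density \<mu> (1 / sqrt J) s = sqrt (J / (2 * pi)) * exp (- (J * (s - \<mu>)\<^sup>2) / 2)"
  using assms by (simp add: normal_density_def power_divide real_sqrt_divide real_sqrt_mult field_simps)

text \<open>Conjugacy: as a function of the parameter \<open>s\<close>, likelihood times prior is a multiple of a normal density.
  Its precision \<open>J n\<close> is explicit and free of the responses; mass \<open>K\<close> and mean \<open>\<mu>\<close> remain existential.\<close>

lemma gaussian_posterior_kernel: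
  fixes x m y :: "nat \<Rightarrow> real"
  assumes "\<sigma> > 0" "\<tau> > 0"
  defines "J \<equiv> \<lambda>n. (\<Sum>k<n. (x k)\<^sup>2) / \<sigma>\<^sup>2 + 1 / \<tau>\<^sup>2"
  shows "\<exists>K \<mu>. K \<ge> 0 \<and> (\<forall>s. (\<Prod>k<n. normal_density (m k + s * x k) \<sigma> (y k)) * normal_density 0 \<tau> s
    = K * normal_density \<mu> (1 / sqrt (J n)) s)"
proof (induction n)
  case 0
  have "1 / sqrt (J 0) = \<tau>" using assms by (simp add: J_def real_sqrt_divide)
  thus ?case by (intro exI[of _ 1] exI[of _ 0]) simp
next
  case (Suc n)
  have J: "J k > 0" for k using assms by (auto simp: J_def intro!: add_nonneg_pos sum_nonneg divide_nonneg_pos)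
  obtain K \<mu> where K: "K \<ge> 0" and IH: "\<And>s. (\<Prod>k<n. normal_density (m k + s * x k) \<sigma> (y k)) * normal_density 0 \<tau> s
    = K * normal_density \<mu> (1 / sqrt (J n)) s" using Suc by blast
  have JS: "J (Suc n) = J n + (x n)\<^sup>2 / \<sigma>\<^sup>2" by (simp add: J_def add_divide_distrib)
  define \<mu>' where "\<mu>' = (J n * \<mu> + x n * (y n - m n) / \<sigma>\<^sup>2) / J (Suc n)"
  define E where "E = (y n - (m n + \<mu>' * x n))\<^sup>2 / \<sigma>\<^sup>2 + J n * (\<mu>' - \<mu>)\<^sup>2"
  define c where "c = K * sqrt (J n / (2 * pi)) / sqrt (2 * pi * \<sigma>\<^sup>2) * exp (- E / 2)"
  define K' where "K' = c / sqrt (J (Suc n) / (2 * pi))"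
  have "(\<Prod>k<Suc n. normal_density (m k + s * x k) \<sigma> (y k)) * normal_density 0 \<tau> s
      = K' * normal_density \<mu>' (1 / sqrt (J (Suc n))) s" for s
  proof -
    have "(\<Prod>k<Suc n. normal_density (m k + s * x k) \<sigma> (y k)) * normal_density 0 \<tau> s
      = K * normal_density \<mu> (1 / sqrt (J n)) s * normal_density (m n + s * x n) \<sigma> (y n)"
      unfolding IH[symmetric] by (simp add: mult_ac)
    also have "\<dots> = K * sqrt (J n / (2 * pi)) / sqrt (2 * pi * \<sigma>\<^sup>2)
        * (exp (- (J n * (s - \<mu>)\<^sup>2) / 2) * exp (- ((y n - (m n + s * x n))\<^sup>2 / \<sigma>\<^sup>2) / 2))"
      unfolding normal_density_precision[OF J] by (simp add: normal_density_def)
    also have "exp (- (J n * (s - \<mu>)\<^sup>2) / 2) * exp (- ((y n - (m n + s * x n))\<^sup>2 / \<sigma>\<^sup>2) / 2)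
       = exp (- ((y n - (m n + s * x n))\<^sup>2 / \<sigma>\<^sup>2 + J n * (s - \<mu>)\<^sup>2) / 2)"
      by (simp add: exp_add[symmetric] field_simps)
    also have "(y n - (m n + s * x n))\<^sup>2 / \<sigma>\<^sup>2 + J n * (s - \<mu>)\<^sup>2 = J (Suc n) * (s - \<mu>')\<^sup>2 + E"
      using quadratic_complete_square[OF J[of n] \<open>\<sigma> > 0\<close>, of "y n" "m n" s "x n" \<mu>] unfolding E_def \<mu>'_def JS .
    also have "exp (- (J (Suc n) * (s - \<mu>')\<^sup>2 + E) / 2) = exp (- E / 2) * exp (- (J (Suc n) * (s - \<mu>')\<^sup>2) / 2)"
      by (simp add: exp_add[symmetric] field_simps)
    finally show ?thesis
      unfolding normal_density_precision[OF J] K'_def c_def using J[of "Suc n"] by simp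
  qed
  moreover have "K' \<ge> 0" using K J[of n] J[of "Suc n"] by (simp add: K'_def c_def)
  ultimately show ?case by blast
qed

lemma normal_second_moment_about_point:
  assumes v: "v > 0"
  shows "ennreal (v\<^sup>2) \<le> (\<integral>\<^sup>+s. ennreal ((c - s)\<^sup>2 * normal_density \<mu> v s) \<partial>lborel)"
proof -
  have eq: "(c - s)\<^sup>2 * normal_density \<mu> v s = normal_density \<mu> v s * (s - \<mu>) ^ (2 * 1)
      + 2 * (\<mu> - c) * (normal_density \<mu> v s * (s - \<mu>) ^ (2 * 0 + 1)) + (\<mu> - c)\<^sup>2 * normal_density \<mu> v s" for s
    by (simp add: power2_eq_square algebra_simps)
  have i2: "has_bochner_integral lborel (\<lambda>s. normal_density \<mu> v s * (s - \<mu>) ^ (2 * 1)) (v\<^sup>2)"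
    using normal_moment_even[OF v, of \<mu> 1] by (simp add: fact_numeral)
  have i1: "has_bochner_integral lborel (\<lambda>s. normal_density \<mu> v s * (s - \<mu>) ^ (2 * 0 + 1)) 0"
    using normal_moment_odd[OF v, of \<mu> 0] by simp
  have i0: "has_bochner_integral lborel (normal_density \<mu> v) 1"
    using v by (simp add: has_bochner_integral_iff)
  have "has_bochner_integral lborel (\<lambda>s. (c - s)\<^sup>2 * normal_density \<mu> v s) (v\<^sup>2 + 2 * (\<mu> - c) * 0 + (\<mu> - c)\<^sup>2 * 1)"
    unfolding eq by (intro has_bochner_integral_add has_bochner_integral_mult_right i0 i1 i2)
  hence "(\<integral>\<^sup>+s. ennreal ((c - s)\<^sup>2 * normal_density \<mu> v s) \<partial>lborel) = ennreal (v\<^sup>2 + (\<mu> - c)\<^sup>2)"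
    by (subst nn_integral_eq_integral) (auto simp: has_bochner_integral_iff)
  thus ?thesis by (simp add: ennreal_leI)
qed

text \<open>For fixed data, no guess \<open>c\<close> beats the posterior variance.\<close>

lemma gaussian_posterior_variance_bound:
  fixes x m y :: "nat \<Rightarrow> real"
  assumes "\<sigma> > 0" "\<tau> > 0"
  shows "(\<integral>\<^sup>+s. ennreal ((\<Prod>k<n. normal_density (m k + s * x k) \<sigma> (y k)) * normal_density 0 \<tau> s) \<partial>lborel)
      * ennreal (1 / ((\<Sum>k<n. (x k)\<^sup>2) / \<sigma>\<^sup>2 + 1 / \<tau>\<^sup>2))
    \<le> (\<integral>\<^sup>+s. ennreal ((c - s)\<^sup>2 * ((\<Prod>k<n. normal_density (m k + s * x k) \<sigma> (y k)) * normal_density 0 \<tau> s)) \<partial>lborel)"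
proof -
  define J where "J = (\<Sum>k<n. (x k)\<^sup>2) / \<sigma>\<^sup>2 + 1 / \<tau>\<^sup>2"
  have J: "J > 0" using assms by (auto simp: J_def intro!: add_nonneg_pos sum_nonneg divide_nonneg_pos)
  obtain K \<mu> where K: "K \<ge> 0" and eq: "\<And>s. (\<Prod>k<n. normal_density (m k + s * x k) \<sigma> (y k)) * normal_density 0 \<tau> s
    = K * normal_density \<mu> (1 / sqrt J) s" unfolding J_def using gaussian_posterior_kernel[OF assms] by blast
  have v: "1 / sqrt J > 0" using J by simp
  have "(\<integral>\<^sup>+s. ennreal (K * normal_density \<mu> (1 / sqrt J) s) \<partial>lborel) = ennreal K"
    using K v by (subst nn_integral_eq_integral) auto
  moreover have "ennreal K * ennreal (1 / J) \<le> (\<integral>\<^sup>+s. ennreal ((c - s)\<^sup>2 * (K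
      * normal_density \<mu> (1 / sqrt J) s)) \<partial>lborel)"
  proof -
    have "ennreal (1 / J) \<le> (\<integral>\<^sup>+s. ennreal ((c - s)\<^sup>2 * normal_density \<mu> (1 / sqrt J) s) \<partial>lborel)"
      using normal_second_moment_about_point[OF v, of c \<mu>] J by (simp add: power_divide)
    hence "ennreal K * ennreal (1 / J) \<le> ennreal K * (\<integral>\<^sup>+s. ennreal ((c - s)\<^sup>2
        * normal_density \<mu> (1 / sqrt J) s) \<partial>lborel)"
      by (rule mult_left_mono) simp
    also have "\<dots> = (\<integral>\<^sup>+s. ennreal ((c - s)\<^sup>2 * (K * normal_density \<mu> (1 / sqrt J) s)) \<partial>lborel)"
      using K by (subst nn_integral_cmult[symmetric]) (auto simp: ennreal_mult'[symmetric] mult_ac)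
    finally show ?thesis .
  qed
  ultimately show ?thesis unfolding eq J_def[symmetric] by simp
qed

text \<open>Both measures agree on boxes.\<close>

lemma PiM_density_finite:
  fixes M :: "'a measure" and h :: "'a \<Rightarrow> ennreal"
  assumes M: "sigma_finite_measure M" and N: "sigma_finite_measure (density M h)" and h[measurable]: "h
      \<in> borel_measurable M" and I: "finite I"
  shows "(\<Pi>\<^sub>M k\<in>I. density M h) = density (\<Pi>\<^sub>M k\<in>I. M) (\<lambda>z. \<Prod>k\<in>I. h (z k))"
proof -
  interpret M: product_sigma_finite "\<lambda>_. M" using M by (simp add: product_sigma_finite_def)
  interpret N: product_sigma_finite "\<lambda>_. density M h" using N by (simp add: product_sigma_finite_def)
  show ?thesis
  proof (rule N.PiM_eqI[OF I, symmetric])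
    show "sets (density (\<Pi>\<^sub>M k\<in>I. M) (\<lambda>z. \<Prod>k\<in>I. h (z k))) = sets (\<Pi>\<^sub>M k\<in>I. density M h)"
      by (simp cong: sets_PiM_cong)
    fix A assume A: "\<And>i. i \<in> I \<Longrightarrow> A i \<in> sets (density M h)"
    have [measurable]: "A i \<in> sets M" if "i \<in> I" for i using A[OF that] by simp
    have "emeasure (density (\<Pi>\<^sub>M k\<in>I. M) (\<lambda>z. \<Prod>k\<in>I. h (z k))) (Pi\<^sub>E I A)
       = (\<integral>\<^sup>+z. (\<Prod>k\<in>I. h (z k)) * indicator (Pi\<^sub>E I A) z \<partial>(\<Pi>\<^sub>M k\<in>I. M))"
      using A by (intro emeasure_density sets_PiM_I_finite I) auto
    also have "\<dots> = (\<integral>\<^sup>+z. (\<Prod>k\<in>I. h (z k) * indicator (A k) (z k)) \<partial>(\<Pi>\<^sub>M k\<in>I. M))"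
    proof (intro nn_integral_cong)
      fix z assume z: "z \<in> space (\<Pi>\<^sub>M k\<in>I. M)"
      have "(\<Prod>k\<in>I. indicator (A k) (z k) :: ennreal) = indicator (Pi\<^sub>E I A) z"
      proof (cases "z \<in> Pi\<^sub>E I A")
        case False
        then obtain k where "k \<in> I" "z k \<notin> A k" using z by (auto simp: space_PiM PiE_def)
        thus ?thesis using False I by (auto simp: indicator_def intro!: prod_zero)
      qed (auto simp: indicator_def PiE_def Pi_def intro!: prod.neutral)
      thus "(\<Prod>k\<in>I. h (z k)) * indicator (Pi\<^sub>E I A) z = (\<Prod>k\<in>I. h (z k) * indicator (A k) (z k))"
        by (simp add: prod.distrib)
    qed
    also have "\<dots> = (\<Prod>k\<in>I. \<integral>\<^sup>+z. h z * indicator (A k) z \<partial>M)"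
      by (rule M.product_nn_integral_prod[OF I]) measurable
    also have "\<dots> = (\<Prod>k\<in>I. emeasure (density M h) (A k))"
      by (intro prod.cong refl emeasure_density[symmetric]) auto
    finally show "emeasure (density (\<Pi>\<^sub>M k\<in>I. M) (\<lambda>z. \<Prod>k\<in>I. h (z k))) (Pi\<^sub>E I A)
        = (\<Prod>k\<in>I. emeasure (density M h) (A k))" .
  qed
qed

context linear_design
begin

text \<open>The law of \<open>(X, \<langle>\<beta>, X\<rangle> + \<epsilon>)\<close> with Gaussian noise independent of \<open>X\<close>.  Defining it by a density gives all
  these laws a common dominating measure, so that parameters and data can be exchanged under the
  integral.\<close>

definition gaussian_model :: "real \<Rightarrow> real^'d \<Rightarrow> ((real^'d) \<times> real) measure" where
  "gaussian_model \<sigma> \<beta> = density (PX \<Otimes>\<^sub>M lborel) (\<lambda>p. ennreal (normal_density (\<beta> \<bullet> fst p) \<sigma> (snd p)))"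

lemma sets_pair_PX [measurable_cong]: "sets (PX \<Otimes>\<^sub>M (lborel :: real measure)) = sets borel"
proof -
  have "sets (PX \<Otimes>\<^sub>M (lborel :: real measure)) = sets (borel \<Otimes>\<^sub>M borel)"
    by (intro sets_pair_measure_cong) (simp_all add: sets_PX)
  thus ?thesis by (simp only: borel_prod)
qed

lemma measurable_fst_pair [measurable]: "fst \<in> PX \<Otimes>\<^sub>M (lborel :: real measure) \<rightarrow>\<^sub>M borel"
proof -
  have "fst \<in> PX \<Otimes>\<^sub>M (lborel :: real measure) \<rightarrow>\<^sub>M PX" by simp
  thus ?thesis by (simp cong: measurable_cong_sets add: sets_PX)
qed

lemma measurable_snd_pair [measurable]: "snd \<in> PX \<Otimes>\<^sub>M (lborel :: real measure) \<rightarrow>\<^sub>M borel"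
proof -
  have "snd \<in> PX \<Otimes>\<^sub>M (lborel :: real measure) \<rightarrow>\<^sub>M lborel" by (rule measurable_snd)
  thus ?thesis by simp
qed

lemma measurable_response:
  fixes n :: nat
  shows "k < n \<Longrightarrow> (\<lambda>z. snd (z k)) \<in> borel_measurable (\<Pi>\<^sub>M k\<in>{..<n}. PX \<Otimes>\<^sub>M (lborel :: real measure))"
  by (intro measurable_compose[OF _ measurable_snd_pair]) measurable

lemma measurable_whitened_covariate:
  fixes n :: nat
  shows "k < n \<Longrightarrow> (\<lambda>z. (W *v fst (z k)) $ j) \<in> borel_measurable (\<Pi>\<^sub>M k\<in>{..<n}. PX \<Otimes>\<^sub>M (lborel :: real measure))"
  by (intro borel_measurable_component measurable_compose[OF _ measurable_W] measurable_compose[OF _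
      measurable_fst_pair]) measurable

lemma sigma_finite_pair_PX: "sigma_finite_measure (PX \<Otimes>\<^sub>M (lborel :: real measure))"
  by (intro sigma_finite_pair_measure sigma_finite_measure_axioms lborel.sigma_finite_measure_axioms)

lemma sigma_finite_PiM_pair:
  fixes n :: nat
  shows "sigma_finite_measure (\<Pi>\<^sub>M k\<in>{..<n}. PX \<Otimes>\<^sub>M (lborel :: real measure))"
proof -
  interpret product_sigma_finite "\<lambda>_. PX \<Otimes>\<^sub>M (lborel :: real measure)"
    using sigma_finite_pair_PX by (simp add: product_sigma_finite_def)
  show ?thesis by (rule sigma_finite) simp
qed

lemma measurable_gaussian_density [measurable]:
  "(\<lambda>p. normal_density (\<beta> \<bullet> fst p) \<sigma> (snd p)) \<in> borel_measurable (PX \<Otimes>\<^sub>M lborel)"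
  unfolding normal_density_def by measurable

lemma nn_integral_gaussian_model:
  assumes F[measurable]: "F \<in> borel_measurable (PX \<Otimes>\<^sub>M lborel)"
  shows "(\<integral>\<^sup>+p. F p \<partial>gaussian_model \<sigma> \<beta>) = (\<integral>\<^sup>+x. (\<integral>\<^sup>+y. ennreal (normal_density (\<beta> \<bullet> x) \<sigma> y)
      * F (x, y) \<partial>lborel) \<partial>PX)"
  unfolding gaussian_model_def
  by (subst nn_integral_density, measurable, subst lborel.nn_integral_fst[symmetric], measurable)

lemma nn_integral_normal_density: "\<sigma> > 0 \<Longrightarrow> (\<integral>\<^sup>+y. ennreal (normal_density \<mu> \<sigma> y) \<partial>lborel) = 1"
  by (subst nn_integral_eq_integral) auto

lemma nn_integral_normal_variance: "\<sigma> > 0 \<Longrightarrow> (\<integral>\<^sup>+y. ennreal (normal_density \<mu> \<sigma> y * (y - \<mu>)\<^sup>2) \<partial>lborel)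
    = ennreal (\<sigma>\<^sup>2)"
  using normal_moment_even[of \<sigma> \<mu> 1]
  by (subst nn_integral_eq_integral) (auto simp: has_bochner_integral_iff fact_numeral)

lemma prob_space_gaussian_model:
  assumes "\<sigma> > 0"
  shows "prob_space (gaussian_model \<sigma> \<beta>)"
proof
  have "emeasure (gaussian_model \<sigma> \<beta>) (space (gaussian_model \<sigma> \<beta>)) = (\<integral>\<^sup>+p. 1 \<partial>gaussian_model \<sigma> \<beta>)" by simp
  also have "\<dots> = (\<integral>\<^sup>+x. 1 \<partial>PX)"
    by (subst nn_integral_gaussian_model) (simp_all add: nn_integral_normal_density assms)
  finally show "emeasure (gaussian_model \<sigma> \<beta>) (space (gaussian_model \<sigma> \<beta>)) = 1" using emeasure_space_1 by simp
qed

text \<open>Both conditional moments are identified by integrating over events \<open>{X \<in> B}\<close>, which generate the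
  \<open>\<sigma>\<close>-algebra of the covariate.\<close>

lemma well_specified_gaussian_model:
  assumes \<sigma>: "\<sigma> > 0"
  shows "well_specified_at PX (\<sigma>\<^sup>2) (gaussian_model \<sigma> \<beta>) \<beta>"
proof -
  let ?P = "gaussian_model \<sigma> \<beta>"
  interpret P: prob_space ?P by (rule prob_space_gaussian_model[OF \<sigma>])
  have sets_P0: "sets ?P = sets (PX \<Otimes>\<^sub>M lborel)" by (simp add: gaussian_model_def)
  have sets_P: "sets ?P = sets borel" unfolding sets_P0 by (rule sets_pair_PX)
  have space_P[simp]: "space ?P = UNIV" using sets_eq_imp_space_eq[OF sets_P] by simp
  have meas_P: "f \<in> ?P \<rightarrow>\<^sub>M N \<longleftrightarrow> f \<in> PX \<Otimes>\<^sub>M lborel \<rightarrow>\<^sub>M N" for f and N :: "'z measure"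
    using measurable_cong_sets[OF sets_P0 refl, of N] by simp
  have fst_P[measurable]: "fst \<in> ?P \<rightarrow>\<^sub>M borel" unfolding meas_P by measurable
  have res_pair[measurable]: "residual \<beta> \<in> borel_measurable (PX \<Otimes>\<^sub>M lborel)" unfolding residual_def[abs_def]
      by measurable
  hence res_P[measurable]: "residual \<beta> \<in> borel_measurable ?P" unfolding meas_P .
  have distr: "distr ?P borel fst = PX"
  proof (rule measure_eqI)
    fix A assume "A \<in> sets (distr ?P borel fst)"
    hence A[measurable]: "A \<in> sets borel" by simp
    hence A'[measurable]: "A \<in> sets PX" by (simp add: sets_PX)
    have "emeasure (distr ?P borel fst) A = (\<integral>\<^sup>+x. indicator A x \<partial>distr ?P borel fst)" by simp
    also have "\<dots> = (\<integral>\<^sup>+p. indicator A (fst p) \<partial>?P)" by (rule nn_integral_distr) measurable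
    also have "\<dots> = (\<integral>\<^sup>+x. (\<integral>\<^sup>+y. ennreal (normal_density (\<beta> \<bullet> x) \<sigma> y) * indicator A x \<partial>lborel) \<partial>PX)"
      by (subst nn_integral_gaussian_model) auto
    also have "\<dots> = emeasure PX A" by (simp add: nn_integral_multc nn_integral_normal_density \<sigma>)
    finally show "emeasure (distr ?P borel fst) A = emeasure PX A" .
  qed (simp add: sets_PX)
  have moment2: "(\<integral>\<^sup>+p. ennreal ((residual \<beta> p)\<^sup>2) * indicator A (fst p) \<partial>?P) = ennreal (\<sigma>\<^sup>2)
      * (\<integral>\<^sup>+p. indicator A (fst p) \<partial>?P)"
    if A[measurable]: "A \<in> sets borel" for A
  proof -
    have [measurable]: "A \<in> sets PX" using A by (simp add: sets_PX)
    have "(\<integral>\<^sup>+p. ennreal ((residual \<beta> p)\<^sup>2) * indicator A (fst p) \<partial>?P)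
      = (\<integral>\<^sup>+x. (\<integral>\<^sup>+y. ennreal (normal_density (\<beta> \<bullet> x) \<sigma> y) * (ennreal ((y - \<beta> \<bullet> x)\<^sup>2) * indicator A x) \<partial>lborel) \<partial>PX)"
      by (subst nn_integral_gaussian_model) (auto simp: residual_def)
    also have "\<dots> = (\<integral>\<^sup>+x. (\<integral>\<^sup>+y. ennreal (normal_density (\<beta> \<bullet> x) \<sigma> y * (y - \<beta> \<bullet> x)\<^sup>2) \<partial>lborel) * indicator A x \<partial>PX)"
      by (subst nn_integral_multc[symmetric]) (simp_all add: ennreal_mult mult.assoc)
    also have "\<dots> = ennreal (\<sigma>\<^sup>2) * (\<integral>\<^sup>+x. indicator A x \<partial>PX)"
      by (simp add: nn_integral_normal_variance \<sigma> nn_integral_cmult)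
    also have "(\<integral>\<^sup>+x. indicator A x \<partial>PX) = (\<integral>\<^sup>+p. indicator A (fst p) \<partial>?P)"
      by (subst distr[symmetric], subst nn_integral_distr) auto
    finally show ?thesis .
  qed
  have int2: "integrable ?P (\<lambda>p. (residual \<beta> p)\<^sup>2)"
  proof (rule integrableI_bounded)
    have "(\<integral>\<^sup>+p. ennreal (norm ((residual \<beta> p)\<^sup>2)) \<partial>?P) = ennreal (\<sigma>\<^sup>2)"
      using moment2[of UNIV] P.emeasure_space_1 by simp
    thus "(\<integral>\<^sup>+p. ennreal (norm ((residual \<beta> p)\<^sup>2)) \<partial>?P) < \<infinity>" by simp
  qed simp
  have int1: "integrable ?P (residual \<beta>)"
  proof (rule Bochner_Integration.integrable_bound[OF Bochner_Integration.integrable_add[OF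
      P.integrable_const[of 1] int2]])
    have "\<bar>a\<bar> \<le> 1 + a\<^sup>2" for a :: real
      using sum_squares_bound[of 1 "\<bar>a\<bar>"] abs_ge_zero[of a] by simp
    thus "AE p in ?P. norm (residual \<beta> p) \<le> norm (1 + (residual \<beta> p)\<^sup>2)" by simp
  qed (simp_all add: P.finite_measure_axioms)
  have sigma_sets: "\<exists>B\<in>sets borel. A = fst -` B" if "A \<in> sets (sigma_X ?P)" for A
    using that by (auto simp: sigma_X_def sets_vimage_algebra2)
  have "subalgebra ?P (sigma_X ?P)"
    using measurable_sets[OF fst_P] by (auto simp: subalgebra_def sigma_X_def sets_vimage_algebra2)
  then interpret cond: sigma_finite_subalgebra ?P "sigma_X ?P"
    by (intro finite_measure_subalgebra_is_sigma_finite finite_measure_subalgebra.intro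
      finite_measure_subalgebra_axioms.intro P.finite_measure_axioms)
  have "AE p in ?P. real_cond_exp ?P (sigma_X ?P) (residual \<beta>) p = 0"
  proof (rule cond.real_cond_exp_charact[OF _ int1])
    fix A assume "A \<in> sets (sigma_X ?P)"
    then obtain B where B[measurable]: "B \<in> sets borel" and A: "A = fst -` B" using sigma_sets by blast
    have [measurable]: "B \<in> sets PX" using B by (simp add: sets_PX)
    let ?f = "\<lambda>p. indicator B (fst p) * residual \<beta> p"
    have f_m: "?f \<in> borel_measurable (PX \<Otimes>\<^sub>M lborel)" by measurable
    have "integrable ?P ?f"
      by (rule Bochner_Integration.integrable_bound[OF int1]) (auto simp: indicator_def)
    hence int: "integrable (PX \<Otimes>\<^sub>M lborel) (\<lambda>p. normal_density (\<beta> \<bullet> fst p) \<sigma> (snd p) * ?f p)"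
      unfolding gaussian_model_def using f_m by (subst (asm) integrable_density) auto
    have "(LINT p|?P. ?f p) = (LINT p|(PX \<Otimes>\<^sub>M lborel). normal_density (\<beta> \<bullet> fst p) \<sigma> (snd p) * ?f p)"
      unfolding gaussian_model_def using f_m by (subst integral_density) auto
    also have "\<dots> = (LINT x|PX. (LINT y|lborel. normal_density (\<beta> \<bullet> x) \<sigma> y * (indicator B x * (y - \<beta> \<bullet> x))))"
    proof -
      interpret pair_sigma_finite PX "lborel :: real measure" by standard
      show ?thesis using integral_fst'[OF int] by (simp add: residual_def)
    qed
    also have "\<dots> = (LINT x|PX. 0)"
    proof (intro Bochner_Integration.integral_cong refl)
      fix x
      have "(LINT y|lborel. normal_density (\<beta> \<bullet> x) \<sigma> y * (y - \<beta> \<bullet> x)) = 0"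
        using integral_normal_moment_odd[OF \<sigma>, of "\<beta> \<bullet> x" 0] by simp
      hence "(LINT y|lborel. indicator B x * (normal_density (\<beta> \<bullet> x) \<sigma> y * (y - \<beta> \<bullet> x))) = 0" by simp
      thus "(LINT y|lborel. normal_density (\<beta> \<bullet> x) \<sigma> y * (indicator B x * (y - \<beta> \<bullet> x))) = 0"
          by (simp only: mult.left_commute)
    qed
    finally show "(LINT p:A|?P. residual \<beta> p) = (LINT p:A|?P. 0)"
      by (simp add: set_lebesgue_integral_def A indicator_vimage)
  qed simp_all
  moreover have "AE p in ?P. ennreal (\<sigma>\<^sup>2) = nn_cond_exp ?P (sigma_X ?P) (\<lambda>p. ennreal ((residual \<beta> p)\<^sup>2)) p"
  proof (rule cond.nn_cond_exp_charact)
    fix A assume "A \<in> sets (sigma_X ?P)"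
    then obtain B where B[measurable]: "B \<in> sets borel" and A: "A = fst -` B" using sigma_sets by blast
    have "(\<integral>\<^sup>+p. ennreal (\<sigma>\<^sup>2) * indicator B (fst p) \<partial>?P) = ennreal (\<sigma>\<^sup>2) * (\<integral>\<^sup>+p. indicator B (fst p) \<partial>?P)"
      by (rule nn_integral_cmult) measurable
    thus "(\<integral>\<^sup>+p\<in>A. ennreal ((residual \<beta> p)\<^sup>2) \<partial>?P) = (\<integral>\<^sup>+p\<in>A. ennreal (\<sigma>\<^sup>2) \<partial>?P)"
      using moment2[OF B] by (simp add: A indicator_vimage)
  qed simp_all
  ultimately show ?thesis
    unfolding well_specified_at_def using sets_P distr int1 P.prob_space_axioms by (auto elim: eventually_mono)
qed

end

context linear_design
begin

text \<open>Jensen's inequality for \<open>1 / J\<close>, by integrating the tangent line \<open>2 / q - J / q\<^sup>2\<close> at the mean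
  \<open>q = E J\<close>.  The prior precision keeps \<open>1 / J\<close> bounded.\<close>

lemma expected_inverse_information:
  assumes "\<sigma> > 0" "\<tau> > 0"
  shows "ennreal (1 / (real n / \<sigma>\<^sup>2 + 1 / \<tau>\<^sup>2))
    \<le> (\<integral>\<^sup>+z. ennreal (1 / ((\<Sum>k<n. ((W *v fst (z k)) $ i)\<^sup>2) / \<sigma>\<^sup>2 + 1 / \<tau>\<^sup>2)) \<partial>(\<Pi>\<^sub>M k\<in>{..<n}. gaussian_model \<sigma> \<beta>))"
proof -
  let ?PX = "\<Pi>\<^sub>M k\<in>{..<n}. PX"
  interpret law: well_specified_law PX "gaussian_model \<sigma> \<beta>" "\<sigma>\<^sup>2" \<beta>
    by unfold_locales (use well_specified_gaussian_model[OF \<open>\<sigma> > 0\<close>] assms in auto)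
  have PS: "prob_space ?PX" by (intro prob_space_PiM prob_space_axioms)
  then interpret PXn: prob_space ?PX .
  define J where "J = (\<lambda>X :: nat \<Rightarrow> real^'d. (\<Sum>k<n. ((W *v X k) $ i)\<^sup>2) / \<sigma>\<^sup>2 + 1 / \<tau>\<^sup>2)"
  define q where "q = real n / \<sigma>\<^sup>2 + 1 / \<tau>\<^sup>2"
  have q: "q > 0" using assms by (simp add: q_def add_nonneg_pos)
  have J: "J X \<ge> 1 / \<tau>\<^sup>2" "J X > 0" for X
  proof -
    show *: "J X \<ge> 1 / \<tau>\<^sup>2" using assms by (simp add: J_def sum_nonneg)
    show "J X > 0" by (rule less_le_trans[OF _ *]) (use assms in simp)
  qed
  have x[measurable]: "(\<lambda>X. (W *v X k) $ i) \<in> borel_measurable ?PX" if "k < n" for k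
    using that by (intro borel_measurable_component measurable_compose[OF _ measurable_W]) measurable
  have J_m[measurable]: "J \<in> borel_measurable ?PX" unfolding J_def by measurable
  have comp: "integrable ?PX (\<lambda>X. ((W *v X k) $ i)\<^sup>2)" "(LINT X|?PX. ((W *v X k) $ i)\<^sup>2) = 1" if "k < n" for k
  proof -
    have iso: "integrable PX (\<lambda>x. ((W *v x) $ i)\<^sup>2)" "(LINT x|PX. ((W *v x) $ i)\<^sup>2) = 1"
      using whitened_isotropic[of i i] by (simp_all add: power2_eq_square)
    show "integrable ?PX (\<lambda>X. ((W *v X k) $ i)\<^sup>2)" "(LINT X|?PX. ((W *v X k) $ i)\<^sup>2) = 1"
      using integrable_PiM_component[OF prob_space_axioms iso(1) that]
        integral_PiM_component[OF prob_space_axioms iso(1) that] by (simp_all add: iso(2))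
  qed
  have J_int: "integrable ?PX J" unfolding J_def
    by (intro Bochner_Integration.integrable_add integrable_divide Bochner_Integration.integrable_sum comp
        PXn.integrable_const) auto
  have "(LINT X|?PX. (\<Sum>k<n. ((W *v X k) $ i)\<^sup>2)) = real n"
    by (subst Bochner_Integration.integral_sum) (auto simp: comp)
  hence J_E: "(LINT X|?PX. J X) = q"
    unfolding J_def q_def by (subst Bochner_Integration.integral_add) (auto intro!: integrable_divide
        Bochner_Integration.integrable_sum comp PXn.integrable_const simp: PXn.prob_space)
  have inv_int: "integrable ?PX (\<lambda>X. 1 / J X)"
  proof (rule PXn.integrable_const_bound[of _ "\<tau>\<^sup>2"])
    have "1 / J X \<le> \<tau>\<^sup>2" for X using J[of X] assms by (simp add: field_simps)
    thus "AE X in ?PX. norm (1 / J X) \<le> \<tau>\<^sup>2" using J(2) by (simp add: less_imp_le)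
  qed measurable
  have "1 / q = (LINT X|?PX. 2 / q - J X / q\<^sup>2)"
    using q J_int J_E by (simp add: PXn.prob_space power2_eq_square)
  also have "\<dots> \<le> (LINT X|?PX. 1 / J X)"
  proof (rule integral_mono[OF _ inv_int])
    show "integrable ?PX (\<lambda>X. 2 / q - J X / q\<^sup>2)" using J_int by auto
    fix X
    have "0 \<le> (1 - J X / q)\<^sup>2 / J X" using J[of X] by simp
    also have "\<dots> = 1 / J X - (2 / q - J X / q\<^sup>2)" using J(2)[of X] q by (simp add: power2_eq_square field_simps)
    finally show "2 / q - J X / q\<^sup>2 \<le> 1 / J X" by simp
  qed
  finally have "ennreal (1 / q) \<le> ennreal (LINT X|?PX. 1 / J X)" by (rule ennreal_leI)
  also have "\<dots> = (\<integral>\<^sup>+X. ennreal (1 / J X) \<partial>?PX)"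
    using J(2) by (intro nn_integral_eq_integral[symmetric] inv_int) (simp add: less_imp_le)
  also have "\<dots> = (\<integral>\<^sup>+z. ennreal (1 / J (compose {..<n} fst z)) \<partial>law.sample n)"
    by (rule law.nn_integral_covariates[symmetric]) measurable
  also have "\<dots> = (\<integral>\<^sup>+z. ennreal (1 / ((\<Sum>k<n. ((W *v fst (z k)) $ i)\<^sup>2) / \<sigma>\<^sup>2 + 1 / \<tau>\<^sup>2)) \<partial>law.sample n)"
    by (simp add: J_def compose_eq)
  finally show ?thesis by (simp add: q_def)
qed

lemma nn_integral_gaussian_sample:
  fixes n :: nat
  assumes \<sigma>: "\<sigma> > 0" and F[measurable]: "F \<in> borel_measurable (\<Pi>\<^sub>M k\<in>{..<n}. PX \<Otimes>\<^sub>M lborel)"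
  shows "(\<integral>\<^sup>+z. F z \<partial>(\<Pi>\<^sub>M k\<in>{..<n}. gaussian_model \<sigma> (W *v vec_lambda g)))
    = (\<integral>\<^sup>+z. ennreal (\<Prod>k<n. normal_density (\<Sum>j\<in>UNIV. g j * (W *v fst (z k)) $ j) \<sigma> (snd (z k))) * F z
         \<partial>(\<Pi>\<^sub>M k\<in>{..<n}. PX \<Otimes>\<^sub>M lborel))"
proof -
  let ?D = "PX \<Otimes>\<^sub>M (lborel :: real measure)" and ?\<beta> = "W *v vec_lambda g"
  have "sigma_finite_measure (gaussian_model \<sigma> ?\<beta>)"
    using prob_space_gaussian_model[OF \<sigma>] by (rule prob_space_imp_sigma_finite)
  hence "(\<Pi>\<^sub>M k\<in>{..<n}. gaussian_model \<sigma> ?\<beta>) = density (\<Pi>\<^sub>M k\<in>{..<n}. ?D) (\<lambda>z. \<Prod>k<n. ennreal (normal_density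
      (?\<beta> \<bullet> fst (z k)) \<sigma> (snd (z k))))"
    unfolding gaussian_model_def by (intro PiM_density_finite sigma_finite_pair_PX finite_lessThan) auto
  moreover have "(\<lambda>z. ennreal (normal_density (?\<beta> \<bullet> fst (z k)) \<sigma> (snd (z k))))
      \<in> borel_measurable (\<Pi>\<^sub>M k\<in>{..<n}. ?D)" if "k < n" for k
    by (rule measurable_compose[of "\<lambda>z. z k" _ ?D "\<lambda>p. ennreal (normal_density (?\<beta> \<bullet> fst p) \<sigma> (snd p))"]) (use
        that in simp_all)
  ultimately have "(\<integral>\<^sup>+z. F z \<partial>(\<Pi>\<^sub>M k\<in>{..<n}. gaussian_model \<sigma> ?\<beta>))
    = (\<integral>\<^sup>+z. (\<Prod>k<n. ennreal (normal_density (?\<beta> \<bullet> fst (z k)) \<sigma> (snd (z k)))) * F z \<partial>(\<Pi>\<^sub>M k\<in>{..<n}. ?D))"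
    by (simp add: nn_integral_density borel_measurable_prod_ennreal)
  moreover have "?\<beta> \<bullet> fst (z k) = (\<Sum>j\<in>UNIV. g j * (W *v fst (z k)) $ j)" for z :: "nat \<Rightarrow> (real^'d) \<times> real" and k
    unfolding inner_W[symmetric] by (simp add: inner_vec_def)
  ultimately show ?thesis by (simp add: prod_ennreal)
qed

text \<open>The coordinates other than \<open>i\<close> are held fixed at \<open>g\<close>, which amounts to revealing them to the estimator.
  After exchanging the integrals over data and parameter, the posterior variance bound applies for each
  data set; exchanging them back, its inverse information is averaged over the data.\<close>

lemma bayes_risk_coordinate:
  fixes c :: "(nat \<Rightarrow> (real^'d) \<times> real) \<Rightarrow> real" and g :: "'d \<Rightarrow> real"
  assumes \<sigma>: "\<sigma> > 0" and \<tau>: "\<tau> > 0" and c[measurable]: "c \<in> borel_measurable (\<Pi>\<^sub>M k\<in>{..<n}. PX \<Otimes>\<^sub>M lborel)"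
  shows "ennreal (1 / (real n / \<sigma>\<^sup>2 + 1 / \<tau>\<^sup>2))
    \<le> (\<integral>\<^sup>+s. ennreal (normal_density 0 \<tau> s) * (\<integral>\<^sup>+z. ennreal ((c z - s)\<^sup>2)
        \<partial>(\<Pi>\<^sub>M k\<in>{..<n}. gaussian_model \<sigma> (W *v vec_lambda (g(i := s))))) \<partial>lborel)"
proof -
  let ?D = "PX \<Otimes>\<^sub>M (lborel :: real measure)"
  let ?\<mu> = "\<Pi>\<^sub>M k\<in>{..<n}. ?D"
  \<comment> \<open>response \<open>k\<close> has mean \<open>m z k + s * x z k\<close>; only the second term involves the unknown coordinate\<close>
  define m where "m = (\<lambda>z :: nat \<Rightarrow> (real^'d) \<times> real. \<lambda>k. \<Sum>j\<in>UNIV-{i}. g j * (W *v fst (z k)) $ j)"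
  define x where "x = (\<lambda>z :: nat \<Rightarrow> (real^'d) \<times> real. \<lambda>k. (W *v fst (z k)) $ i)"
  define L where "L = (\<lambda>s z. \<Prod>k<n. normal_density (m z k + s * x z k) \<sigma> (snd (z k)))"
  define J where "J = (\<lambda>z. (\<Sum>k<n. (x z k)\<^sup>2) / \<sigma>\<^sup>2 + 1 / \<tau>\<^sup>2)"
  interpret mu: sigma_finite_measure ?\<mu> by (rule sigma_finite_PiM_pair)
  have L0: "L s z \<ge> 0" for s z unfolding L_def by (intro prod_nonneg) auto
  note [measurable] = measurable_response measurable_whitened_covariate
  have [measurable]: "(\<lambda>z. x z k) \<in> borel_measurable ?\<mu>" "(\<lambda>z. m z k) \<in> borel_measurable ?\<mu>" if "k < n" for k
    using that unfolding x_def m_def by measurable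
  have L_m[measurable]: "(\<lambda>p. L (fst p) (snd p)) \<in> borel_measurable (lborel \<Otimes>\<^sub>M ?\<mu>)"
    unfolding L_def normal_density_def by measurable
  have L_s[measurable]: "L s \<in> borel_measurable ?\<mu>" for s
    unfolding L_def normal_density_def by measurable
  have J_m[measurable]: "J \<in> borel_measurable ?\<mu>" unfolding J_def by measurable
  have lik: "(\<integral>\<^sup>+z. F z \<partial>(\<Pi>\<^sub>M k\<in>{..<n}. gaussian_model \<sigma> (W *v vec_lambda (g(i := s)))))
      = (\<integral>\<^sup>+z. ennreal (L s z) * F z \<partial>?\<mu>)"
    if F[measurable]: "F \<in> borel_measurable ?\<mu>" for F s
  proof -
    have "(\<Sum>j\<in>UNIV. (g(i := s)) j * (W *v fst (z k)) $ j) = m z k + s * x z k" for z k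
    proof -
      have "(\<Sum>j\<in>UNIV. (g(i := s)) j * (W *v fst (z k)) $ j) = s * x z k + (\<Sum>j\<in>UNIV-{i}. (g(i := s)) j
          * (W *v fst (z k)) $ j)"
        by (subst sum.remove[of _ i]) (auto simp: x_def)
      also have "(\<Sum>j\<in>UNIV-{i}. (g(i := s)) j * (W *v fst (z k)) $ j) = m z k"
        unfolding m_def by (intro sum.cong) auto
      finally show ?thesis by simp
    qed
    thus ?thesis unfolding nn_integral_gaussian_sample[OF \<sigma> F] L_def by simp
  qed
  have "ennreal (1 / (real n / \<sigma>\<^sup>2 + 1 / \<tau>\<^sup>2)) = (\<integral>\<^sup>+s. ennreal (normal_density 0 \<tau> s)
      * ennreal (1 / (real n / \<sigma>\<^sup>2 + 1 / \<tau>\<^sup>2)) \<partial>lborel)"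
    by (subst nn_integral_multc) (simp_all add: nn_integral_normal_density \<tau>)
  also have "\<dots> \<le> (\<integral>\<^sup>+s. ennreal (normal_density 0 \<tau> s) * (\<integral>\<^sup>+z. ennreal (L s z) * ennreal (1 / J z) \<partial>?\<mu>) \<partial>lborel)"
  proof (intro nn_integral_mono mult_left_mono)
    fix s :: real
    show "ennreal (1 / (real n / \<sigma>\<^sup>2 + 1 / \<tau>\<^sup>2)) \<le> (\<integral>\<^sup>+z. ennreal (L s z) * ennreal (1 / J z) \<partial>?\<mu>)"
      using expected_inverse_information[OF \<sigma> \<tau>, where n = n and i = i and \<beta> = "W *v vec_lambda (g(i := s))"]
      by (subst lik[symmetric]) (simp_all add: J_def x_def del: fun_upd_apply)
  qed simp
  also have "\<dots> = (\<integral>\<^sup>+s. (\<integral>\<^sup>+z. ennreal (L s z * normal_density 0 \<tau> s) * ennreal (1 / J z) \<partial>?\<mu>) \<partial>lborel)"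
    by (intro nn_integral_cong, subst nn_integral_cmult[symmetric]) (auto simp: ennreal_mult L0 mult_ac)
  also have "\<dots> = (\<integral>\<^sup>+z. (\<integral>\<^sup>+s. ennreal (L s z * normal_density 0 \<tau> s) * ennreal (1 / J z) \<partial>lborel) \<partial>?\<mu>)"
  proof -
    interpret pair_sigma_finite "lborel :: real measure" ?\<mu> by standard
    have "(\<lambda>(s, z). ennreal (L s z * normal_density 0 \<tau> s) * ennreal (1 / J z)) \<in> borel_measurable (lborel \<Otimes>\<^sub>M ?\<mu>)"
      using L_m unfolding case_prod_beta by measurable
    from Fubini'[OF this] show ?thesis by simp
  qed
  also have "\<dots> \<le> (\<integral>\<^sup>+z. (\<integral>\<^sup>+s. ennreal ((c z - s)\<^sup>2 * (L s z * normal_density 0 \<tau> s)) \<partial>lborel) \<partial>?\<mu>)"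
  proof (rule nn_integral_mono)
    fix z
    have "(\<lambda>s. ennreal (L s z * normal_density 0 \<tau> s)) \<in> borel_measurable lborel"
      unfolding L_def normal_density_def by measurable
    thus "(\<integral>\<^sup>+s. ennreal (L s z * normal_density 0 \<tau> s) * ennreal (1 / J z) \<partial>lborel)
        \<le> (\<integral>\<^sup>+s. ennreal ((c z - s)\<^sup>2 * (L s z * normal_density 0 \<tau> s)) \<partial>lborel)"
      using gaussian_posterior_variance_bound[OF \<sigma> \<tau>, where n = n and m = "m z" and x = "x z" and y
          = "\<lambda>k. snd (z k)" and c = "c z"]
      by (simp add: nn_integral_multc L_def J_def)
  qed
  also have "\<dots> = (\<integral>\<^sup>+s. (\<integral>\<^sup>+z. ennreal ((c z - s)\<^sup>2 * (L s z * normal_density 0 \<tau> s)) \<partial>?\<mu>) \<partial>lborel)"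
  proof -
    interpret pair_sigma_finite "lborel :: real measure" ?\<mu> by standard
    have "(\<lambda>(s, z). ennreal ((c z - s)\<^sup>2 * (L s z * normal_density 0 \<tau> s))) \<in> borel_measurable (lborel \<Otimes>\<^sub>M ?\<mu>)"
      using L_m unfolding case_prod_beta by measurable
    from Fubini'[OF this] show ?thesis by simp
  qed
  also have "\<dots> = (\<integral>\<^sup>+s. ennreal (normal_density 0 \<tau> s) * (\<integral>\<^sup>+z. ennreal (L s z) * ennreal ((c z - s)\<^sup>2) \<partial>?\<mu>) \<partial>lborel)"
    by (intro nn_integral_cong, subst nn_integral_cmult[symmetric]) (auto simp: ennreal_mult L0 mult_ac)
  also have "\<dots> = (\<integral>\<^sup>+s. ennreal (normal_density 0 \<tau> s) * (\<integral>\<^sup>+z. ennreal ((c z - s)\<^sup>2)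
      \<partial>(\<Pi>\<^sub>M k\<in>{..<n}. gaussian_model \<sigma> (W *v vec_lambda (g(i := s))))) \<partial>lborel)"
    by (intro nn_integral_cong arg_cong2[where f = "(*)"] refl lik[symmetric]) measurable
  finally show ?thesis .
qed

end

section \<open>The minimax risk\<close>

text \<open>The supremum of the risk is at least its average over the prior, and the squared distance splits into one
  term per coordinate.\<close>

lemma (in linear_design) bayes_lower_bound:
  assumes \<sigma>: "\<sigma> > 0" and \<tau>: "\<tau> > 0" and b: "b \<in> estimators n"
  shows "ennreal (real CARD('d) / (real n / \<sigma>\<^sup>2 + 1 / \<tau>\<^sup>2))
    \<le> (SUP P\<in>P_well PX (\<sigma>\<^sup>2). \<integral>\<^sup>+z. ennreal (excess_risk PX (\<sigma>\<^sup>2) P (b z)) \<partial>(\<Pi>\<^sub>M k\<in>{..<n}. P))" (is "_ \<le> ?SUP")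
proof -
  let ?D = "PX \<Otimes>\<^sub>M (lborel :: real measure)"
  let ?\<mu> = "\<Pi>\<^sub>M k\<in>{..<n}. ?D"
  let ?G = "\<lambda>g. \<Pi>\<^sub>M k\<in>{..<n}. gaussian_model \<sigma> (W *v vec_lambda g)"
  define a where "a = 1 / (real n / \<sigma>\<^sup>2 + 1 / \<tau>\<^sup>2)"
  have a0: "a \<ge> 0" by (simp add: a_def)
  define N where "N = density lborel (\<lambda>s. ennreal (normal_density 0 \<tau> s))"
  have N: "prob_space N" unfolding N_def by (rule prob_space_normal_density[OF \<tau>])
  have sets_N[measurable_cong]: "sets N = sets borel" by (simp add: N_def)
  interpret N: product_prob_space "\<lambda>_::'d. N" UNIV
    using N by (simp add: product_prob_space_def product_prob_space_axioms_def product_sigma_finite_def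
        prob_space_imp_sigma_finite)
  interpret mu: sigma_finite_measure ?\<mu> by (rule sigma_finite_PiM_pair)
  have sets_mu: "sets ?\<mu> = sets (\<Pi>\<^sub>M k\<in>{..<n}. (borel :: ((real^'d) \<times> real) measure))"
    by (intro sets_PiM_cong refl sets_pair_PX)
  have b_m[measurable]: "b \<in> borel_measurable ?\<mu>"
    using b unfolding estimators_def by (simp cong: measurable_cong_sets add: sets_mu)
  define c where "c = (\<lambda>i z. (S *v b z) $ i)"
  have c_m[measurable]: "c i \<in> borel_measurable ?\<mu>" for i
    unfolding c_def by (intro borel_measurable_component measurable_compose[OF b_m measurable_S])
  define R where "R = (\<lambda>i g. \<integral>\<^sup>+z. ennreal ((c i z - g i)\<^sup>2) \<partial>?G g)"
  have R_le: "(\<Sum>i\<in>UNIV. R i g) \<le> ?SUP" for g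
  proof -
    let ?\<beta> = "W *v vec_lambda g"
    note ws = well_specified_gaussian_model[OF \<sigma>, of ?\<beta>]
    interpret law: well_specified_law PX "gaussian_model \<sigma> ?\<beta>" "\<sigma>\<^sup>2" ?\<beta>
      by unfold_locales (use ws \<sigma> in auto)
    have sets_G: "sets (?G g) = sets ?\<mu>"
      by (intro sets_PiM_cong refl) (simp add: gaussian_model_def)
    have "(\<Sum>i\<in>UNIV. R i g) = (\<integral>\<^sup>+z. (\<Sum>i\<in>UNIV. ennreal ((c i z - g i)\<^sup>2)) \<partial>?G g)"
      unfolding R_def by (rule nn_integral_sum[symmetric]) (simp add: measurable_cong_sets[OF sets_G refl])
    also have "\<dots> = (\<integral>\<^sup>+z. ennreal (excess_risk PX (\<sigma>\<^sup>2) (gaussian_model \<sigma> ?\<beta>) (b z)) \<partial>?G g)"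
    proof (intro nn_integral_cong)
      fix z
      have "(norm (S *v b z - S *v ?\<beta>))\<^sup>2 = (\<Sum>i\<in>UNIV. (c i z - g i)\<^sup>2)"
        by (simp add: norm_vec_def L2_set_def sum_nonneg c_def)
      thus "(\<Sum>i\<in>UNIV. ennreal ((c i z - g i)\<^sup>2)) = ennreal (excess_risk PX (\<sigma>\<^sup>2) (gaussian_model \<sigma> ?\<beta>) (b z))"
        unfolding law.excess_risk_eq by (simp add: sum_ennreal)
    qed
    also have "\<dots> \<le> ?SUP"
      using ws by (intro SUP_upper) (auto simp: P_well_def)
    finally show ?thesis .
  qed
  have R_m[measurable]: "R i \<in> borel_measurable (\<Pi>\<^sub>M j\<in>UNIV. N)" for i
  proof -
    note [measurable] = measurable_response measurable_whitened_covariate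
    have "R i = (\<lambda>g. \<integral>\<^sup>+z. ennreal (\<Prod>k<n. normal_density (\<Sum>j\<in>UNIV. g j * (W *v fst (z k)) $ j) \<sigma> (snd (z k)))
        * ennreal ((c i z - g i)\<^sup>2) \<partial>?\<mu>)"
      unfolding R_def by (intro ext nn_integral_gaussian_sample[OF \<sigma>]) measurable
    thus ?thesis unfolding normal_density_def by simp
  qed
  have R_avg: "ennreal a \<le> (\<integral>\<^sup>+g. R i g \<partial>(\<Pi>\<^sub>M j\<in>UNIV. N))" for i
  proof -
    define I where "I = UNIV - {i}"
    have I: "finite I" "i \<notin> I" and UI: "(UNIV :: 'd set) = insert i I" by (auto simp: I_def)
    have R_m': "R i \<in> borel_measurable (\<Pi>\<^sub>M j\<in>insert i I. N)" using R_m[of i] UI by simp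
    have PS: "prob_space (\<Pi>\<^sub>M j\<in>I. N)" by (intro prob_space_PiM N)
    have "ennreal a = (\<integral>\<^sup>+g. ennreal a \<partial>(\<Pi>\<^sub>M j\<in>I. N))" using prob_space.emeasure_space_1[OF PS] by simp
    also have "\<dots> \<le> (\<integral>\<^sup>+g. (\<integral>\<^sup>+s. R i (g(i := s)) \<partial>N) \<partial>(\<Pi>\<^sub>M j\<in>I. N))"
    proof (intro nn_integral_mono)
      fix g assume g: "g \<in> space (\<Pi>\<^sub>M j\<in>I. N)"
      have "(\<lambda>s. R i (g(i := s))) \<in> borel_measurable N"
        by (rule measurable_compose[OF measurable_component_update[OF g I(2)] R_m'])
      hence "(\<lambda>s. R i (g(i := s))) \<in> borel_measurable lborel" by (simp cong: measurable_cong_sets add: sets_N)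
      hence "(\<integral>\<^sup>+s. R i (g(i := s)) \<partial>N) = (\<integral>\<^sup>+s. ennreal (normal_density 0 \<tau> s) * R i (g(i := s)) \<partial>lborel)"
        unfolding N_def by (intro nn_integral_density) auto
      thus "ennreal a \<le> (\<integral>\<^sup>+s. R i (g(i := s)) \<partial>N)"
        using bayes_risk_coordinate[OF \<sigma> \<tau> c_m[of i], where i = i and g = g] by (simp add: R_def a_def)
    qed
    also have "\<dots> = (\<integral>\<^sup>+g. R i g \<partial>(\<Pi>\<^sub>M j\<in>insert i I. N))"
      by (rule N.product_nn_integral_insert[OF I R_m', symmetric])
    finally show ?thesis using UI by simp
  qed
  have "ennreal (real CARD('d) / (real n / \<sigma>\<^sup>2 + 1 / \<tau>\<^sup>2)) = (\<Sum>i\<in>(UNIV::'d set). ennreal a)"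
    using a0 by (simp add: a_def ennreal_of_nat_eq_real_of_nat ennreal_mult[symmetric])
  also have "\<dots> \<le> (\<Sum>i\<in>UNIV. \<integral>\<^sup>+g. R i g \<partial>(\<Pi>\<^sub>M j\<in>UNIV. N))" by (intro sum_mono R_avg)
  also have "\<dots> = (\<integral>\<^sup>+g. (\<Sum>i\<in>UNIV. R i g) \<partial>(\<Pi>\<^sub>M j\<in>UNIV. N))" by (rule nn_integral_sum[symmetric]) measurable
  also have "\<dots> \<le> (\<integral>\<^sup>+g. ?SUP \<partial>(\<Pi>\<^sub>M j\<in>(UNIV :: 'd set). N))" by (rule nn_integral_mono) (rule R_le)
  also have "\<dots> = ?SUP"
    using prob_space.emeasure_space_1[OF prob_space_PiM[of UNIV "\<lambda>_::'d. N"]] N by simp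
  finally show ?thesis .
qed

text \<open>Let the prior variance tend to infinity.\<close>

lemma (in linear_design) minimax_lower_bound:
  assumes "\<sigma>2 > 0" and "n \<ge> 1"
  shows "ennreal (\<sigma>2 * real CARD('d) / real n) \<le> minimax_excess_risk PX \<sigma>2 n"
  unfolding minimax_excess_risk_def
proof (rule INF_greatest)
  fix b :: "(nat \<Rightarrow> (real^'d) \<times> real) \<Rightarrow> real^'d" assume b: "b \<in> estimators n"
  let ?SUP = "SUP P\<in>P_well PX \<sigma>2. \<integral>\<^sup>+z. ennreal (excess_risk PX \<sigma>2 P (b z)) \<partial>(\<Pi>\<^sub>M k\<in>{..<n}. P)"
  have bound: "ennreal (real CARD('d) / (real n / \<sigma>2 + 1 / (real (Suc m))\<^sup>2)) \<le> ?SUP" for m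
    using bayes_lower_bound[of "sqrt \<sigma>2" "real (Suc m)", OF _ _ b] assms by simp
  have "(\<lambda>m. real CARD('d) / (real n / \<sigma>2 + (1 / real (Suc m))\<^sup>2)) \<longlonglongrightarrow> real CARD('d) / (real n / \<sigma>2 + 0\<^sup>2)"
    using assms by (intro tendsto_intros lim_1_over_n[THEN LIMSEQ_Suc]) auto
  hence "(\<lambda>m. ennreal (real CARD('d) / (real n / \<sigma>2 + 1 / (real (Suc m))\<^sup>2))) \<longlonglongrightarrow> ennreal (\<sigma>2 * real CARD('d) / real n)"
    by (intro tendsto_ennrealI) (simp add: power_divide mult.commute)
  thus "ennreal (\<sigma>2 * real CARD('d) / real n) \<le> ?SUP"
    by (rule LIMSEQ_le_const2) (use bound in auto)
qed

lemma (in linear_design) minimax_upper_bound: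
  assumes "\<sigma>2 > 0" and "n \<ge> 1" and fin: "expected_trace_inv PX n < \<infinity>"
  shows "minimax_excess_risk PX \<sigma>2 n \<le> ennreal (\<sigma>2 / real n) * expected_trace_inv PX n"
  unfolding minimax_excess_risk_def
proof (rule INF_lower2[OF ols_in_estimators], rule SUP_least)
  fix P assume "P \<in> P_well PX \<sigma>2"
  then obtain \<beta> where "well_specified_at PX \<sigma>2 P \<beta>" by (auto simp: P_well_def)
  then interpret well_specified_law PX P \<sigma>2 \<beta> by unfold_locales (use assms in auto)
  show "(\<integral>\<^sup>+z. ennreal (excess_risk PX \<sigma>2 P (ols n z)) \<partial>(\<Pi>\<^sub>M k\<in>{..<n}. P)) \<le> ennreal (\<sigma>2 / real n)
      * expected_trace_inv PX n"
    by (rule expected_excess_risk_ols[OF \<open>n \<ge> 1\<close> fin])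
qed

theorem theorem3:
  fixes PX :: "(real ^ 'd) measure" and n :: nat and \<sigma>2 C \<alpha> \<kappa> C' :: real
  assumes "prob_space PX" and "sets PX = sets borel"
    and "integrable PX (\<lambda>x. (norm x)\<^sup>2)"
    and "invertible (second_moment PX)"
    and "n \<ge> 1" and "\<sigma>2 > 0"
    and "C \<ge> 1" and "0 < \<alpha>" and "\<alpha> \<le> 1" and "small_ball PX C \<alpha>"
    and "\<kappa> > 0" and "norm_kurtosis PX \<kappa>"
    and "C' = 3 * C ^ 4 * exp (1 + 9 / \<alpha>)"
    and "real n \<ge> max (6 / \<alpha> * real CARD('d)) (12 / \<alpha> * ln (12 / \<alpha>))"
  shows "ennreal (1 / real n) * expected_trace_inv PX n
           \<le> ennreal (real CARD('d) / real n + 8 * C' * \<kappa> * (real CARD('d) / real n)\<^sup>2)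
       \<and> ennreal (\<sigma>2 * real CARD('d) / real n) \<le> minimax_excess_risk PX \<sigma>2 n
       \<and> minimax_excess_risk PX \<sigma>2 n
           \<le> ennreal (\<sigma>2 * real CARD('d) / real n * (1 + 8 * C' * (\<kappa> * real CARD('d) / real n)))"
proof -
  interpret linear_design PX
    using assms by (simp add: linear_design_def linear_design_axioms_def)
  let ?d = "real CARD('d)"
  have C'0: "C' \<ge> 0" using assms by simp
  have W_m: "(\<lambda>x. W *v x) \<in> borel_measurable PX" by measurable
  have k4: "(\<integral>\<^sup>+x. ennreal (norm (W *v x) ^ 4) \<partial>PX) \<le> ennreal (\<kappa> * ?d ^ 2)"
    using assms by (simp add: norm_kurtosis_def)
  have int4: "integrable PX (\<lambda>x. norm (W *v x) ^ 4)"
    by (rule integrableI_bounded) (use W_m le_less_trans[OF k4] in auto)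
  have "ennreal (LINT x|PX. norm (W *v x) ^ 4) \<le> ennreal (\<kappa> * ?d ^ 2)"
    using k4 by (subst nn_integral_eq_integral[OF int4, symmetric]) auto
  hence kurt: "(LINT x|PX. norm (W *v x) ^ 4) \<le> \<kappa> * ?d ^ 2" using assms by simp
  have E: "expected_trace_inv PX n \<le> ennreal (?d + 8 * C' * \<kappa> * ?d ^ 2 / real n)"
    unfolding expected_trace_inv_def whitened_sample_cov_eq
    using assms by (intro expected_trace_inv_sample_cov[OF prob_space_axioms W_m whitened_isotropic int4 kurt
          whitened_small_ball]) auto
  have n0: "real n > 0" using assms by simp
  have A: "ennreal (1 / real n) * expected_trace_inv PX n
           \<le> ennreal (?d / real n + 8 * C' * \<kappa> * (?d / real n)\<^sup>2)"
  proof -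
    have "ennreal (1 / real n) * expected_trace_inv PX n \<le> ennreal (1 / real n) * ennreal (?d + 8 * C' * \<kappa>
        * ?d ^ 2 / real n)"
      by (intro mult_left_mono E) simp
    also have "\<dots> = ennreal (?d / real n + 8 * C' * \<kappa> * (?d / real n)\<^sup>2)"
      using n0 by (simp add: ennreal_mult'[symmetric] power2_eq_square add_divide_distrib)
    finally show ?thesis .
  qed
  have fin: "expected_trace_inv PX n < \<infinity>" using E by (rule le_less_trans) simp
  have "minimax_excess_risk PX \<sigma>2 n \<le> ennreal (\<sigma>2 / real n) * expected_trace_inv PX n"
    by (rule minimax_upper_bound) (use assms fin in auto)
  also have "\<dots> = ennreal \<sigma>2 * (ennreal (1 / real n) * expected_trace_inv PX n)"
    using assms by (simp add: mult.assoc[symmetric] ennreal_mult'[symmetric])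
  also have "\<dots> \<le> ennreal \<sigma>2 * ennreal (?d / real n + 8 * C' * \<kappa> * (?d / real n)\<^sup>2)"
    by (intro mult_left_mono A) simp
  also have "\<dots> = ennreal (\<sigma>2 * ?d / real n * (1 + 8 * C' * (\<kappa> * ?d / real n)))"
    using assms by (simp add: ennreal_mult'[symmetric] power2_eq_square algebra_simps)
  finally have U: "minimax_excess_risk PX \<sigma>2 n \<le> ennreal (\<sigma>2 * ?d / real n * (1 + 8 * C' * (\<kappa> * ?d / real n)))" .
  have "ennreal (\<sigma>2 * ?d / real n) \<le> minimax_excess_risk PX \<sigma>2 n"
    by (rule minimax_lower_bound) (use assms in auto)
  with A U show ?thesis by blast
qed

end
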